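(* Let $V$ be an $n$-dimensional complex vector space with a nondegenerate symmetric bilinear form, $O(V)$ its orthogonal group, and $\Lambda(\Lambda_2(V))$ the exterior algebra on $\Lambda_2(V)$ with the natural action of $O(V)$. Let $A=(a_{ij})_{1\le i,j\le n}\in\operatorname{Mat}_{n,n}(\Lambda(\Lambda_2(V)))$ and $q_{4k+3}=\operatorname{tr}(A^{4k+3})$. Then $\Lambda(\Lambda_2(V))^{O(V)}$ is generated by the following elements, and these elements anticommute with each other and have no other relations (so the products $q_{k_1}\cdots q_{k_d}$ with $k_1<\cdots<k_d$ taken from the list form a linear basis): $$q_3,q_7,q_{11},\ldots,q_{4m-5}\quad\text{if } n=2m,\qquad q_3,q_7,q_{11},\ldots,q_{4m-1}\quad\text{if } n=2m+1.$$
   Context: $e_1,\ldots,e_n$ is an orthonormal basis of $V$ and $a_{ij}=e_i\wedge e_j\in\Lambda_2(V)$ (so $a_{ji}=-a_{ij}$, $a_{ii}=0$). Products in $\Lambda(\Lambda_2(V))$ are exterior products; matrix products are taken with entries multiplied in the order written. $O(V)$ acts on $\Lambda_2(V)$ naturally and on $\Lambda(\Lambda_2(V))$ by induced algebra automorphisms. *)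

theory Defs
  imports Complex_Main "HOL-Library.Product_Lexorder"
begin

text \<open>Exterior algebra Lambda(Lambda_2(V)), V = C^n with orthonormal basis e_0..e_(n-1).
  Lambda_2(V) has basis a_ij = e_i /\ e_j, i<j, indexed by pairs (i,j).
  An element of the exterior algebra is a coefficient function on finite sets S of pairs:
  x S is the coefficient of the monomial a_p1 /\ ... /\ a_pr with p1 < ... < pr
  (lexicographic order) the elements of S.\<close>

type_synonym ext = "(nat \<times> nat) set \<Rightarrow> complex"

definition pairs :: "nat \<Rightarrow> (nat \<times> nat) set" where
  "pairs n = {(i,j). i < j \<and> j < n}"

definition elem :: "nat \<Rightarrow> ext \<Rightarrow> bool" where
  "elem n x \<longleftrightarrow> (\<forall>S. x S \<noteq> 0 \<longrightarrow> S \<subseteq> pairs n)"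

definition ezero :: ext where "ezero = (\<lambda>S. 0)"
definition eone :: ext where "eone = (\<lambda>S. if S = {} then 1 else 0)"
definition eadd :: "ext \<Rightarrow> ext \<Rightarrow> ext" where "eadd x y = (\<lambda>S. x S + y S)"
definition eneg :: "ext \<Rightarrow> ext" where "eneg x = (\<lambda>S. - x S)"
definition escale :: "complex \<Rightarrow> ext \<Rightarrow> ext" where "escale c x = (\<lambda>S. c * x S)"
definition esum :: "'i set \<Rightarrow> ('i \<Rightarrow> ext) \<Rightarrow> ext" where
  "esum I f = (\<lambda>S. \<Sum>i\<in>I. f i S)"

text \<open>number of inversions when concatenating the sorted lists of T and U\<close>
definition inv_count :: "(nat \<times> nat) set \<Rightarrow> (nat \<times> nat) set \<Rightarrow> nat" where
  "inv_count T U = card {(t,u). t \<in> T \<and> u \<in> U \<and> u < t}"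

definition emul :: "ext \<Rightarrow> ext \<Rightarrow> ext" where
  "emul x y = (\<lambda>S. \<Sum>T\<in>Pow S. (-1) ^ inv_count T (S - T) * x T * y (S - T))"

definition eprod :: "ext list \<Rightarrow> ext" where
  "eprod xs = foldr emul xs eone"

text \<open>the element a_ij = e_i /\ e_j (so a_ji = - a_ij, a_ii = 0)\<close>
definition agen :: "nat \<Rightarrow> nat \<Rightarrow> ext" where
  "agen i j = (\<lambda>S. if i < j \<and> S = {(i,j)} then 1
                  else if j < i \<and> S = {(j,i)} then -1 else 0)"

type_synonym emat = "nat \<Rightarrow> nat \<Rightarrow> ext"

definition mmul :: "nat \<Rightarrow> emat \<Rightarrow> emat \<Rightarrow> emat" where
  "mmul n M N = (\<lambda>i j. esum {..<n} (\<lambda>k. emul (M i k) (N k j)))"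

definition mone :: emat where
  "mone = (\<lambda>i j. if i = j then eone else ezero)"

primrec mpow :: "nat \<Rightarrow> emat \<Rightarrow> nat \<Rightarrow> emat" where
  "mpow n M 0 = mone"
| "mpow n M (Suc k) = mmul n (mpow n M k) M"

definition mtrace :: "nat \<Rightarrow> emat \<Rightarrow> ext" where
  "mtrace n M = esum {..<n} (\<lambda>i. M i i)"

definition qtr :: "nat \<Rightarrow> nat \<Rightarrow> ext" where
  "qtr n k = mtrace n (mpow n agen k)"

definition orth :: "nat \<Rightarrow> (nat \<Rightarrow> nat \<Rightarrow> complex) \<Rightarrow> bool" where
  "orth n g \<longleftrightarrow> (\<forall>i<n. \<forall>j<n. (\<Sum>k<n. g k i * g k j) = (if i = j then 1 else 0))"

text \<open>g (e_i /\ e_j) = (g e_i) /\ (g e_j), with g e_i = sum_k g_ki e_k\<close>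
definition gimg :: "nat \<Rightarrow> (nat \<Rightarrow> nat \<Rightarrow> complex) \<Rightarrow> nat \<times> nat \<Rightarrow> ext" where
  "gimg n g p = esum ({..<n} \<times> {..<n})
      (\<lambda>(k,l). escale (g k (fst p) * g l (snd p)) (agen k l))"

definition act :: "nat \<Rightarrow> (nat \<Rightarrow> nat \<Rightarrow> complex) \<Rightarrow> ext \<Rightarrow> ext" where
  "act n g x = esum (Pow (pairs n))
      (\<lambda>S. escale (x S) (eprod (map (gimg n g) (sorted_list_of_set S))))"

definition invariant :: "nat \<Rightarrow> ext \<Rightarrow> bool" where
  "invariant n x \<longleftrightarrow> elem n x \<and> (\<forall>g. orth n g \<longrightarrow> act n g x = x)"

definition ngen :: "nat \<Rightarrow> nat" where
  "ngen n = (if even n then n div 2 - 1 else n div 2)"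

definition gq :: "nat \<Rightarrow> nat \<Rightarrow> ext" where
  "gq n k = qtr n (4 * k + 3)"

definition qprod :: "nat \<Rightarrow> nat set \<Rightarrow> ext" where
  "qprod n J = eprod (map (gq n) (sorted_list_of_set J))"

end

theory Submission
  imports Defs "Jordan_Normal_Form.Determinant"
begin

text \<open>
  Write \<open>A\<close> for the matrix of generators. An invariant orthogonal to all products of traces \<open>tr (A^k)\<close>
  gives an invariant tensor all of whose complete contractions vanish, since a complete contraction of
  a product of entries of \<open>A\<close> is, up to sign, such a product. A tensor of this kind is zero, by induction on
  \<open>n\<close>: a contraction over \<open>n\<close> basis vectors is one over \<open>n + 1\<close> of them minus a term carrying the last
  vector twice, and the value of an invariant tensor at \<open>(e,\<dots>,e)\<close> is a multiple of the sum of the values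
  of its contractions. Hence the trace products span the invariants.

  Transposition and cyclicity leave only \<open>tr (A^(4k+3))\<close>, and \<open>A^(2n-2) = 0\<close> by Kostant and Rowen, because
  the adjoint of multiplication by \<open>A^2\<close> maps \<open>A^(2n-2)\<close> to zero. This leaves the \<open>q\<close> of the list. For odd \<open>n\<close>
  the volume form is invariant, so their full product, the only one of top degree, is not zero; for even
  \<open>n\<close> restrict to \<open>n - 1\<close>. A nonzero full product of anticommuting elements makes all products independent.
\<close>

section \<open>The exterior algebra as a ring\<close>

text \<open>The form used for orthogonality is bilinear over the complex numbers, so it has
  isotropic vectors. Whatever is shown to vanish by its norm (entries of \<open>A^(2n-2)\<close>,
  Gram-Schmidt residues of trace products) has real coefficients, and there the form is a sum of
  squares. The group enters the spanning argument only through plane rotations to first order and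
  reflections of basis vectors. These conditions are linear, survive contraction, and pass to the
  first \<open>n\<close> basis vectors when some positions are filled with the last one, as the
  induction on the dimension requires. They are also easy to check for the volume form. In the
  nilpotency argument one contraction of \<open>A^r\<close> with \<open>A\<close> leaves terms
  \<open>tr (A^p) A^(r-1-p)\<close>. The second contraction removes them: products of two traces
  cancel by anticommutation, and single traces cancel because a nonzero \<open>tr (A^p)\<close> with
  \<open>p > 0\<close> has \<open>p = 3\<close> modulo 4, while the coefficients have period 4 in
  the exponent. A multiple of \<open>A^(r-2)\<close> remains, and the factor is zero for
  \<open>r = 2n-2\<close>.\<close>

lemma inv_count_empty [simp]: "inv_count {} U = 0" "inv_count T {} = 0"
  by (simp_all add: inv_count_def)

lemma finite_inv_pairs: "finite T \<Longrightarrow> finite U \<Longrightarrow> finite {(t,u). t \<in> T \<and> u \<in> U \<and> u < t}"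
  by (rule finite_subset[of _ "T \<times> U"]) auto

lemma inv_count_Un_left:
  assumes "finite T" "finite T'" "finite U" "T \<inter> T' = {}"
  shows "inv_count (T \<union> T') U = inv_count T U + inv_count T' U"
proof -
  have "{(t,u). t \<in> T \<union> T' \<and> u \<in> U \<and> u < t}
      = {(t,u). t \<in> T \<and> u \<in> U \<and> u < t} \<union> {(t,u). t \<in> T' \<and> u \<in> U \<and> u < t}" by auto
  then show ?thesis unfolding inv_count_def
    using assms by (simp only:, subst card_Un_disjoint) (blast intro: finite_inv_pairs)+
qed

lemma inv_count_Un_right:
  assumes "finite T" "finite U" "finite U'" "U \<inter> U' = {}"
  shows "inv_count T (U \<union> U') = inv_count T U + inv_count T U'"
proof -
  have "{(t,u). t \<in> T \<and> u \<in> U \<union> U' \<and> u < t}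
      = {(t,u). t \<in> T \<and> u \<in> U \<and> u < t} \<union> {(t,u). t \<in> T \<and> u \<in> U' \<and> u < t}" by auto
  then show ?thesis unfolding inv_count_def
    using assms by (simp only:, subst card_Un_disjoint) (blast intro: finite_inv_pairs)+
qed

lemma inv_count_swap:
  assumes "finite T" "finite U" "T \<inter> U = {}"
  shows "inv_count T U + inv_count U T = card T * card U"
proof -
  have "inv_count U T = card {(t,u). t \<in> T \<and> u \<in> U \<and> t < u}"
    unfolding inv_count_def
    by (rule bij_betw_same_card[of prod.swap], rule bij_betw_byWitness[of _ prod.swap]) auto
  moreover have "T \<times> U = {(t,u). t \<in> T \<and> u \<in> U \<and> u < t} \<union> {(t,u). t \<in> T \<and> u \<in> U \<and> t < u}"
  proof -
    have "u < t \<or> t < u" if "t \<in> T" "u \<in> U" for t u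
      using that assms(3) less_linear[of t u] by blast
    then show ?thesis by blast
  qed
  moreover have "finite {(t,u). t \<in> T \<and> u \<in> U \<and> t < u}"
    by (rule finite_subset[of _ "T \<times> U"]) (use assms in auto)
  moreover have "{(t,u). t \<in> T \<and> u \<in> U \<and> u < t} \<inter> {(t,u). t \<in> T \<and> u \<in> U \<and> t < u} = {}"
    using less_asym by blast
  ultimately show ?thesis
    unfolding inv_count_def card_cartesian_product[symmetric]
    using finite_inv_pairs[OF assms(1,2)] by (simp add: card_Un_disjoint)
qed

text \<open>For an infinite \<open>S\<close> the sum in \<open>emul\<close> ranges over an infinite
  set and is 0 by convention, so \<open>eone\<close> acts as a unit only on coefficient functions
  that vanish on infinite sets. These form the ring.\<close>

typedef ea = "{x :: ext. \<forall>S. infinite S \<longrightarrow> x S = 0}"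
  morphisms cf Abs_ea
  by (rule exI[of _ "\<lambda>S. 0"]) simp

setup_lifting type_definition_ea

lemma cf_infinite [simp]: "infinite S \<Longrightarrow> cf x S = 0"
  using cf[of x] by simp

lemma ea_eqI: "(\<And>S. finite S \<Longrightarrow> cf x S = cf y S) \<Longrightarrow> x = y"
  by (metis cf_infinite cf_inject ext)

text \<open>Both sides are sums over ordered partitions of \<open>S\<close> into three blocks; the
  signs agree because \<open>inv_count\<close> is additive in each argument over disjoint
  unions.\<close>

lemma emul_assoc:
  assumes "finite S"
  shows "emul (emul x y) z S = emul x (emul y z) S"
proof -
  let ?s = "\<lambda>n. (-1 :: complex) ^ n"
  have "emul (emul x y) z S = (\<Sum>(T,U)\<in>(SIGMA T:Pow S. Pow T).
      ?s (inv_count T (S - T)) * (?s (inv_count U (T - U)) * x U * y (T - U)) * z (S - T))"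
    unfolding emul_def sum_distrib_left sum_distrib_right
    by (subst sum.Sigma) (use assms in \<open>auto intro: finite_subset[of _ S]\<close>)
  also have "\<dots> = (\<Sum>(U,W)\<in>(SIGMA U:Pow S. Pow (S - U)).
      ?s (inv_count U (S - U)) * x U * (?s (inv_count W (S - U - W)) * y W * z (S - U - W)))"
  proof (rule sum.reindex_bij_witness[of _ "\<lambda>(U,W). (U \<union> W, U)" "\<lambda>(T,U). (U, T - U)"])
    fix a assume a: "a \<in> (SIGMA T:Pow S. Pow T)"
    obtain T U where [simp]: "a = (T,U)" and T: "T \<subseteq> S" and U: "U \<subseteq> T" using a by auto
    have f: "finite T" "finite U" "finite (T - U)" "finite (S - T)"
      using T U assms by (auto intro: finite_subset[of _ S])
    have e: "T = U \<union> (T - U)" "S - U = (T - U) \<union> (S - T)" "S - U - (T - U) = S - T"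
      using T U by blast+
    have "inv_count T (S - T) = inv_count U (S - T) + inv_count (T - U) (S - T)"
      using inv_count_Un_left[of U "T - U" "S - T"] f e(1) by simp
    moreover have "inv_count U (S - U) = inv_count U (T - U) + inv_count U (S - T)"
      using inv_count_Un_right[of U "T - U" "S - T"] f e(2) by auto
    ultimately show "(case case a of (T, U) \<Rightarrow> (U, T - U) of (U, W) \<Rightarrow>
        ?s (inv_count U (S - U)) * x U * (?s (inv_count W (S - U - W)) * y W * z (S - U - W)))
      = (case a of (T, U) \<Rightarrow>
        ?s (inv_count T (S - T)) * (?s (inv_count U (T - U)) * x U * y (T - U)) * z (S - T))"
      by (simp add: e(3) power_add)
  qed auto
  also have "\<dots> = emul x (emul y z) S"
    unfolding emul_def sum_distrib_left
    by (subst sum.Sigma) (use assms in \<open>auto intro: finite_subset[of _ S]\<close>)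
  finally show ?thesis .
qed

instantiation ea :: ring_1
begin
lift_definition zero_ea :: ea is "\<lambda>S. 0" by simp
lift_definition one_ea :: ea is eone by (auto simp: eone_def)
lift_definition plus_ea :: "ea \<Rightarrow> ea \<Rightarrow> ea" is eadd by (simp add: eadd_def)
lift_definition uminus_ea :: "ea \<Rightarrow> ea" is eneg by (simp add: eneg_def)
lift_definition minus_ea :: "ea \<Rightarrow> ea \<Rightarrow> ea" is "\<lambda>x y S. x S - y S" by simp
lift_definition times_ea :: "ea \<Rightarrow> ea \<Rightarrow> ea" is emul
  by (simp add: emul_def)
instance
proof
  fix a b c :: ea
  show "a * b * c = a * (b * c)"
    by (rule ea_eqI) (simp add: times_ea.rep_eq emul_assoc)
  show "1 * a = a"
  proof (rule ea_eqI)
    fix S :: "(nat \<times> nat) set" assume S: "finite S"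
    have "cf (1 * a) S = (\<Sum>T\<in>Pow S. if T = {} then cf a S else 0)"
      unfolding times_ea.rep_eq one_ea.rep_eq emul_def
      by (rule sum.cong) (auto simp: eone_def)
    then show "cf (1 * a) S = cf a S" using S by (simp add: sum.delta)
  qed
  show "a * 1 = a"
  proof (rule ea_eqI)
    fix S :: "(nat \<times> nat) set" assume S: "finite S"
    have "cf (a * 1) S = (\<Sum>T\<in>Pow S. if T = S then cf a S else 0)"
      unfolding times_ea.rep_eq one_ea.rep_eq emul_def
      by (rule sum.cong) (auto simp: eone_def)
    then show "cf (a * 1) S = cf a S" using S by (simp add: sum.delta)
  qed
  show "(a + b) * c = a * c + b * c"
    by (rule ea_eqI) (simp add: times_ea.rep_eq plus_ea.rep_eq emul_def eadd_def
        distrib_left distrib_right sum.distrib)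
  show "a * (b + c) = a * b + a * c"
    by (rule ea_eqI) (simp add: times_ea.rep_eq plus_ea.rep_eq emul_def eadd_def
        distrib_left distrib_right sum.distrib)
  show "(0::ea) \<noteq> 1"
  proof
    assume "(0::ea) = 1"
    then have "cf 0 {} = cf 1 {}" by simp
    then show False by (simp add: zero_ea.rep_eq one_ea.rep_eq eone_def)
  qed
  note reps = plus_ea.rep_eq uminus_ea.rep_eq minus_ea.rep_eq zero_ea.rep_eq eadd_def eneg_def
  show "a + b + c = a + (b + c)" by (rule ea_eqI) (simp add: reps)
  show "a + b = b + a" by (rule ea_eqI) (simp add: reps add.commute)
  show "0 + a = a" by (rule ea_eqI) (simp add: reps)
  show "- a + a = 0" by (rule ea_eqI) (simp add: reps)
  show "a - b = a + - b" by (rule ea_eqI) (simp add: reps)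
qed
end

lemma cf_0 [simp]: "cf 0 S = 0" by (simp add: zero_ea.rep_eq)
lemma cf_1: "cf 1 S = (if S = {} then 1 else 0)" by (simp add: one_ea.rep_eq eone_def)
lemma cf_add [simp]: "cf (x + y) S = cf x S + cf y S" by (simp add: plus_ea.rep_eq eadd_def)
lemma cf_uminus [simp]: "cf (- x) S = - cf x S" by (simp add: uminus_ea.rep_eq eneg_def)
lemma cf_minus [simp]: "cf (x - y) S = cf x S - cf y S" by (simp add: minus_ea.rep_eq)
lemma cf_mult: "cf (x * y) S = (\<Sum>T\<in>Pow S. (-1) ^ inv_count T (S - T) * cf x T * cf y (S - T))"
  by (simp add: times_ea.rep_eq emul_def)
lemma cf_sum [simp]: "cf (sum f I) S = (\<Sum>i\<in>I. cf (f i) S)"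
  by (induction I rule: infinite_finite_induct) auto

lemma ea_eq_uminus_self: "(x :: ea) = - x \<Longrightarrow> x = 0"
proof (rule ea_eqI)
  fix S :: "(nat \<times> nat) set"
  assume "x = - x"
  then have "cf x S = - cf x S" by (metis cf_uminus)
  then show "cf x S = cf 0 S" by simp
qed

definition cst :: "complex \<Rightarrow> ea" where
  "cst c = Abs_ea (\<lambda>S. if S = {} then c else 0)"

lemma cf_cst: "cf (cst c) S = (if S = {} then c else 0)"
  unfolding cst_def by (subst Abs_ea_inverse) auto

lemma cf_cst_mult [simp]: "cf (cst c * x) S = c * cf x S"
proof (cases "finite S")
  case True
  have "cf (cst c * x) S = (\<Sum>T\<in>Pow S. if T = {} then c * cf x S else 0)"
    unfolding cf_mult cf_cst by (rule sum.cong) auto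
  then show ?thesis using True by (simp add: sum.delta)
qed simp

lemma cf_mult_cst [simp]: "cf (x * cst c) S = c * cf x S"
proof (cases "finite S")
  case True
  have "cf (x * cst c) S = (\<Sum>T\<in>Pow S. if T = S then c * cf x S else 0)"
    unfolding cf_mult cf_cst by (rule sum.cong) auto
  then show ?thesis using True by (simp add: sum.delta)
qed simp

lemma cst_commute: "x * cst c = cst c * x"
  by (rule ea_eqI) simp

lemma cst_0 [simp]: "cst 0 = 0" and cst_1 [simp]: "cst 1 = 1"
  by (rule ea_eqI, simp add: cf_cst cf_1)+

lemma cst_add: "cst (a + b) = cst a + cst b"
  by (rule ea_eqI) (simp add: cf_cst)

lemma cst_minus: "cst (- a) = - cst a"
  by (rule ea_eqI) (simp add: cf_cst)

lemma cst_mult: "cst (a * b) = cst a * cst b"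
  by (rule ea_eqI) (simp add: cf_cst)

lemma cst_sum: "cst (sum f I) = (\<Sum>i\<in>I. cst (f i))"
  by (rule ea_eqI) (simp add: cf_cst)

lemma cst_of_int: "cst (of_int k) = of_int k"
proof -
  have n: "cst (of_nat m) = of_nat m" for m by (induction m) (auto simp: cst_add)
  show ?thesis by (cases k rule: int_cases2) (auto simp: n cst_minus)
qed

lemma cst_mult_eq_0: "cst c * x = 0 \<Longrightarrow> c \<noteq> 0 \<Longrightarrow> x = 0"
  by (rule ea_eqI) (metis cf_0 cf_cst_mult mult_eq_0_iff)

lemma sign_swap:
  assumes "finite T" "finite U" "T \<inter> U = {}"
  shows "(-1::complex) ^ inv_count T U = (-1) ^ (card T * card U) * (-1) ^ inv_count U T"
proof -
  have "(-1::complex) ^ (card T * card U) * (-1) ^ inv_count U T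
     = (-1) ^ inv_count T U * ((-1) ^ inv_count U T * (-1) ^ inv_count U T)"
    unfolding inv_count_swap[OF assms, symmetric] power_add by simp
  then show ?thesis by (simp add: power_add[symmetric])
qed

text \<open>Exchanging \<open>T\<close> with its complement costs
  \<open>(-1)^(card T * card (S - T))\<close>, where only parities matter. The hypotheses therefore
  ask for a parity and not a degree.\<close>

lemma supercommute:
  assumes "\<And>S. cf x S \<noteq> 0 \<Longrightarrow> even (card S) = even k"
    and "\<And>S. cf y S \<noteq> 0 \<Longrightarrow> even (card S) = even l"
  shows "x * y = (-1) ^ (k * l) * (y * x)"
proof (rule ea_eqI)
  fix S :: "(nat \<times> nat) set" assume S: "finite S"
  have m: "(-1) ^ (k * l) = cst ((-1) ^ (k * l))"
    by (cases "even (k * l)") (auto simp: cst_minus)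
  have "cf (x * y) S = (\<Sum>T\<in>Pow S. (-1) ^ (k * l) * ((-1) ^ inv_count (S - T) T * cf y (S - T) * cf x T))"
    unfolding cf_mult
  proof (rule sum.cong)
    fix T assume T: "T \<in> Pow S"
    then have f: "finite T" "finite (S - T)" using S by (auto intro: finite_subset[of _ S])
    show "(-1) ^ inv_count T (S - T) * cf x T * cf y (S - T)
      = (-1) ^ (k * l) * ((-1) ^ inv_count (S - T) T * cf y (S - T) * cf x T)"
    proof (cases "cf x T = 0 \<or> cf y (S - T) = 0")
      case False
      then have "even (card T) = even k" "even (card (S - T)) = even l" using assms by auto
      then have "(-1::complex) ^ (card T * card (S - T)) = (-1) ^ (k * l)"
        by (simp add: power_mult uminus_power_if)
      then show ?thesis using sign_swap[OF f] by simp
    qed auto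
  qed simp
  also have "\<dots> = (-1) ^ (k * l) * cf (y * x) S"
    unfolding cf_mult sum_distrib_left[symmetric]
    by (rule arg_cong[of _ _ "(*) _"],
        rule sum.reindex_bij_witness[of _ "\<lambda>T. S - T" "\<lambda>T. S - T"]) (auto simp: double_diff)
  finally show "cf (x * y) S = cf ((-1) ^ (k * l) * (y * x)) S" unfolding m by simp
qed

section \<open>Sign automorphisms, contractions and the bilinear form\<close>

text \<open>The automorphism that multiplies the generator \<open>p\<close> by
  \<open>(-1)^(w p)\<close>. The constant weight 1 gives the grading involution \<open>gi\<close>;
  counting the occurrences of one index gives the reflection of a basis vector.\<close>

definition sgn_aut :: "(nat \<times> nat \<Rightarrow> nat) \<Rightarrow> ea \<Rightarrow> ea" where
  "sgn_aut w x = Abs_ea (\<lambda>S. (-1) ^ sum w S * cf x S)"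

lemma cf_sgn_aut [simp]: "cf (sgn_aut w x) S = (-1) ^ sum w S * cf x S"
  unfolding sgn_aut_def by (subst Abs_ea_inverse) auto

lemma sgn_aut_mult: "sgn_aut w (x * y) = sgn_aut w x * sgn_aut w y"
proof (rule ea_eqI)
  fix S :: "(nat \<times> nat) set" assume S: "finite S"
  show "cf (sgn_aut w (x * y)) S = cf (sgn_aut w x * sgn_aut w y) S"
    unfolding cf_sgn_aut cf_mult sum_distrib_left
  proof (rule sum.cong)
    fix T assume "T \<in> Pow S"
    then have "sum w S = sum w T + sum w (S - T)"
      using S by (metis PowD add.commute sum.subset_diff)
    then show "(- 1) ^ sum w S * ((- 1) ^ inv_count T (S - T) * cf x T * cf y (S - T))
      = (- 1) ^ inv_count T (S - T) * ((- 1) ^ sum w T * cf x T) * ((- 1) ^ sum w (S - T) * cf y (S - T))"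
      by (simp add: power_add)
  qed simp
qed

lemma sgn_aut_1 [simp]: "sgn_aut w 1 = 1"
  by (rule ea_eqI) (simp add: cf_1)

lemma sgn_aut_0 [simp]: "sgn_aut w 0 = 0"
  by (rule ea_eqI) simp

lemma sgn_aut_add: "sgn_aut w (x + y) = sgn_aut w x + sgn_aut w y"
  by (rule ea_eqI) (simp add: algebra_simps)

lemma sgn_aut_uminus: "sgn_aut w (- x) = - sgn_aut w x"
  by (rule ea_eqI) simp

lemma sgn_aut_sum: "sgn_aut w (sum f I) = (\<Sum>i\<in>I. sgn_aut w (f i))"
  by (induction I rule: infinite_finite_induct) (auto simp: sgn_aut_add)

abbreviation gi :: "ea \<Rightarrow> ea" where "gi \<equiv> sgn_aut (\<lambda>_. Suc 0)"

definition parity :: "nat \<Rightarrow> ea \<Rightarrow> bool" where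
  "parity k x \<longleftrightarrow> gi x = (-1) ^ k * x"

lemma ea_power_m1: "(-1 :: ea) ^ k = (if even k then 1 else -1)"
  by (simp add: uminus_power_if)

lemma parity_card: "parity k x \<Longrightarrow> cf x S \<noteq> 0 \<Longrightarrow> even (card S) = even k"
proof -
  assume "parity k x" and n: "cf x S \<noteq> 0"
  then have "cf (gi x) S = cf ((-1) ^ k * x) S" by (simp add: parity_def)
  with n show ?thesis by (cases "even k"; cases "even (card S)") (auto simp: ea_power_m1)
qed

lemma parity_commute: "parity k x \<Longrightarrow> parity l y \<Longrightarrow> x * y = (-1) ^ (k * l) * (y * x)"
  by (rule supercommute) (auto dest: parity_card)

lemma parity_mult: "parity k x \<Longrightarrow> parity l y \<Longrightarrow> parity (k + l) (x * y)"
  by (auto simp: parity_def sgn_aut_mult ea_power_m1)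

lemma parity_0 [simp]: "parity k 0" by (simp add: parity_def)
lemma parity_1 [simp]: "parity 0 1" by (simp add: parity_def)
lemma parity_uminus: "parity k x \<Longrightarrow> parity k (- x)" by (simp add: parity_def sgn_aut_uminus)
lemma parity_sum: "(\<And>i. i \<in> I \<Longrightarrow> parity k (f i)) \<Longrightarrow> parity k (sum f I)"
  by (simp add: parity_def sgn_aut_sum sum_distrib_left)

text \<open>\<open>iop p\<close> is the interior product with the generator \<open>p\<close>, the adjoint of left multiplication by it.\<close>

definition iop :: "nat \<times> nat \<Rightarrow> ea \<Rightarrow> ea" where
  "iop p x = Abs_ea (\<lambda>S. if p \<in> S then 0 else (-1) ^ inv_count {p} S * cf x (insert p S))"

lemma cf_iop: "cf (iop p x) S = (if p \<in> S then 0 else (-1) ^ inv_count {p} S * cf x (insert p S))"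
  unfolding iop_def by (subst Abs_ea_inverse) auto

lemma iop_add: "iop p (x + y) = iop p x + iop p y"
  by (rule ea_eqI) (simp add: cf_iop algebra_simps)

lemma iop_uminus: "iop p (- x) = - iop p x"
  by (rule ea_eqI) (simp add: cf_iop)

lemma iop_0 [simp]: "iop p 0 = 0"
  by (rule ea_eqI) (simp add: cf_iop)

lemma iop_1 [simp]: "iop p 1 = 0"
  by (rule ea_eqI) (simp add: cf_iop cf_1)

text \<open>If \<open>p\<close> lies in \<open>S\<close>, the left side has coefficient 0 and the
  terms on the right cancel in pairs \<open>T\<close>, \<open>insert p T\<close>. Otherwise a subset
  of \<open>insert p S\<close> contains \<open>p\<close> or does not, which gives the two terms of
  this graded Leibniz rule.\<close>

lemma iop_mult: "iop p (x * y) = iop p x * y + gi x * iop p y"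
proof (rule ea_eqI)
  fix S :: "(nat \<times> nat) set" assume S: "finite S"
  let ?s = "\<lambda>n. (-1 :: complex) ^ n"
  show "cf (iop p (x * y)) S = cf (iop p x * y + gi x * iop p y) S"
  proof (cases "p \<in> S")
    case True
    have "cf (iop p x * y) S + cf (gi x * iop p y) S
      = (\<Sum>T\<in>Pow S. ?s (inv_count T (S - T)) *
          (cf (iop p x) T * cf y (S - T) + cf (gi x) T * cf (iop p y) (S - T)))"
      unfolding cf_mult sum.distrib[symmetric] by (simp add: algebra_simps)
    also have "\<dots> = (\<Sum>T\<in>Pow S. ?s (inv_count T (S - T)) *
          ((if p \<in> T then 0 else ?s (inv_count {p} T) * cf x (insert p T) * cf y (S - T))
          + (if p \<in> T then ?s (card T) * cf x T * (?s (inv_count {p} (S - T)) * cf y (insert p (S - T))) else 0)))"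
      using True by (intro sum.cong refl) (auto simp: cf_iop)
    also have "\<dots> = (\<Sum>T\<in>Pow S. if p \<in> T then 0 else ?s (inv_count T (S - T)) *
           (?s (inv_count {p} T) * cf x (insert p T) * cf y (S - T)))
       + (\<Sum>T\<in>Pow S. if p \<in> T then ?s (inv_count T (S - T)) *
           (?s (card T) * cf x T * (?s (inv_count {p} (S - T)) * cf y (insert p (S - T)))) else 0)"
      unfolding sum.distrib[symmetric] by (rule sum.cong) auto
    also have "(\<Sum>T\<in>Pow S. if p \<in> T then 0 else ?s (inv_count T (S - T)) *
           (?s (inv_count {p} T) * cf x (insert p T) * cf y (S - T)))
       = (\<Sum>T\<in>{T \<in> Pow S. p \<notin> T}. ?s (inv_count T (S - T)) *
           (?s (inv_count {p} T) * cf x (insert p T) * cf y (S - T)))"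
      using S by (intro sum.mono_neutral_cong_right) auto
    also have "(\<Sum>T\<in>Pow S. if p \<in> T then ?s (inv_count T (S - T)) *
           (?s (card T) * cf x T * (?s (inv_count {p} (S - T)) * cf y (insert p (S - T)))) else 0)
       = (\<Sum>T\<in>{T \<in> Pow S. p \<in> T}. ?s (inv_count T (S - T)) *
           (?s (card T) * cf x T * (?s (inv_count {p} (S - T)) * cf y (insert p (S - T)))))"
      using S by (intro sum.mono_neutral_cong_right) auto
    also have "\<dots> = (\<Sum>T\<in>{T \<in> Pow S. p \<notin> T}. - (?s (inv_count T (S - T)) *
           (?s (inv_count {p} T) * cf x (insert p T) * cf y (S - T))))"
    proof (rule sum.reindex_bij_witness[of _ "insert p" "\<lambda>T. T - {p}"])
      fix T assume "T \<in> {T \<in> Pow S. p \<in> T}"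
      then have T: "T \<subseteq> S" "p \<in> T" by auto
      define U where "U = T - {p}"
      define R where "R = S - T"
      have e: "T = {p} \<union> U" "p \<notin> U" "S - T = R" "S - U = insert p R" "p \<notin> R"
        "insert p U = T" "T - {p} = U"
        using T True by (auto simp: U_def R_def)
      have f: "finite U" "finite R" "finite T"
        using finite_subset[OF T(1) S] S by (simp_all add: U_def R_def)
      have c: "card T = Suc (card U)" using card_insert_disjoint[OF f(1) e(2)] unfolding e(6) .
      have i1: "inv_count T R = inv_count {p} R + inv_count U R"
        using inv_count_Un_left[of "{p}" U R] f e(1,2) by simp
      have i2: "inv_count U (insert p R) = inv_count U {p} + inv_count U R"
        using inv_count_Un_right[of U "{p}" R] f e(5) by simp
      have i3: "inv_count U {p} + inv_count {p} U = card U"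
        using inv_count_swap[of U "{p}"] f e(2) by simp
      have s: "?s (card U) = ?s (inv_count U {p}) * ?s (inv_count {p} U)"
        by (simp only: i3[symmetric] power_add)
      have "?s k * ?s k = 1" for k by (simp add: power_add[symmetric])
      then have q: "?s k * (?s k * z) = z" for k z by (simp add: mult.assoc[symmetric])
      show "- (?s (inv_count (T - {p}) (S - (T - {p}))) *
           (?s (inv_count {p} (T - {p})) * cf x (insert p (T - {p})) * cf y (S - (T - {p}))))
         = ?s (inv_count T (S - T)) *
           (?s (card T) * cf x T * (?s (inv_count {p} (S - T)) * cf y (insert p (S - T))))"
        unfolding e(7) unfolding e(3,4,6) c i1 i2 power_Suc power_add s
        by (simp add: q algebra_simps)
    qed (use True in auto)
    finally show ?thesis using True by (simp add: cf_iop sum_negf)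
  next
    case False
    have "cf (x * y) (insert p S) = (\<Sum>T\<in>Pow S. ?s (inv_count T (insert p S - T)) * cf x T * cf y (insert p S - T))
       + (\<Sum>T\<in>Pow S. ?s (inv_count (insert p T) (insert p S - insert p T)) * cf x (insert p T) * cf y (insert p S - insert p T))"
    proof -
      have inj: "inj_on (insert p) (Pow S)"
        using False by (intro inj_onI) (metis Diff_insert_absorb PowD subsetD)
      have d: "Pow S \<inter> insert p ` Pow S = {}" using False by blast
      show ?thesis unfolding cf_mult Pow_insert
        by (subst sum.union_disjoint) (use S d in \<open>simp_all only: sum.reindex[OF inj] o_def finite_imageI finite_Pow_iff\<close>)
    qed
    then have "cf (iop p (x * y)) S = ?s (inv_count {p} S) *
        ((\<Sum>T\<in>Pow S. ?s (inv_count T (insert p S - T)) * cf x T * cf y (insert p S - T))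
       + (\<Sum>T\<in>Pow S. ?s (inv_count (insert p T) (insert p S - insert p T)) * cf x (insert p T) * cf y (insert p S - insert p T)))"
      using False by (simp add: cf_iop)
    also have "\<dots> = (\<Sum>T\<in>Pow S. ?s (inv_count T (S - T)) *
          (?s (inv_count {p} T) * cf x (insert p T)) * cf y (S - T)) +
          (\<Sum>T\<in>Pow S. ?s (inv_count T (S - T)) * (?s (card T) * cf x T) *
              (?s (inv_count {p} (S - T)) * cf y (insert p (S - T))))"
      unfolding distrib_left sum_distrib_left sum.distrib[symmetric]
    proof (rule sum.cong)
      fix T assume T: "T \<in> Pow S"
      define R where "R = S - T"
      have e: "S = T \<union> R" "T \<inter> R = {}" "p \<notin> T" "p \<notin> R" "S - T = R"
         "insert p S - T = insert p R" "insert p S - insert p T = R"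
        using T False by (auto simp: R_def)
      have f: "finite T" "finite R"
        using S finite_subset[of T S] T by (simp_all add: R_def)
      have i1: "inv_count {p} S = inv_count {p} T + inv_count {p} R"
        using inv_count_Un_right[of "{p}" T R] e(1,2) f by simp
      have i2: "inv_count T (insert p R) = inv_count T {p} + inv_count T R"
        using inv_count_Un_right[of T "{p}" R] e(4) f by simp
      have i3: "inv_count (insert p T) R = inv_count {p} R + inv_count T R"
        using inv_count_Un_left[of "{p}" T R] e(3) f by simp
      have "inv_count T {p} + inv_count {p} T = card T"
        using inv_count_swap[of T "{p}"] f e(3) by simp
      then have s: "?s (card T) = ?s (inv_count T {p}) * ?s (inv_count {p} T)"
        by (metis power_add)
      have q: "?s k * ?s k = 1" for k by (simp add: power_add[symmetric])
      then have q': "?s k * (?s k * z) = z" for k z by (simp add: mult.assoc[symmetric])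
      show "?s (inv_count {p} S) * (?s (inv_count T (insert p S - T)) * cf x T * cf y (insert p S - T))
        + ?s (inv_count {p} S) * (?s (inv_count (insert p T) (insert p S - insert p T)) * cf x (insert p T) * cf y (insert p S - insert p T))
        = ?s (inv_count T (S - T)) * (?s (inv_count {p} T) * cf x (insert p T)) * cf y (S - T)
          + ?s (inv_count T (S - T)) * (?s (card T) * cf x T) * (?s (inv_count {p} (S - T)) * cf y (insert p (S - T)))"
        unfolding e(5-7) i1 i2 i3 power_add s
        by (simp add: q' algebra_simps)
    qed simp
    also have "\<dots> = cf (iop p x * y + gi x * iop p y) S"
      unfolding cf_add cf_mult using False
      by (intro arg_cong2[of _ _ _ _ "(+)"] sum.cong refl) (auto simp: cf_iop)
    finally show ?thesis .
  qed
qed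

definition gn :: "nat \<times> nat \<Rightarrow> ea" where
  "gn p = Abs_ea (\<lambda>S. if S = {p} then 1 else 0)"

lemma cf_gn: "cf (gn p) S = (if S = {p} then 1 else 0)"
  unfolding gn_def by (subst Abs_ea_inverse) auto

lemma iop_gn: "iop p (gn q) = (if p = q then 1 else 0)"
  by (rule ea_eqI) (auto simp: cf_iop cf_gn cf_1)

lemma cf_gn_mult: "cf (gn p * y) S = (if p \<in> S then (-1) ^ inv_count {p} (S - {p}) * cf y (S - {p}) else 0)"
proof (cases "finite S")
  case True
  have "cf (gn p * y) S = (\<Sum>T\<in>Pow S. if T = {p} then (-1) ^ inv_count {p} (S - {p}) * cf y (S - {p}) else 0)"
    unfolding cf_mult by (rule sum.cong) (auto simp: cf_gn)
  then show ?thesis using True by (simp add: sum.delta)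
qed simp

lemma sgn_aut_gn: "sgn_aut w (gn p) = (-1) ^ w p * gn p"
  by (rule ea_eqI) (auto simp: cf_gn ea_power_m1)

text \<open>Bilinear, not Hermitian: monomials are orthonormal, but a nonzero element can be
  orthogonal to itself unless its coefficients are real.\<close>

definition ip :: "nat \<Rightarrow> ea \<Rightarrow> ea \<Rightarrow> complex" where
  "ip n x y = (\<Sum>S\<in>Pow (pairs n). cf x S * cf y S)"

lemma finite_pairs [simp]: "finite (pairs n)"
  by (rule finite_subset[of _ "{..<n} \<times> {..<n}"]) (auto simp: pairs_def)

lemma ip_commute: "ip n x y = ip n y x" by (simp add: ip_def mult.commute)
lemma ip_add_right: "ip n x (y + z) = ip n x y + ip n x z" by (simp add: ip_def algebra_simps sum.distrib)
lemma ip_minus_left: "ip n (x - y) z = ip n x z - ip n y z" by (simp add: ip_def algebra_simps sum_subtractf)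
lemma ip_uminus_right [simp]: "ip n x (- y) = - ip n x y" by (simp add: ip_def sum_negf)
lemma ip_uminus_left [simp]: "ip n (- x) y = - ip n x y" by (simp add: ip_def sum_negf)
lemma ip_0_right [simp]: "ip n x 0 = 0" by (simp add: ip_def)
lemma ip_0_left [simp]: "ip n 0 x = 0" by (simp add: ip_def)
lemma ip_sum_right: "ip n x (sum f I) = (\<Sum>i\<in>I. ip n x (f i))"
  by (induction I rule: infinite_finite_induct) (auto simp: ip_add_right)
lemma ip_sum_left: "ip n (sum f I) x = (\<Sum>i\<in>I. ip n (f i) x)"
  by (simp add: ip_commute[of n _ x] ip_sum_right)
lemma ip_cst_right [simp]: "ip n x (cst c * y) = c * ip n x y"
  by (simp add: ip_def sum_distrib_left mult_ac)
lemma ip_cst_left [simp]: "ip n (cst c * x) y = c * ip n x y"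
  by (simp add: ip_def sum_distrib_left mult_ac)

lemma ip_sgn_aut: "ip n (sgn_aut w x) (sgn_aut w y) = ip n x y"
  unfolding ip_def
proof (rule sum.cong)
  fix S assume "S \<in> Pow (pairs n)"
  have "(-1 :: complex) ^ sum w S * (-1) ^ sum w S = 1" by (simp add: power_add[symmetric])
  then show "cf (sgn_aut w x) S * cf (sgn_aut w y) S = cf x S * cf y S"
    by (simp add: algebra_simps)
qed simp

lemma ip_gn_mult:
  assumes "p \<in> pairs n"
  shows "ip n (gn p * y) x = ip n y (iop p x)"
proof -
  have "ip n (gn p * y) x = (\<Sum>S\<in>{S \<in> Pow (pairs n). p \<in> S}. (-1) ^ inv_count {p} (S - {p}) * cf y (S - {p}) * cf x S)"
    unfolding ip_def by (rule sum.mono_neutral_cong_right) (auto simp: cf_gn_mult)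
  also have "\<dots> = (\<Sum>S\<in>{S \<in> Pow (pairs n). p \<notin> S}. cf y S * cf (iop p x) S)"
    by (rule sum.reindex_bij_witness[of _ "insert p" "\<lambda>S. S - {p}"])
       (use assms in \<open>auto simp: cf_iop insert_absorb\<close>)
  also have "\<dots> = ip n y (iop p x)"
    unfolding ip_def by (rule sum.mono_neutral_cong_left) (auto simp: cf_iop)
  finally show ?thesis .
qed

text \<open>The entry \<open>a\<^sub>i\<^sub>j\<close> and the identity matrix are cut off outside the index range \<open>{..<n}\<close>, so that the
  matrix identities below hold for arbitrary indices.\<close>

definition an :: "nat \<Rightarrow> nat \<Rightarrow> nat \<Rightarrow> ea" where
  "an n i j = (if i < j \<and> j < n then gn (i,j) else if j < i \<and> i < n then - gn (j,i) else 0)"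

definition io :: "nat \<Rightarrow> nat \<Rightarrow> ea \<Rightarrow> ea" where
  "io i j x = (if i < j then iop (i,j) x else if j < i then - iop (j,i) x else 0)"

definition mid :: "nat \<Rightarrow> nat \<Rightarrow> nat \<Rightarrow> ea" where
  "mid n i j = (if i = j \<and> i < n then 1 else 0)"

lemma an_skew: "an n j i = - an n i j" by (auto simp: an_def)
lemma io_skew: "io j i x = - io i j x" by (auto simp: io_def)
lemma an_refl [simp]: "an n i i = 0" by (simp add: an_def)
lemma io_refl [simp]: "io i i x = 0" by (simp add: io_def)

lemma parity_gn: "parity 1 (gn p)" by (simp add: parity_def sgn_aut_gn)
lemma parity_an: "parity 1 (an n i j)"
  unfolding an_def by (auto simp only: if_True if_False intro: parity_gn parity_uminus parity_0 split: if_split)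

lemma io_add: "io i j (x + y) = io i j x + io i j y" by (simp add: io_def iop_add)
lemma io_uminus: "io i j (- x) = - io i j x" by (simp add: io_def iop_uminus)
lemma io_0 [simp]: "io i j 0 = 0" by (simp add: io_def)
lemma io_1 [simp]: "io i j 1 = 0" by (simp add: io_def)
lemma io_minus: "io i j (x - y) = io i j x - io i j y"
  using io_add[of i j x "- y"] by (simp add: io_uminus)
lemma io_sum: "io i j (sum f I) = (\<Sum>k\<in>I. io i j (f k))"
  by (induction I rule: infinite_finite_induct) (auto simp: io_add)
lemma io_mult: "io i j (x * y) = io i j x * y + gi x * io i j y"
  by (simp add: io_def iop_mult)
lemma io_mid [simp]: "io i j (mid n k l) = 0" by (simp add: mid_def)

lemma io_an: "io i j (an n k l) = mid n i k * mid n j l - mid n i l * mid n j k"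
  by (auto simp: io_def an_def mid_def iop_gn iop_uminus)

lemma ip_an_mult:
  assumes "i < n" "j < n"
  shows "ip n (an n i j * y) x = ip n y (io i j x)"
  using assms by (auto simp: an_def io_def ip_gn_mult pairs_def)

lemma sum_mid_left: "i < n \<Longrightarrow> (\<Sum>l<n. mid n i l * f l) = f i"
  proof -
  assume "i < n"
  have "(\<Sum>l<n. mid n i l * f l) = (\<Sum>l<n. if l = i then f i else 0)"
    by (rule sum.cong) (use \<open>i < n\<close> in \<open>auto simp: mid_def\<close>)
  then show ?thesis using \<open>i < n\<close> by (simp add: sum.delta)
qed

section \<open>Powers of the generic skew matrix\<close>

primrec pw :: "nat \<Rightarrow> nat \<Rightarrow> nat \<Rightarrow> nat \<Rightarrow> ea" where
  "pw n 0 = mid n"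
| "pw n (Suc k) = (\<lambda>i j. \<Sum>l<n. pw n k i l * an n l j)"

definition tr :: "nat \<Rightarrow> nat \<Rightarrow> ea" where
  "tr n k = (\<Sum>i<n. pw n k i i)"

lemma sum_mid_right: "j < n \<Longrightarrow> (\<Sum>l<n. f l * mid n l j) = f j"
proof -
  assume "j < n"
  have "(\<Sum>l<n. f l * mid n l j) = (\<Sum>l<n. if l = j then f j else 0)"
    by (rule sum.cong) (use \<open>j < n\<close> in \<open>auto simp: mid_def\<close>)
  then show ?thesis using \<open>j < n\<close> by (simp add: sum.delta)
qed

lemma mid_commute: "mid n i j = mid n j i" by (auto simp: mid_def)

lemma pw_outside: "i \<ge> n \<or> j \<ge> n \<Longrightarrow> pw n k i j = 0"
proof (induction k arbitrary: j)
  case (Suc k)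
  have "pw n k i l * an n l j = 0" if "l < n" for l
    using Suc that by (cases "i \<ge> n") (auto simp: an_def)
  then show ?case by simp
qed (auto simp: mid_def)

lemma pw_sum_mid: "(\<Sum>l<n. pw n k i l * mid n l j) = pw n k i j"
proof (cases "j < n")
  case False
  then have "mid n l j = 0" for l by (auto simp: mid_def)
  then show ?thesis using False by (simp add: pw_outside)
qed (simp add: sum_mid_right)

lemma pw_add: "(\<Sum>l<n. pw n k i l * pw n m l j) = pw n (k + m) i j"
proof (induction m arbitrary: j)
  case 0
  then show ?case by (simp add: pw_sum_mid)
next
  case (Suc m)
  have "(\<Sum>l<n. pw n k i l * pw n (Suc m) l j) = (\<Sum>l<n. \<Sum>q<n. pw n k i l * pw n m l q * an n q j)"
    by (simp add: sum_distrib_left mult.assoc)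
  also have "\<dots> = (\<Sum>q<n. (\<Sum>l<n. pw n k i l * pw n m l q) * an n q j)"
    by (subst sum.swap) (simp add: sum_distrib_right)
  finally show ?case using Suc by simp
qed

lemma pw_1: "pw n (Suc 0) i j = an n i j"
proof (cases "i < n")
  case False
  then have "mid n i l = 0" "an n i j = 0" for l by (auto simp: mid_def an_def)
  then show ?thesis by simp
qed (simp add: sum_mid_left)

lemma pw_Suc_left: "pw n (Suc k) i j = (\<Sum>l<n. an n i l * pw n k l j)"
  using pw_add[of n "Suc 0" i k j] by (simp only: pw_1 plus_nat.simps)

lemma parity_pw: "parity k (pw n k i j)"
proof (induction k arbitrary: j)
  case 0
  then show ?case by (simp add: mid_def)
next
  case (Suc k)
  have "parity (k + 1) (pw n k i l * an n l j)" for l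
    by (rule parity_mult[OF Suc parity_an])
  then show ?case by (auto intro: parity_sum)
qed

lemma parity_tr: "parity k (tr n k)"
  unfolding tr_def by (rule parity_sum) (rule parity_pw)

lemma gi_pw: "gi (pw n k i j) = (-1) ^ k * pw n k i j"
  using parity_pw by (simp add: parity_def)

lemma gi_tr: "gi (tr n k) = (-1) ^ k * tr n k"
  using parity_tr by (simp add: parity_def)

text \<open>The sign \<open>eps k = (-1)^(k(k+1)/2)\<close> relates \<open>A^k\<close> to its transpose.\<close>

primrec eps :: "nat \<Rightarrow> int" where
  "eps 0 = 1"
| "eps (Suc k) = - ((-1) ^ k * eps k)"

lemma eps_add_4: "eps (k + 4) = eps k"
proof -
  have "k + 4 = Suc (Suc (Suc (Suc k)))" by simp
  then show ?thesis by (simp only: eps.simps) (simp add: uminus_power_if)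
qed

lemma eps_mod4: "eps (4 * k + r) = eps r"
proof (induction k)
  case (Suc k)
  have "4 * Suc k + r = (4 * k + r) + 4" by simp
  then show ?case using Suc eps_add_4 by metis
qed simp

text \<open>Transposing reverses \<open>k\<close> odd factors, which costs
  \<open>(-1)^(k(k-1)/2)\<close>, and each of the \<open>k\<close> skew factors contributes one more
  sign.\<close>

lemma pw_transpose: "pw n k j i = of_int (eps k) * pw n k i j"
proof (induction k arbitrary: i j)
  case 0
  then show ?case by (simp add: mid_commute)
next
  case (Suc k)
  have c: "pw n k l j * an n i l = (-1) ^ k * (an n i l * pw n k l j)" for l
    using parity_commute[OF parity_pw[of k n l j] parity_an[of n i l]] unfolding mult_1_right .
  have "pw n (Suc k) j i = (\<Sum>l<n. - (of_int (eps k) * (pw n k l j * an n i l)))"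
    by (simp add: Suc[of j] an_skew[of n i] mult.assoc del: of_int_minus)
  also have "\<dots> = (\<Sum>l<n. - (of_int (eps k) * ((-1) ^ k * (an n i l * pw n k l j))))"
    unfolding c ..
  also have "\<dots> = of_int (eps (Suc k)) * (\<Sum>l<n. an n i l * pw n k l j)"
    by (cases "even k") (simp_all add: sum_distrib_left sum_negf)
  finally show ?case by (simp only: pw_Suc_left)
qed

lemma tr_0: "tr n 0 = of_nat n"
  by (simp add: tr_def mid_def)

lemma tr_cyclic: "tr n (a + b) = (-1) ^ (a * b) * tr n (a + b)"
proof -
  have "tr n (a + b) = (\<Sum>i<n. \<Sum>l<n. pw n a i l * pw n b l i)"
    by (simp add: tr_def pw_add)
  also have "\<dots> = (\<Sum>i<n. \<Sum>l<n. (-1) ^ (a * b) * (pw n b l i * pw n a i l))"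
    by (intro sum.cong refl parity_commute parity_pw)
  also have "\<dots> = (-1) ^ (a * b) * (\<Sum>l<n. \<Sum>i<n. pw n b l i * pw n a i l)"
    by (subst sum.swap) (simp add: sum_distrib_left)
  also have "(\<Sum>l<n. \<Sum>i<n. pw n b l i * pw n a i l) = tr n (a + b)"
    by (simp add: tr_def pw_add add.commute)
  finally show ?thesis .
qed

text \<open>Moving one factor of an even power around the trace passes \<open>k - 1\<close> odd
  factors, an odd number, so the trace equals its negative.\<close>

lemma tr_even_eq_0: "even k \<Longrightarrow> k > 0 \<Longrightarrow> tr n k = 0"
  using tr_cyclic[of n 1 "k - 1"] by (intro ea_eq_uminus_self) (auto simp: uminus_power_if)

text \<open>Since \<open>eps (4 * k + 1) = -1\<close>, the power is a skew matrix and its diagonal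
  vanishes.\<close>

lemma tr_4k1_eq_0: "tr n (4 * k + 1) = 0"
proof (rule ea_eq_uminus_self)
  have "pw n (4 * k + 1) i i = - pw n (4 * k + 1) i i" for i
    using pw_transpose[of n "4 * k + 1" i i] eps_mod4[of k 1] by simp
  then show "tr n (4 * k + 1) = - tr n (4 * k + 1)"
    unfolding tr_def sum_negf[symmetric] by (intro sum.cong) auto
qed

lemma tr_nonzero_cases:
  assumes "tr n k \<noteq> 0"
  obtains "k = 0" | q where "k = 4 * q + 3"
proof -
  have "k mod 4 \<noteq> 1" using tr_4k1_eq_0[of n "k div 4"] assms by (metis mult_div_mod_eq)
  moreover have "even k \<longrightarrow> k = 0" using tr_even_eq_0 assms by blast
  ultimately have "k = 0 \<or> k = 4 * (k div 4) + 3" by presburger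
  then show ?thesis using that by blast
qed

lemma mult_m1_power: "x * ((-1) ^ k * y) = (-1) ^ k * (x * (y :: ea))"
  by (simp add: ea_power_m1)

text \<open>\<open>p\<close> is the position of the contracted factor. Passing the \<open>p\<close>
  odd factors before it gives the sign, and \<open>io_an\<close> gives the two ways of distributing
  \<open>i\<close> and \<open>j\<close> over the two cut ends.\<close>

lemma io_pw:
  "io i j (pw n r k l) = (\<Sum>p<r. (-1) ^ p *
     (pw n p k i * pw n (r - 1 - p) j l - pw n p k j * pw n (r - 1 - p) i l))"
proof (induction r arbitrary: l)
  case 0
  then show ?case by simp
next
  case (Suc r)
  have "io i j (pw n (Suc r) k l) = (\<Sum>m<n. io i j (pw n r k m) * an n m l)
      + (\<Sum>m<n. gi (pw n r k m) * io i j (an n m l))"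
    by (simp add: io_sum io_mult sum.distrib)
  also have "(\<Sum>m<n. gi (pw n r k m) * io i j (an n m l))
      = (-1) ^ r * ((\<Sum>m<n. pw n r k m * mid n m i) * mid n j l - (\<Sum>m<n. pw n r k m * mid n m j) * mid n i l)"
    unfolding sum_distrib_right sum_subtractf[symmetric] sum_distrib_left
    by (rule sum.cong) (auto simp: gi_pw io_an algebra_simps mid_def)
  also have "\<dots> = (-1) ^ r * (pw n r k i * pw n 0 j l - pw n r k j * pw n 0 i l)"
    by (simp add: pw_sum_mid)
  also have "(\<Sum>m<n. io i j (pw n r k m) * an n m l) = (\<Sum>p<r. (-1) ^ p *
     (pw n p k i * pw n (Suc (r - 1 - p)) j l - pw n p k j * pw n (Suc (r - 1 - p)) i l))"
    unfolding Suc sum_distrib_right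
    by (subst sum.swap)
       (simp add: sum_distrib_left sum_subtractf left_diff_distrib right_diff_distrib mult.assoc)
  also have "\<dots> = (\<Sum>p<r. (-1) ^ p *
     (pw n p k i * pw n (Suc r - 1 - p) j l - pw n p k j * pw n (Suc r - 1 - p) i l))"
    by (rule sum.cong) (auto simp: Suc_diff_Suc simp del: pw.simps)
  finally show ?case by (simp add: sum.lessThan_Suc del: pw.simps)
qed

text \<open>The adjoint, up to sign, of left multiplication by \<open>A\<close> on matrices with entries in the algebra.
  Its square maps \<open>A^r\<close>, for even \<open>r\<close>, to a multiple \<open>mu n r\<close> of \<open>A^(r-2)\<close>.\<close>

definition Dm :: "nat \<Rightarrow> (nat \<Rightarrow> nat \<Rightarrow> ea) \<Rightarrow> nat \<Rightarrow> nat \<Rightarrow> ea" where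
  "Dm n M i k = (\<Sum>j<n. io i j (M j k))"

text \<open>The total coefficient of \<open>A^(r-1)\<close> that arises when the left pieces
  \<open>A^p\<close> of \<open>io_pw\<close> are transposed so that they can be multiplied with the
  right pieces.\<close>

definition eps_sum :: "nat \<Rightarrow> int" where
  "eps_sum r = (\<Sum>p<r. (-1) ^ p * eps p)"

definition odds :: "nat \<Rightarrow> nat set" where
  "odds r = {p. p < r \<and> odd p}"

lemma finite_odds [simp]: "finite (odds r)" by (simp add: odds_def)

text \<open>The first terms of \<open>io_pw\<close>, after transposing \<open>A^p\<close>, all
  multiply to \<open>A^(r-1)\<close>; the second terms sum to traces. Exponent 0 contributes the
  trace \<open>n\<close> of the identity, the other even exponents nothing.\<close>

lemma Dm_pw:
  assumes "r > 0"
  shows "Dm n (pw n r) i k = of_int (eps_sum r - int n) * pw n (r - 1) i k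
    + (\<Sum>p\<in>odds r. tr n p * pw n (r - 1 - p) i k)"
proof -
  let ?E = "\<lambda>p. (-1) ^ p * (tr n p * pw n (r - 1 - p) i k)"
  have tp: "pw n p j i * y = of_int (eps p) * (pw n p i j * y)" for p j y
    by (subst pw_transpose) (rule mult.assoc)
  have "Dm n (pw n r) i k = (\<Sum>p<r. \<Sum>j<n. (-1) ^ p *
     (pw n p j i * pw n (r - 1 - p) j k - pw n p j j * pw n (r - 1 - p) i k))"
    unfolding Dm_def io_pw by (rule sum.swap)
  also have "\<dots> = (\<Sum>p<r. of_int ((-1) ^ p * eps p) * pw n (r - 1) i k - ?E p)"
  proof (rule sum.cong)
    fix p assume "p \<in> {..<r}"
    then have "p + (r - 1 - p) = r - 1" by auto
    then have "(\<Sum>j<n. pw n p i j * pw n (r - 1 - p) j k) = pw n (r - 1) i k"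
      by (simp add: pw_add)
    then show "(\<Sum>j<n. (-1) ^ p * (pw n p j i * pw n (r - 1 - p) j k - pw n p j j * pw n (r - 1 - p) i k))
      = of_int ((-1) ^ p * eps p) * pw n (r - 1) i k - ?E p"
      by (simp add: tp sum_distrib_left[symmetric] sum_subtractf sum_distrib_right[symmetric]
          tr_def[symmetric] right_diff_distrib mult.assoc)
  qed simp
  also have "\<dots> = of_int (eps_sum r) * pw n (r - 1) i k - (\<Sum>p<r. ?E p)"
    by (simp add: sum_subtractf eps_sum_def sum_distrib_right)
  also have "(\<Sum>p<r. ?E p) = (\<Sum>p\<in>insert 0 (odds r). ?E p)"
    using assms by (intro sum.mono_neutral_right) (auto simp: odds_def tr_even_eq_0)
  also have "\<dots> = of_nat n * pw n (r - 1) i k - (\<Sum>p\<in>odds r. tr n p * pw n (r - 1 - p) i k)"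
  proof -
    have "(\<Sum>p\<in>odds r. ?E p) = (\<Sum>p\<in>odds r. - (tr n p * pw n (r - 1 - p) i k))"
      by (rule sum.cong) (simp_all add: odds_def)
    moreover have "0 \<notin> odds r" by (simp add: odds_def)
    ultimately show ?thesis by (simp add: tr_0 sum_negf)
  qed
  finally show ?thesis by (simp add: left_diff_distrib)
qed

text \<open>Opening the trace at any of its \<open>p\<close> positions and moving the pieces around
  cyclically gives the same matrix \<open>A^(p-1)\<close>, once transposed and once as it stands. As
  \<open>p - 1\<close> is even, the sign of the cyclic move cancels that of the Leibniz
  rule.\<close>

lemma io_tr:
  assumes "odd p"
  shows "io i j (tr n p) = of_int (int p * (eps (p - 1) - 1)) * pw n (p - 1) i j"
proof -
  have "io i j (tr n p) = (\<Sum>k<n. \<Sum>a<p. (-1) ^ a *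
     (pw n a k i * pw n (p - 1 - a) j k - pw n a k j * pw n (p - 1 - a) i k))"
    unfolding tr_def io_sum io_pw ..
  also have "\<dots> = (\<Sum>a<p. (\<Sum>k<n. (-1) ^ a *
     (pw n a k i * pw n (p - 1 - a) j k - pw n a k j * pw n (p - 1 - a) i k)))"
    by (rule sum.swap)
  also have "\<dots> = (\<Sum>a<p. pw n (p - 1) j i - pw n (p - 1) i j)"
  proof (rule sum.cong)
    fix a assume "a \<in> {..<p}"
    then have a: "(p - 1 - a) + a = p - 1" by auto
    have "even ((p - 1 - a) + a)" unfolding a using assms by simp
    then have "even (p - 1 - a) = even a" by (simp only: even_add)
    then have ev: "even (a * (p - 1 - a)) = even a" by (simp only: even_mult_iff) blast
    have c: "(-1) ^ a * (pw n a k u * pw n (p - 1 - a) v k) = pw n (p - 1 - a) v k * pw n a k u" for k u v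
      using parity_commute[OF parity_pw[of a n k u] parity_pw[of "p - 1 - a" n v k]] ev
      by (simp add: ea_power_m1)
    show "(\<Sum>k<n. (-1) ^ a *
     (pw n a k i * pw n (p - 1 - a) j k - pw n a k j * pw n (p - 1 - a) i k)) = pw n (p - 1) j i - pw n (p - 1) i j"
      unfolding right_diff_distrib c sum_subtractf pw_add a ..
  qed simp
  also have "\<dots> = of_int (int p * (eps (p - 1) - 1)) * pw n (p - 1) i j"
    by (subst pw_transpose) (simp add: algebra_simps)
  finally show ?thesis .
qed

lemma Dm_tr_mult:
  assumes "odd p"
  shows "Dm n (\<lambda>j k. tr n p * M j k) i k = (\<Sum>j<n. io i j (tr n p) * M j k) - tr n p * Dm n M i k"
  unfolding Dm_def sum_distrib_left sum_subtractf[symmetric]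
  by (rule sum.cong) (use assms in \<open>auto simp: io_mult gi_tr\<close>)

lemma io_of_int_mult: "io i j (of_int c * x) = of_int c * io i j x"
proof -
  have 1: "io i j (of_nat m * x) = of_nat m * io i j x" for m
    by (induction m) (auto simp: io_add distrib_right)
  show ?thesis by (cases c rule: int_cases2) (auto simp: 1 io_uminus)
qed

lemma Dm_lin: "Dm n (\<lambda>j k. of_int c * M j k + (\<Sum>p\<in>I. N p j k)) i k
    = of_int c * Dm n M i k + (\<Sum>p\<in>I. Dm n (N p) i k)"
  unfolding Dm_def io_add io_sum io_of_int_mult sum.distrib sum_distrib_left
  by (simp add: sum.swap[of _ I])

text \<open>The nested sum runs over the odd pairs with \<open>p + q < r\<close>, a set that is
  symmetric under exchange.\<close>

lemma sum_antisym_pairs: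
  fixes f :: "nat \<Rightarrow> nat \<Rightarrow> ea"
  assumes "\<And>p q. p \<in> odds r \<Longrightarrow> q \<in> odds r \<Longrightarrow> f p q = - f q p"
  shows "(\<Sum>p\<in>odds r. \<Sum>q\<in>odds (r - p). f p q) = 0"
proof (rule ea_eq_uminus_self)
  let ?A = "SIGMA p:odds r. odds (r - p)"
  have A: "(a, b) \<in> ?A \<longleftrightarrow> odd a \<and> odd b \<and> a + b < r" for a b by (auto simp: odds_def)
  have "(\<Sum>p\<in>odds r. \<Sum>q\<in>odds (r - p). f p q) = (\<Sum>(p,q)\<in>?A. f p q)"
    by (rule sum.Sigma) auto
  also have "\<dots> = (\<Sum>(p,q)\<in>?A. - f p q)"
  proof (rule sum.reindex_bij_witness[of _ prod.swap prod.swap])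
    fix z assume z: "z \<in> ?A"
    obtain a b where [simp]: "z = (a,b)" by (cases z)
    have "odd a" "odd b" "a + b < r" using z by (simp_all add: A del: mem_Sigma_iff)
    then have "b \<in> odds r" "a \<in> odds r" "prod.swap z \<in> ?A" by (auto simp: odds_def)
    then show "(case prod.swap z of (p, q) \<Rightarrow> - f p q) = (case z of (p, q) \<Rightarrow> f p q)" "prod.swap z \<in> ?A"
      using assms[of b a] by auto
    show "prod.swap z \<in> ?A" by fact
  qed auto
  also have "\<dots> = - (\<Sum>p\<in>odds r. \<Sum>q\<in>odds (r - p). f p q)"
    by (subst sum.Sigma[symmetric]) (auto simp: sum_negf)
  finally show "(\<Sum>p\<in>odds r. \<Sum>q\<in>odds (r - p). f p q) = - (\<Sum>p\<in>odds r. \<Sum>q\<in>odds (r - p). f p q)" .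
qed

section \<open>The Kostant--Rowen identity\<close>

lemma eps_sum_add_4: "eps_sum (r + 4) = eps_sum r"
proof -
  have "r + 4 = Suc (Suc (Suc (Suc r)))" by simp
  then show ?thesis
    unfolding eps_sum_def by (simp only: sum.lessThan_Suc eps.simps power_Suc) (simp add: uminus_power_if)
qed

lemma eps_sum_mod4: "eps_sum (4 * k + r) = eps_sum r"
proof (induction k)
  case (Suc k)
  have "4 * Suc k + r = (4 * k + r) + 4" by simp
  then show ?case using Suc eps_sum_add_4 by metis
qed simp

text \<open>The product stems from the leading coefficients of \<open>Dm_pw\<close> at
  \<open>r\<close> and \<open>r - 1\<close>, the sum from contracting the traces by
  \<open>io_tr\<close>.\<close>

definition mu :: "nat \<Rightarrow> nat \<Rightarrow> int" where
  "mu n r = (eps_sum r - int n) * (eps_sum (r - 1) - int n) + (\<Sum>p\<in>odds r. int p * (eps (p - 1) - 1))"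

text \<open>Terms with one trace arise twice, from \<open>Dm\<close> of \<open>A^(r-1)\<close> and
  from \<open>Dm\<close> of \<open>A^(r-1-p)\<close>, with equal coefficients and opposite signs;
  terms with two traces are antisymmetric in their exponents.\<close>

lemma Dm_Dm_pw:
  assumes "even r" "r > 0"
  shows "Dm n (Dm n (pw n r)) i k = of_int (mu n r) * pw n (r - 2) i k"
proof -
  define c where "c = eps_sum r - int n"
  have r1: "r - 1 > 0" using assms by presburger
  have E1: "Dm n (pw n r) = (\<lambda>j k. of_int c * pw n (r - 1) j k
      + (\<Sum>p\<in>odds r. tr n p * pw n (r - 1 - p) j k))"
    by (intro ext) (simp only: Dm_pw[OF assms(2)] c_def)
  let ?g = "\<lambda>p. of_int (int p * (eps (p - 1) - 1)) * pw n (r - 2) i k"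
  \<comment> \<open>At \<open>p = r - 1\<close> the remaining power is \<open>A^0\<close>, which
    every contraction kills; \<open>Dm_pw\<close> covers positive exponents only.\<close>
  let ?h = "\<lambda>p. if p = r - 1 then 0 else of_int c * (tr n p * pw n (r - 2 - p) i k)"
  let ?f = "\<lambda>p q. tr n p * tr n q * pw n (r - 2 - (p + q)) i k"
  have E2: "Dm n (\<lambda>j k. tr n p * pw n (r - 1 - p) j k) i k = ?g p - (?h p + (\<Sum>q\<in>odds (r - 1 - p). ?f p q))"
    if p: "p \<in> odds r" for p
  proof -
    have p': "odd p" "p < r" "(p - 1) + (r - 1 - p) = r - 2" using p by (auto simp: odds_def elim: oddE)
    have "(\<Sum>j<n. io i j (tr n p) * pw n (r - 1 - p) j k)
        = of_int (int p * (eps (p - 1) - 1)) * (\<Sum>j<n. pw n (p - 1) i j * pw n (r - 1 - p) j k)"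
      unfolding io_tr[OF p'(1)] sum_distrib_left mult.assoc ..
    also have "\<dots> = ?g p" unfolding pw_add p'(3) ..
    finally have a: "(\<Sum>j<n. io i j (tr n p) * pw n (r - 1 - p) j k) = ?g p" .
    have b: "tr n p * Dm n (pw n (r - 1 - p)) i k = ?h p + (\<Sum>q\<in>odds (r - 1 - p). ?f p q)"
    proof (cases "p = r - 1")
      case True
      then show ?thesis by (simp add: Dm_def odds_def)
    next
      case False
      then have pos: "r - 1 - p > 0" using p' by auto
      \<comment> \<open>A nonzero trace has \<open>p = 4 * q + 3\<close>, so \<open>r\<close> and
        \<open>r - 1 - p\<close> differ by \<open>4 * (q + 1)\<close>, a multiple of the period of
        \<open>eps_sum\<close>.\<close>
      have s: "of_int (eps_sum (r - 1 - p)) * tr n p = of_int (eps_sum r) * tr n p"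
      proof (cases "tr n p = 0")
        case F: False
        obtain q where q: "p = 4 * q + 3" using tr_nonzero_cases[OF F] p'(1) by (metis even_zero)
        have "r = 4 * (q + 1) + (r - 1 - p)" using q p'(2) by simp
        then have "eps_sum r = eps_sum (r - 1 - p)" using eps_sum_mod4[of "q + 1" "r - 1 - p"] by simp
        then show ?thesis by simp
      qed simp
      have "tr n p * Dm n (pw n (r - 1 - p)) i k
          = of_int (eps_sum (r - 1 - p) - int n) * tr n p * pw n (r - 2 - p) i k
            + (\<Sum>q\<in>odds (r - 1 - p). ?f p q)"
        unfolding Dm_pw[OF pos] distrib_left sum_distrib_left
        using mult_of_int_commute[of "eps_sum (r - 1 - p) - int n" "tr n p"]
        by (simp add: mult.assoc[symmetric] diff_diff_add numeral_2_eq_2 del: of_int_diff)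
      also have "of_int (eps_sum (r - 1 - p) - int n) * tr n p = of_int c * tr n p"
        using s by (simp add: c_def left_diff_distrib)
      finally show ?thesis using False by (simp add: mult.assoc)
    qed
    show ?thesis unfolding Dm_tr_mult[OF p'(1)] a b ..
  qed
  have "Dm n (Dm n (pw n r)) i k = of_int c * Dm n (pw n (r - 1)) i k
      + (\<Sum>p\<in>odds r. ?g p - (?h p + (\<Sum>q\<in>odds (r - 1 - p). ?f p q)))"
    unfolding E1 Dm_lin using E2 by simp
  also have "\<dots> = of_int c * Dm n (pw n (r - 1)) i k + (\<Sum>p\<in>odds r. ?g p)
      - (\<Sum>p\<in>odds r. ?h p) - (\<Sum>p\<in>odds r. \<Sum>q\<in>odds (r - 1 - p). ?f p q)"
    by (simp add: sum_subtractf sum.distrib algebra_simps)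
  also have "(\<Sum>p\<in>odds r. \<Sum>q\<in>odds (r - 1 - p). ?f p q)
      = (\<Sum>p\<in>odds (r - 1). \<Sum>q\<in>odds (r - 1 - p). ?f p q)"
  proof (rule sum.mono_neutral_right)
    show "\<forall>p\<in>odds r - odds (r - 1). (\<Sum>q\<in>odds (r - 1 - p). ?f p q) = 0"
    proof
      fix p assume "p \<in> odds r - odds (r - 1)"
      then have "odds (r - 1 - p) = {}" by (auto simp: odds_def)
      then show "(\<Sum>q\<in>odds (r - 1 - p). ?f p q) = 0" by (simp only: sum.empty)
    qed
  qed (auto simp: odds_def)
  also have "\<dots> = 0"
  proof (rule sum_antisym_pairs)
    fix p q assume "p \<in> odds (r - 1)" "q \<in> odds (r - 1)"
    then have "tr n p * tr n q = - (tr n q * tr n p)"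
      using parity_commute[OF parity_tr[of p n] parity_tr[of q n]] by (simp add: odds_def)
    then show "?f p q = - ?f q p" by (simp add: add.commute)
  qed
  also have "(\<Sum>p\<in>odds r. ?h p) = of_int c * (\<Sum>p\<in>odds (r - 1). tr n p * pw n (r - 1 - 1 - p) i k)"
    unfolding sum_distrib_left
    by (rule sum.mono_neutral_cong_right) (use assms r1 in \<open>auto simp: odds_def numeral_2_eq_2\<close>)
  also have "(\<Sum>p\<in>odds r. ?g p) = of_int (\<Sum>p\<in>odds r. int p * (eps (p - 1) - 1)) * pw n (r - 2) i k"
    by (simp only: of_int_sum sum_distrib_right)
  finally show ?thesis
    unfolding Dm_pw[OF r1] mu_def c_def[symmetric]
    by (simp add: distrib_left distrib_right mult.assoc numeral_2_eq_2 del: of_int_diff of_int_sum)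
qed

lemma odds_double_sum: "(\<Sum>p\<in>odds (2 * a). f p) = (\<Sum>b<a. f (2 * b + 1) :: int)"
  by (rule sum.reindex_bij_witness[of _ "\<lambda>b. 2 * b + 1" "\<lambda>p. p div 2"]) (auto simp: odds_def elim!: oddE)

lemma eps_even: "eps (2 * b) = (-1) ^ b"
proof (induction b)
  case (Suc b)
  then show ?case by (simp add: power_mult)
qed simp

lemma eps_sum_even: "eps_sum (2 * a) = (if even a then 0 else 2)"
proof (induction a)
  case (Suc a)
  then show ?case by (auto simp: eps_sum_def eps_even power_mult)
qed (simp add: eps_sum_def)

lemma eps_sum_odd: "eps_sum (2 * a + 1) = 1"
  using eps_sum_even[of a] by (simp add: eps_sum_def eps_even power_mult uminus_power_if)

lemma sum_odd_eps: "(\<Sum>b<a. int (2 * b + 1) * (eps (2 * b) - 1)) = - ((int a)\<^sup>2 + (-1) ^ a * int a)"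
proof (induction a)
  case (Suc a)
  show ?case unfolding sum.lessThan_Suc Suc unfolding eps_even
    by (cases "even a") (simp_all add: power2_eq_square algebra_simps)
qed simp

text \<open>For \<open>r = 2a\<close>, \<open>mu n r\<close> is \<open>(n - a - 1) (n + a)\<close> if \<open>a\<close> is even and \<open>(n - a - 1) (n + a - 2)\<close> if it is odd.\<close>

lemma mu_eq_0: "mu (Suc (Suc a)) (2 * Suc a) = 0"
proof -
  have "2 * Suc a - 1 = 2 * a + 1" by simp
  then have "mu (Suc (Suc a)) (2 * Suc a)
      = ((if even (Suc a) then 0 else 2) - int (Suc (Suc a))) * (1 - int (Suc (Suc a)))
        - ((int (Suc a))\<^sup>2 + (-1) ^ Suc a * int (Suc a))"
    unfolding mu_def odds_double_sum eps_sum_even add_diff_cancel_right' sum_odd_eps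
    by (simp only: eps_sum_odd)
  then show ?thesis
    by (cases "even a") (simp_all add: power2_eq_square algebra_simps)
qed

section \<open>Real coefficients and definiteness of the form\<close>

definition real_ea :: "ea \<Rightarrow> bool" where
  "real_ea x \<longleftrightarrow> (\<forall>S. cf x S \<in> \<real>)"

definition supp :: "nat \<Rightarrow> ea \<Rightarrow> bool" where
  "supp n x \<longleftrightarrow> (\<forall>S. cf x S \<noteq> 0 \<longrightarrow> S \<subseteq> pairs n)"

lemma real_ea_mult: "real_ea x \<Longrightarrow> real_ea y \<Longrightarrow> real_ea (x * y)"
  by (auto simp: real_ea_def cf_mult intro!: Reals_mult Reals_power sum_in_Reals)

lemma real_ea_sum: "(\<And>i. i \<in> I \<Longrightarrow> real_ea (f i)) \<Longrightarrow> real_ea (sum f I)"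
  by (auto simp: real_ea_def intro: sum_in_Reals)

lemma real_ea_0: "real_ea 0" and real_ea_1: "real_ea 1"
  by (auto simp: real_ea_def cf_1)

lemma supp_mult: "supp n x \<Longrightarrow> supp n y \<Longrightarrow> supp n (x * y)"
  unfolding supp_def
proof (intro allI impI)
  fix S assume x: "\<forall>S. cf x S \<noteq> 0 \<longrightarrow> S \<subseteq> pairs n" and y: "\<forall>S. cf y S \<noteq> 0 \<longrightarrow> S \<subseteq> pairs n"
    and "cf (x * y) S \<noteq> 0"
  then obtain T where T: "T \<in> Pow S" "cf x T \<noteq> 0" "cf y (S - T) \<noteq> 0"
    unfolding cf_mult by (metis (no_types, lifting) mult_eq_0_iff sum.neutral)
  then have "T \<subseteq> pairs n" "S - T \<subseteq> pairs n" using x y by blast+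
  then show "S \<subseteq> pairs n" by blast
qed

lemma supp_sum: "(\<And>i. i \<in> I \<Longrightarrow> supp n (f i)) \<Longrightarrow> supp n (sum f I)"
  unfolding supp_def cf_sum by (blast elim: sum.not_neutral_contains_not_neutral)

lemma supp_0: "supp n 0" and supp_1: "supp n 1"
  by (auto simp: supp_def cf_1)

lemma real_ea_an: "real_ea (an n i j)"
  by (auto simp: real_ea_def an_def cf_gn)

lemma supp_an: "supp n (an n i j)"
  by (auto simp: supp_def an_def cf_gn pairs_def split: if_splits)

lemma real_ea_pw: "real_ea (pw n k i j)"
  by (induction k arbitrary: j) (auto simp: mid_def real_ea_0 real_ea_1 real_ea_an intro!: real_ea_sum real_ea_mult)

lemma supp_pw: "supp n (pw n k i j)"
  by (induction k arbitrary: j) (auto simp: mid_def supp_0 supp_1 supp_an intro!: supp_sum supp_mult)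

lemma real_ea_tr: "real_ea (tr n k)"
  unfolding tr_def by (intro real_ea_sum real_ea_pw)

lemma supp_tr: "supp n (tr n k)"
  unfolding tr_def by (intro supp_sum supp_pw)

lemma ip_self: "real_ea x \<Longrightarrow> ip n x x = of_real (\<Sum>S\<in>Pow (pairs n). (Re (cf x S))\<^sup>2)"
  unfolding ip_def of_real_sum
  by (intro sum.cong refl) (auto simp: real_ea_def complex_is_Real_iff complex_eq_iff power2_eq_square)

lemma ip_self_eq_0:
  assumes "real_ea x" "supp n x" "ip n x x = 0"
  shows "x = 0"
proof (rule ea_eqI)
  fix S :: "(nat \<times> nat) set"
  show "cf x S = cf 0 S"
  proof (cases "S \<subseteq> pairs n")
    case True
    have "(\<Sum>S\<in>Pow (pairs n). (Re (cf x S))\<^sup>2) = 0" using assms(3) unfolding ip_self[OF assms(1)] of_real_eq_0_iff .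
    then have "(Re (cf x S))\<^sup>2 = 0" using True by (subst (asm) sum_nonneg_eq_0_iff) auto
    then show ?thesis using assms(1) by (auto simp: real_ea_def complex_is_Real_iff complex_eq_iff)
  next
    case False
    then show ?thesis using assms(2) by (auto simp: supp_def)
  qed
qed

text \<open>Multiplication by \<open>a_ik\<close> is adjoint to \<open>io i k\<close>. The sum
  defining \<open>Dm\<close> at row \<open>k\<close> contains \<open>io k i\<close> instead, whence
  the sign.\<close>

lemma ip_pw_Suc:
  "(\<Sum>i<n. \<Sum>j<n. ip n (pw n (Suc m) i j) (M i j)) = - (\<Sum>i<n. \<Sum>j<n. ip n (pw n m i j) (Dm n M i j))"
proof -
  have "(\<Sum>i<n. \<Sum>j<n. ip n (pw n (Suc m) i j) (M i j))
      = (\<Sum>i<n. \<Sum>j<n. \<Sum>k<n. ip n (pw n m k j) (io i k (M i j)))"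
    unfolding pw_Suc_left ip_sum_left by (intro sum.cong refl) (simp add: ip_an_mult)
  also have "\<dots> = (\<Sum>i<n. \<Sum>k<n. \<Sum>j<n. ip n (pw n m k j) (io i k (M i j)))"
    by (rule sum.cong[OF refl]) (rule sum.swap)
  also have "\<dots> = (\<Sum>k<n. \<Sum>i<n. \<Sum>j<n. ip n (pw n m k j) (io i k (M i j)))"
    by (rule sum.swap)
  also have "\<dots> = (\<Sum>k<n. \<Sum>j<n. \<Sum>i<n. ip n (pw n m k j) (io i k (M i j)))"
    by (rule sum.cong[OF refl]) (rule sum.swap)
  also have "\<dots> = (\<Sum>k<n. \<Sum>j<n. - ip n (pw n m k j) (Dm n M k j))"
    unfolding Dm_def ip_sum_right sum_negf[symmetric] ip_uminus_right[symmetric] io_skew[symmetric] ..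
  finally show ?thesis by (simp add: sum_negf)
qed

text \<open>Since the entries have real coefficients, it suffices that the form vanishes on \<open>A^(2n-2)\<close>; there the
  multiple is \<open>mu n (2n-2) = 0\<close>.\<close>

theorem kostant_rowen:
  assumes "n \<ge> 2" "k \<ge> 2 * n - 2"
  shows "pw n k i j = 0"
proof -
  obtain a where n: "n = Suc (Suc a)" using assms(1) by (metis add_2_eq_Suc le_Suc_ex)
  \<comment> \<open>\<open>?r\<close> is \<open>2 * n - 2\<close>, in a form to which
    \<open>ip_pw_Suc\<close> applies twice.\<close>
  let ?r = "Suc (Suc (2 * a))"
  have r: "2 * Suc a = ?r" by simp
  have DD: "Dm n (Dm n (pw n ?r)) = (\<lambda>i k. 0)"
    using Dm_Dm_pw[of ?r n] mu_eq_0[of a] unfolding n r by (intro ext) simp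
  have "(\<Sum>i<n. \<Sum>j<n. ip n (pw n ?r i j) (pw n ?r i j)) = 0"
    using ip_pw_Suc[of n "Suc (2 * a)" "pw n ?r"] ip_pw_Suc[of n "2 * a" "Dm n (pw n ?r)"]
    by (simp add: DD del: pw.simps(2))
  then have "of_real (\<Sum>i<n. \<Sum>j<n. \<Sum>S\<in>Pow (pairs n). (Re (cf (pw n ?r i j) S))\<^sup>2) = (0 :: complex)"
    unfolding ip_self[OF real_ea_pw] of_real_sum .
  then have s: "(\<Sum>i<n. \<Sum>j<n. \<Sum>S\<in>Pow (pairs n). (Re (cf (pw n ?r i j) S))\<^sup>2) = 0"
    unfolding of_real_eq_0_iff .
  have z: "pw n ?r i j = 0" for i j
  proof (cases "i < n \<and> j < n")
    case True
    have "(\<Sum>j<n. \<Sum>S\<in>Pow (pairs n). (Re (cf (pw n ?r i j) S))\<^sup>2) = 0"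
      using s True by (subst (asm) sum_nonneg_eq_0_iff) (auto intro!: sum_nonneg)
    then have "(\<Sum>S\<in>Pow (pairs n). (Re (cf (pw n ?r i j) S))\<^sup>2) = 0"
      using True by (subst (asm) sum_nonneg_eq_0_iff) (auto intro!: sum_nonneg)
    then have "ip n (pw n ?r i j) (pw n ?r i j) = 0" unfolding ip_self[OF real_ea_pw] by simp
    then show ?thesis by (rule ip_self_eq_0[OF real_ea_pw supp_pw])
  next
    case False
    then show ?thesis using pw_outside by (metis linorder_not_less)
  qed
  have "k = ?r + (k - ?r)" using assms(2) n by simp
  moreover have "pw n (?r + (k - ?r)) i j = 0" unfolding pw_add[symmetric] z by simp
  ultimately show ?thesis by metis
qed

section \<open>Invariant tensors without contractions\<close>

text \<open>A tensor with positions \<open>X\<close> is a function of index assignments \<open>f\<close> that only depends on \<open>f\<close> on \<open>X\<close>.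
  Invariance is recorded only as invariance under infinitesimal plane rotations and (through
  \<open>even_inv\<close>) under the reflections of the basis vectors.\<close>

definition on_pos :: "nat set \<Rightarrow> ((nat \<Rightarrow> nat) \<Rightarrow> 'a) \<Rightarrow> bool" where
  "on_pos X x \<longleftrightarrow> (\<forall>f g. (\<forall>a\<in>X. f a = g a) \<longrightarrow> x f = x g)"

definition lie_inv :: "nat \<Rightarrow> nat set \<Rightarrow> ((nat \<Rightarrow> nat) \<Rightarrow> complex) \<Rightarrow> bool" where
  "lie_inv n X x \<longleftrightarrow> (\<forall>i<n. \<forall>j<n. i \<noteq> j \<longrightarrow> (\<forall>f. f ` X \<subseteq> {..<n} \<longrightarrow>
     (\<Sum>a\<in>X. if f a = i then x (f(a := j)) else 0) = (\<Sum>a\<in>X. if f a = j then x (f(a := i)) else 0)))"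

definition even_inv :: "nat \<Rightarrow> nat set \<Rightarrow> ((nat \<Rightarrow> nat) \<Rightarrow> complex) \<Rightarrow> bool" where
  "even_inv n X x \<longleftrightarrow> (\<forall>v<n. \<forall>f. f ` X \<subseteq> {..<n} \<longrightarrow> x f \<noteq> 0 \<longrightarrow> even (card {a \<in> X. f a = v}))"

definition ctr :: "nat \<Rightarrow> nat \<Rightarrow> nat \<Rightarrow> ((nat \<Rightarrow> nat) \<Rightarrow> 'a) \<Rightarrow> (nat \<Rightarrow> nat) \<Rightarrow> 'a::comm_monoid_add" where
  "ctr n a b x f = (\<Sum>i<n. x (f(a := i, b := i)))"

fun ctrs :: "nat \<Rightarrow> (nat \<times> nat) list \<Rightarrow> ((nat \<Rightarrow> nat) \<Rightarrow> 'a) \<Rightarrow> (nat \<Rightarrow> nat) \<Rightarrow> 'a::comm_monoid_add" where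
  "ctrs n [] x = x"
| "ctrs n ((a,b) # ps) x = ctrs n ps (ctr n a b x)"

fun matching :: "nat set \<Rightarrow> (nat \<times> nat) list \<Rightarrow> bool" where
  "matching X [] \<longleftrightarrow> X = {}"
| "matching X ((a,b) # ps) \<longleftrightarrow> a \<in> X \<and> b \<in> X \<and> a \<noteq> b \<and> matching (X - {a,b}) ps"

definition ctr_free :: "nat \<Rightarrow> nat set \<Rightarrow> ((nat \<Rightarrow> nat) \<Rightarrow> complex) \<Rightarrow> bool" where
  "ctr_free n X x \<longleftrightarrow> (\<forall>ps f. matching X ps \<longrightarrow> f ` X \<subseteq> {..<n} \<longrightarrow> ctrs n ps x f = 0)"

lemma ctrs_diff: "ctrs n ps (\<lambda>f. x f - y f :: complex) f = ctrs n ps x f - ctrs n ps y f"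
  by (induction ps arbitrary: x y) (auto simp: ctr_def[abs_def] sum_subtractf)

lemma even_inv_ctr:
  assumes "finite X" "a \<in> X" "b \<in> X" "a \<noteq> b" "even_inv n X x"
  shows "even_inv n (X - {a,b}) (ctr n a b x)"
  unfolding even_inv_def
proof (intro allI impI)
  fix v f assume v: "v < n" and f: "f ` (X - {a,b}) \<subseteq> {..<n}" and nz: "ctr n a b x f \<noteq> 0"
  obtain i where i: "i < n" "x (f(a := i, b := i)) \<noteq> 0"
    using nz unfolding ctr_def by (auto elim: sum.not_neutral_contains_not_neutral)
  let ?g = "f(a := i, b := i)"
  have "?g ` X \<subseteq> {..<n}" using f i(1) by (auto simp: image_subset_iff)
  then have e: "even (card {c \<in> X. ?g c = v})" using assms(5) v i(2) unfolding even_inv_def by blast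
  have "{c \<in> X. ?g c = v} = {c \<in> X - {a,b}. f c = v} \<union> (if i = v then {a,b} else {})"
    using assms by auto
  moreover have "card ({c \<in> X - {a,b}. f c = v} \<union> {a,b}) = card {c \<in> X - {a,b}. f c = v} + 2"
    using assms by (subst card_Un_disjoint) auto
  ultimately show "even (card {c \<in> X - {a,b}. f c = v})" using e by (auto split: if_splits)
qed

text \<open>When the rotation acts on one of the contracted positions, what is left is the sum of
  the values with \<open>(j, i)\<close> and with \<open>(i, j)\<close> at \<open>(a, b)\<close>. It
  is symmetric in \<open>i\<close> and \<open>j\<close>, so it drops out of the equation.\<close>

lemma lie_inv_ctr:
  assumes "finite X" "a \<in> X" "b \<in> X" "a \<noteq> b" "lie_inv n X x"
  shows "lie_inv n (X - {a,b}) (ctr n a b x)"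
  unfolding lie_inv_def
proof (intro allI impI)
  fix i j f assume ij: "i < n" "j < n" "i \<noteq> j" and f: "f ` (X - {a,b}) \<subseteq> {..<n}"
  let ?Y = "X - {a,b}"
  let ?g = "\<lambda>k. f(a := k, b := k)"
  have split: "(\<Sum>c\<in>X. F c) = (\<Sum>c\<in>?Y. F c) + F a + F b" for F :: "nat \<Rightarrow> complex"
  proof -
    have "X = insert a (insert b ?Y)" using assms by auto
    then have "sum F X = sum F (insert a (insert b ?Y))" by simp
    also have "\<dots> = sum F ?Y + F a + F b" using assms by (simp add: algebra_simps)
    finally show ?thesis .
  qed
  have half: "(\<Sum>k<n. \<Sum>c\<in>X. if ?g k c = i then x ((?g k)(c := j)) else 0)
    = (\<Sum>c\<in>?Y. if f c = i then ctr n a b x (f(c := j)) else 0)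
      + x (f(a := j, b := i)) + x (f(a := i, b := j))" if "i < n" for i j
  proof -
    have "(\<Sum>k<n. \<Sum>c\<in>X. if ?g k c = i then x ((?g k)(c := j)) else 0)
      = (\<Sum>k<n. (\<Sum>c\<in>?Y. if f c = i then x (f(c := j, a := k, b := k)) else 0))
        + (\<Sum>k<n. if k = i then x (f(a := j, b := i)) else 0)
        + (\<Sum>k<n. if k = i then x (f(a := i, b := j)) else 0)"
      unfolding split sum.distrib[symmetric] using assms(4)
      by (intro sum.cong arg_cong2[of _ _ _ _ "(+)"] refl)
         (auto simp: fun_upd_twist intro!: arg_cong[of _ _ x])
    moreover have "(\<Sum>k<n. (\<Sum>c\<in>?Y. if f c = i then x (f(c := j, a := k, b := k)) else 0))
       = (\<Sum>c\<in>?Y. if f c = i then ctr n a b x (f(c := j)) else 0)"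
      unfolding ctr_def by (subst sum.swap, rule sum.cong[OF refl]) (rule if_split[THEN iffD2], simp)
    ultimately show ?thesis using that by (simp add: sum.delta)
  qed
  have "(\<Sum>c\<in>X. if ?g k c = i then x ((?g k)(c := j)) else 0)
      = (\<Sum>c\<in>X. if ?g k c = j then x ((?g k)(c := i)) else 0)" if "k < n" for k
  proof -
    have "?g k ` X \<subseteq> {..<n}" using f that by (auto simp: image_subset_iff)
    then show ?thesis using assms(5) ij unfolding lie_inv_def by blast
  qed
  then have "(\<Sum>k<n. \<Sum>c\<in>X. if ?g k c = i then x ((?g k)(c := j)) else 0)
     = (\<Sum>k<n. \<Sum>c\<in>X. if ?g k c = j then x ((?g k)(c := i)) else 0)" by simp
  then show "(\<Sum>c\<in>?Y. if f c = i then ctr n a b x (f(c := j)) else 0)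
      = (\<Sum>c\<in>?Y. if f c = j then ctr n a b x (f(c := i)) else 0)"
    unfolding half[OF ij(1)] half[OF ij(2)] by (simp add: algebra_simps)
qed

lemma on_pos_ctr: "on_pos X x \<Longrightarrow> on_pos (X - {a,b}) (ctr n a b x)"
  unfolding on_pos_def ctr_def
proof (intro allI impI sum.cong refl)
  fix f g :: "nat \<Rightarrow> nat" and i
  assume x: "\<forall>f g. (\<forall>a\<in>X. f a = g a) \<longrightarrow> x f = x g" and fg: "\<forall>c\<in>X - {a, b}. f c = g c"
  show "x (f(a := i, b := i)) = x (g(a := i, b := i))"
    by (rule x[rule_format]) (use fg in auto)
qed

lemma ctr_free_ctr:
  assumes "a \<in> X" "b \<in> X" "a \<noteq> b" "on_pos X x" "ctr_free n X x" "n > 0"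
  shows "ctr_free n (X - {a,b}) (ctr n a b x)"
  unfolding ctr_free_def
proof (intro allI impI)
  fix ps f assume m: "matching (X - {a,b}) ps" and f: "f ` (X - {a,b}) \<subseteq> {..<n}"
  have op: "on_pos X y \<Longrightarrow> matching X ps \<Longrightarrow> on_pos {} (ctrs n ps y)" for X ps and y :: "(nat \<Rightarrow> nat) \<Rightarrow> complex"
  proof (induction ps arbitrary: X y)
    case (Cons p ps)
    then show ?case by (cases p) (auto intro!: Cons.IH on_pos_ctr)
  qed auto
  have "matching X ((a,b) # ps)" using m assms by simp
  \<comment> \<open>\<open>f\<close> is bounded only on \<open>X - {a,b}\<close>. Resetting it to 0
    at \<open>a\<close> and \<open>b\<close> makes it admissible, and a complete contraction does
    not depend on \<open>f\<close>.\<close>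
  moreover have "(f(a := 0, b := 0)) ` X \<subseteq> {..<n}" using f assms by (auto simp: image_subset_iff)
  ultimately have "ctrs n ((a,b) # ps) x (f(a := 0, b := 0)) = 0"
    using assms(5) unfolding ctr_free_def by blast
  moreover have "ctrs n ((a,b) # ps) x (f(a := 0, b := 0)) = ctrs n ((a,b) # ps) x f"
    using op[OF assms(4) \<open>matching X ((a,b) # ps)\<close>] unfolding on_pos_def by blast
  ultimately show "ctrs n ps (ctr n a b x) f = 0" by simp
qed

definition null_tensor :: "nat \<Rightarrow> nat set \<Rightarrow> ((nat \<Rightarrow> nat) \<Rightarrow> complex) \<Rightarrow> bool" where
  "null_tensor n X x \<longleftrightarrow> finite X \<and> on_pos X x \<and> lie_inv n X x \<and> even_inv n X x \<and> ctr_free n X x"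

lemma null_tensor_ctr: "null_tensor n X x \<Longrightarrow> a \<in> X \<Longrightarrow> b \<in> X \<Longrightarrow> a \<noteq> b \<Longrightarrow> n > 0 \<Longrightarrow> null_tensor n (X - {a,b}) (ctr n a b x)"
  unfolding null_tensor_def using lie_inv_ctr even_inv_ctr on_pos_ctr ctr_free_ctr by auto

text \<open>For an invariant tensor, rotating in the planes spanned by the last vector \<open>e\<^sub>n\<close> and another
  basis vector expresses the value at \<open>(e\<^sub>n,\<dots>,e\<^sub>n)\<close> through values of contractions.\<close>

lemma null_tensor_last:
  assumes "null_tensor (Suc n) X x" "\<forall>a\<in>X. f a = n"
  shows "x f = 0"
  using assms
proof (induction "card X" arbitrary: X x rule: less_induct)
  case less
  then have fin: "finite X" and op: "on_pos X x" and li: "lie_inv (Suc n) X x"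
    and ev: "even_inv (Suc n) X x" and cf: "ctr_free (Suc n) X x" by (auto simp: null_tensor_def)
  define N where "N = (\<lambda>_::nat. n)"
  have xf: "x f = x N" using op less.prems(2) by (auto simp: on_pos_def N_def)
  have rN: "N ` X \<subseteq> {..<Suc n}" by (auto simp: N_def)
  show ?case
  proof (cases "X = {}")
    case True
    then have "ctrs (Suc n) [] x N = 0" using cf[unfolded ctr_free_def, rule_format, of "[]" N] by simp
    then show ?thesis using xf by simp
  next
    case False
    then obtain b where b: "b \<in> X" by auto
    show ?thesis
    proof (rule ccontr)
      assume "x f \<noteq> 0"
      then have nz: "x N \<noteq> 0" using xf by simp
      then have "even (card {a \<in> X. N a = n})" using ev rN unfolding even_inv_def by blast
      then have ec: "even (card X)" by (simp add: N_def)
      \<comment> \<open>Invariance in the plane of \<open>e_i\<close> and \<open>e_n\<close>, at the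
        assignment with \<open>i\<close> in position \<open>b\<close> and \<open>n\<close>
        everywhere else: one side changes only position \<open>b\<close>, the other each of the
        remaining positions.\<close>
      have step: "x N = (\<Sum>a\<in>X - {b}. x (N(b := i, a := i)))" if i: "i < n" for i
      proof -
        have "(N(b := i)) ` X \<subseteq> {..<Suc n}" using i by (auto simp: N_def)
        then have "(\<Sum>a\<in>X. if (N(b := i)) a = i then x (N(b := i, a := n)) else 0)
           = (\<Sum>a\<in>X. if (N(b := i)) a = n then x (N(b := i, a := i)) else 0)"
          using li[unfolded lie_inv_def, rule_format, of i n "N(b := i)"] i by simp
        moreover have "(\<Sum>a\<in>X. if (N(b := i)) a = i then x (N(b := i, a := n)) else 0)
           = (\<Sum>a\<in>X. if a = b then x N else 0)"
          using i by (intro sum.cong refl) (auto simp: N_def intro!: arg_cong[of _ _ x])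
        moreover have "(\<Sum>a\<in>X. if (N(b := i)) a = n then x (N(b := i, a := i)) else 0)
           = (\<Sum>a\<in>X - {b}. x (N(b := i, a := i)))"
          using i fin by (intro sum.mono_neutral_cong_right) (auto simp: N_def)
        ultimately show ?thesis using b fin by (simp add: sum.delta)
      qed
      have zero: "ctr (Suc n) a b x N = 0" if a: "a \<in> X - {b}" for a
      proof -
        have ab: "a \<in> X" "a \<noteq> b" using a by auto
        have "X - {a,b} \<subset> X" using b by auto
        then have "card (X - {a,b}) < card X" by (rule psubset_card_mono[OF fin])
        then have "ctr (Suc n) a b x f = 0"
          by (rule less.hyps) (use null_tensor_ctr[OF less.prems(1) ab(1) b ab(2)] less.prems(2) in auto)
        moreover have "ctr (Suc n) a b x f = ctr (Suc n) a b x N"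
          using on_pos_ctr[OF op, of a b "Suc n"] less.prems(2) unfolding on_pos_def by (auto simp: N_def)
        ultimately show ?thesis by simp
      qed
      \<comment> \<open>Summing \<open>step\<close> over \<open>i < n\<close> completes each inner
        sum to a contraction, which is zero, up to the missing term \<open>x N\<close>. The result
        is \<open>(n + card X - 1) * x N = 0\<close>.\<close>
      have "of_nat n * x N = (\<Sum>i<n. x N)" by simp
      also have "\<dots> = (\<Sum>i<n. \<Sum>a\<in>X - {b}. x (N(b := i, a := i)))"
        by (rule sum.cong[OF refl], rule step) simp
      also have "\<dots> = (\<Sum>a\<in>X - {b}. \<Sum>i<n. x (N(b := i, a := i)))" by (rule sum.swap)
      also have "\<dots> = (\<Sum>a\<in>X - {b}. - x N)"
      proof (rule sum.cong)
        fix a assume a: "a \<in> X - {b}"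
        have "N(a := n, b := n) = N" by (auto simp: N_def)
        then have "ctr (Suc n) a b x N = (\<Sum>i<n. x (N(b := i, a := i))) + x N"
          using a unfolding ctr_def by (simp add: fun_upd_twist)
        then show "(\<Sum>i<n. x (N(b := i, a := i))) = - x N" using zero[OF a]
          by (simp add: eq_neg_iff_add_eq_0)
      qed simp
      also have "\<dots> = - of_nat (card X - 1) * x N" using b fin by simp
      finally have "of_nat (n + (card X - 1)) * x N = 0" by (simp add: algebra_simps)
      \<comment> \<open>The factor vanishes only in dimension one with a single position; there the
        reflection, through the even number of positions, gives the contradiction.\<close>
      then have "n + (card X - 1) = 0" using nz by (metis mult_eq_0_iff of_nat_eq_0_iff)
      moreover have "card X > 0" using b fin by (auto simp: card_gt_0_iff)
      ultimately have "card X = 1" by simp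
      then show False using ec by simp
    qed
  qed
qed

text \<open>Filling the positions in \<open>S\<close> with the last vector leaves a tensor on the
  other positions that is still invariant for the first \<open>n\<close> basis vectors.\<close>

definition plug :: "nat \<Rightarrow> nat set \<Rightarrow> ((nat \<Rightarrow> nat) \<Rightarrow> complex) \<Rightarrow> (nat \<Rightarrow> nat) \<Rightarrow> complex" where
  "plug n S x f = x (\<lambda>a. if a \<in> S then n else f a)"

text \<open>A contraction over the first \<open>n\<close> basis vectors is the contraction over all \<open>n + 1\<close> of them
  minus the term in which both positions carry the last vector.\<close>

lemma ctrs_plug_eq_0:
  assumes "null_tensor (Suc n) X x" "S \<subseteq> X" "matching (X - S) ps"
  shows "ctrs n ps (plug n S x) f = 0"
  using assms
proof (induction ps arbitrary: X x S)
  case Nil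
  then have "S = X" by auto
  have "x (\<lambda>a. if a \<in> S then n else f a) = 0"
    by (rule null_tensor_last[OF Nil(1)]) (simp add: \<open>S = X\<close>)
  then show ?case by (simp add: plug_def)
next
  case (Cons p ps)
  obtain a b where p: "p = (a,b)" by (cases p)
  have ab: "a \<in> X" "b \<in> X" "a \<notin> S" "b \<notin> S" "a \<noteq> b" "matching (X - S - {a,b}) ps"
    using Cons.prems(3) p by auto
  have "ctr n a b (plug n S x) = (\<lambda>f. plug n S (ctr (Suc n) a b x) f - plug n (S \<union> {a,b}) x f)"
  proof
    fix f
    have "plug n S x (f(a := i, b := i)) = x ((\<lambda>c. if c \<in> S then n else f c)(a := i, b := i))" for i
      unfolding plug_def using ab by (intro arg_cong[of _ _ x]) auto
    moreover have "plug n (S \<union> {a,b}) x f = x ((\<lambda>c. if c \<in> S then n else f c)(a := n, b := n))"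
      unfolding plug_def using ab by (intro arg_cong[of _ _ x]) auto
    moreover have "plug n S (ctr (Suc n) a b x) f
        = (\<Sum>i<Suc n. x ((\<lambda>c. if c \<in> S then n else f c)(a := i, b := i)))"
      by (simp only: plug_def ctr_def)
    ultimately show "ctr n a b (plug n S x) f = plug n S (ctr (Suc n) a b x) f - plug n (S \<union> {a,b}) x f"
      unfolding ctr_def[of n] by simp
  qed
  then have "ctrs n (p # ps) (plug n S x) f
     = ctrs n ps (plug n S (ctr (Suc n) a b x)) f - ctrs n ps (plug n (S \<union> {a,b}) x) f"
    by (simp add: p ctrs_diff)
  moreover have "ctrs n ps (plug n S (ctr (Suc n) a b x)) f = 0"
  proof (rule Cons.IH)
    show "null_tensor (Suc n) (X - {a,b}) (ctr (Suc n) a b x)" by (rule null_tensor_ctr) (use Cons.prems ab in auto)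
    show "S \<subseteq> X - {a,b}" using Cons.prems ab by auto
    have "X - {a,b} - S = X - S - {a,b}" by auto
    then show "matching (X - {a,b} - S) ps" using ab by simp
  qed
  moreover have "ctrs n ps (plug n (S \<union> {a,b}) x) f = 0"
  proof (rule Cons.IH[OF Cons.prems(1)])
    show "S \<union> {a,b} \<subseteq> X" using Cons.prems ab by auto
    have "X - (S \<union> {a,b}) = X - S - {a,b}" by auto
    then show "matching (X - (S \<union> {a,b})) ps" using ab by simp
  qed
  ultimately show ?case by simp
qed

theorem null_tensor_eq_0:
  assumes "null_tensor n X x" "f ` X \<subseteq> {..<n}"
  shows "x f = 0"
  using assms
proof (induction n arbitrary: X x f)
  case 0
  then have "X = {}" by auto
  then have "ctrs 0 [] x f = 0" using 0(1)[unfolded null_tensor_def ctr_free_def] by (metis image_empty empty_subsetI matching.simps(1))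
  then show ?case by simp
next
  case (Suc n)
  then have fin: "finite X" and op: "on_pos X x" and li: "lie_inv (Suc n) X x"
    and ev: "even_inv (Suc n) X x" by (auto simp: null_tensor_def)
  \<comment> \<open>With this choice \<open>plug n S x\<close> agrees with \<open>x\<close> at
    \<open>f\<close>, and on the remaining positions \<open>f\<close> takes values below
    \<open>n\<close>.\<close>
  define S where "S = {a \<in> X. f a = n}"
  let ?y = "plug n S x"
  let ?u = "\<lambda>g a. if a \<in> S then n else g a :: nat"
  have S: "S \<subseteq> X" "finite S" using fin by (auto simp: S_def)
  have rng: "?u g ` X \<subseteq> {..<Suc n}" if "g ` (X - S) \<subseteq> {..<n}" for g
    using that by (force simp: image_subset_iff less_Suc_eq)
  have "null_tensor n (X - S) ?y"
    unfolding null_tensor_def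
  proof (intro conjI)
    show "finite (X - S)" using fin by simp
    show "on_pos (X - S) ?y" using op unfolding on_pos_def plug_def by auto
    show "lie_inv n (X - S) ?y"
      unfolding lie_inv_def
    proof (intro allI impI)
      fix i j g assume ij: "i < n" "j < n" "i \<noteq> j" and g: "g ` (X - S) \<subseteq> {..<n}"
      \<comment> \<open>Positions in \<open>S\<close> carry \<open>n\<close>, which differs from
        \<open>i\<close> and \<open>j\<close>, so the rotation leaves them alone.\<close>
      have "(\<Sum>a\<in>X. if ?u g a = i then x ((?u g)(a := j)) else 0)
          = (\<Sum>a\<in>X - S. if g a = i then plug n S x (g(a := j)) else 0)" if "i < n" for i j
        unfolding plug_def using that fin
        by (intro sum.mono_neutral_cong_right) (auto intro!: arg_cong[of _ _ x])
      then show "(\<Sum>a\<in>X - S. if g a = i then plug n S x (g(a := j)) else 0)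
          = (\<Sum>a\<in>X - S. if g a = j then plug n S x (g(a := i)) else 0)"
        using li[unfolded lie_inv_def, rule_format, of i j "?u g"] ij rng[OF g] by simp
    qed
    show "even_inv n (X - S) ?y"
      unfolding even_inv_def
    proof (intro allI impI)
      fix v g assume v: "v < n" and g: "g ` (X - S) \<subseteq> {..<n}" and nz: "plug n S x g \<noteq> 0"
      have "even (card {a \<in> X. ?u g a = v})"
        using ev[unfolded even_inv_def, rule_format, of v "?u g"] v rng[OF g] nz by (simp add: plug_def)
      moreover have "{a \<in> X. ?u g a = v} = {a \<in> X - S. g a = v}" using v by auto
      ultimately show "even (card {a \<in> X - S. g a = v})" by simp
    qed
    show "ctr_free n (X - S) ?y"
      unfolding ctr_free_def using ctrs_plug_eq_0[OF Suc.prems(1) S(1)] by blast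
  qed
  moreover have "f ` (X - S) \<subseteq> {..<n}" using Suc.prems(2) by (force simp: S_def less_Suc_eq)
  ultimately have "?y f = 0" by (rule Suc.IH)
  moreover have "?u f = f" by (auto simp: S_def)
  ultimately show ?case by (simp add: plug_def)
qed

section \<open>Products of anticommuting elements and words in the matrix entries\<close>

definition oprod :: "('i::linorder \<Rightarrow> ea) \<Rightarrow> 'i set \<Rightarrow> ea" where
  "oprod G S = prod_list (map G (sorted_list_of_set S))"

definition invs :: "'i::linorder set \<Rightarrow> 'i set \<Rightarrow> nat" where
  "invs T U = card {(t,u). t \<in> T \<and> u \<in> U \<and> u < t}"

lemma inv_count_invs: "inv_count = invs"
  by (intro ext) (simp add: inv_count_def invs_def)

lemma invs_insert:
  fixes A T :: "'i::linorder set"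
  assumes "finite A" "finite T" "b \<notin> A"
  shows "invs (insert b A) T = card {u \<in> T. u < b} + invs A T"
proof -
  have "{(t,u). t \<in> insert b A \<and> u \<in> T \<and> u < t}
      = Pair b ` {u \<in> T. u < b} \<union> {(t,u). t \<in> A \<and> u \<in> T \<and> u < t}" by auto
  moreover have "finite {(t,u). t \<in> A \<and> u \<in> T \<and> u < t}"
    by (rule finite_subset[of _ "A \<times> T"]) (use assms in auto)
  moreover have "Pair b ` {u \<in> T. u < b} \<inter> {(t,u). t \<in> A \<and> u \<in> T \<and> u < t} = {}"
    using assms(3) by auto
  ultimately show ?thesis
    using assms by (simp add: invs_def card_Un_disjoint card_image inj_on_def)
qed

lemma oprod_empty [simp]: "oprod G {} = 1"
  by (simp add: oprod_def)

lemma oprod_insert_min: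
  assumes "finite A" "\<And>a. a \<in> A \<Longrightarrow> b < a"
  shows "oprod G (insert b A) = G b * oprod G A"
proof -
  have "b \<notin> A" using assms(2) by blast
  have "sorted_list_of_set (insert b A) = insort b (sorted_list_of_set A)"
    using assms \<open>b \<notin> A\<close> by (simp add: sorted_list_of_set.fold_insort_key.insert_remove)
  also have "\<dots> = b # sorted_list_of_set A"
    using assms by (intro insort_is_Cons) (auto intro: less_imp_le)
  finally show ?thesis by (simp add: oprod_def)
qed

text \<open>Moving \<open>G p\<close> to its place passes exactly the factors of smaller index. A
  repeated factor gives 0 because anticommutation with itself forces
  \<open>G p * G p = 0\<close>.\<close>

lemma mult_oprod:
  assumes ac: "\<And>i j. G i * G j = - (G j * G i)" and "finite T"
  shows "G p * oprod G T = (if p \<in> T then 0 else (-1) ^ card {t \<in> T. t < p} * oprod G (insert p T))"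
  using \<open>finite T\<close>
proof (induction T rule: finite_linorder_min_induct)
  case empty
  show ?case using oprod_insert_min[of "{}" p G] by simp
next
  case (insert b A)
  have fA: "finite A" using insert.hyps by simp
  have e: "oprod G (insert b A) = G b * oprod G A"
    by (rule oprod_insert_min) (use insert.hyps in auto)
  consider "p = b" | "p < b" | "b < p" by force
  then show ?case
  proof cases
    case 1
    have "G b * G b = 0" using ac[of b b] by (rule ea_eq_uminus_self)
    then show ?thesis unfolding e 1 by (simp add: mult.assoc[symmetric])
  next
    case 2
    then have l: "\<And>a. a \<in> insert b A \<Longrightarrow> p < a" using insert.hyps by force
    then have em: "{t \<in> insert b A. t < p} = {}" and n: "p \<notin> insert b A" by (blast dest: less_asym, blast)
    have "G p * oprod G (insert b A) = oprod G (insert p (insert b A))"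
      by (rule oprod_insert_min[symmetric]) (use l fA in auto)
    then show ?thesis unfolding em using n by simp
  next
    case 3
    have "G p * oprod G (insert b A) = - (G b * (G p * oprod G A))"
      unfolding e mult.assoc[symmetric] by (subst ac) simp
    also have "\<dots> = - (G b * (if p \<in> A then 0 else (-1) ^ card {t \<in> A. t < p} * oprod G (insert p A)))"
      by (simp add: insert.IH)
    also have "\<dots> = (if p \<in> A then 0 else - ((-1) ^ card {t \<in> A. t < p} * (G b * oprod G (insert p A))))"
      by (simp add: mult_m1_power)
    also have "G b * oprod G (insert p A) = oprod G (insert b (insert p A))"
      by (rule oprod_insert_min[symmetric]) (use insert.hyps fA 3 in auto)
    also have "insert b (insert p A) = insert p (insert b A)" by auto
    also have "(if p \<in> A then 0 else - ((-1) ^ card {t \<in> A. t < p} * oprod G (insert p (insert b A))))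
       = (if p \<in> insert b A then 0 else (-1) ^ card {t \<in> insert b A. t < p} * oprod G (insert p (insert b A)))"
    proof -
      have "{t \<in> insert b A. t < p} = insert b {t \<in> A. t < p}" using 3 by auto
      moreover have "b \<notin> A" using insert.hyps by blast
      ultimately have "card {t \<in> insert b A. t < p} = Suc (card {t \<in> A. t < p})" using fA by simp
      then show ?thesis using 3 by auto
    qed
    finally show ?thesis .
  qed
qed

text \<open>The multiplication rule of monomials, for any anticommuting family: applied to the
  images of generators it makes the group action multiplicative, applied to the \<open>qq\<close> it
  serves independence.\<close>

lemma oprod_mult:
  assumes ac: "\<And>i j. G i * G j = - (G j * G i)" and "finite S" "finite T"
  shows "oprod G S * oprod G T = (if S \<inter> T = {} then (-1) ^ invs S T * oprod G (S \<union> T) else 0)"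
  using \<open>finite S\<close>
proof (induction S rule: finite_linorder_min_induct)
  case empty
  then show ?case by (simp add: invs_def)
next
  case (insert b A)
  have fA: "finite A" and bA: "b \<notin> A" using insert.hyps by auto
  have "oprod G (insert b A) * oprod G T = G b * (oprod G A * oprod G T)"
    by (subst oprod_insert_min) (use insert.hyps in \<open>auto simp: mult.assoc\<close>)
  also have "\<dots> = (if A \<inter> T = {} then (-1) ^ invs A T * (G b * oprod G (A \<union> T)) else 0)"
    by (simp add: insert.IH mult_m1_power)
  also have "\<dots> = (if insert b A \<inter> T = {} then (-1) ^ invs (insert b A) T * oprod G (insert b A \<union> T) else 0)"
  proof -
    have "\<not> a < b" if "a \<in> A" for a using insert.hyps(2) that by (simp add: not_less less_imp_le)
    then have eq: "{t \<in> A \<union> T. t < b} = {t \<in> T. t < b}" by blast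
    have fin: "finite (A \<union> T)" using fA assms(3) by simp
    have *: "G b * oprod G (A \<union> T)
        = (if b \<in> A \<union> T then 0 else (-1) ^ card {t \<in> T. t < b} * oprod G (insert b (A \<union> T)))"
      unfolding eq[symmetric] by (rule mult_oprod) (rule ac, rule fin)
    show ?thesis
      unfolding * invs_insert[OF fA assms(3) bA] add.commute[of "card _"] power_add using bA
      by (simp add: mult.assoc)
  qed
  finally show ?case .
qed

section \<open>Trace generators and words in the matrix entries\<close>

definition qq :: "nat \<Rightarrow> nat \<Rightarrow> ea" where
  "qq n k = tr n (4 * k + 3)"

lemma qq_anticomm: "qq n i * qq n j = - (qq n j * qq n i)"
  using parity_commute[OF parity_tr[of "4 * i + 3" n] parity_tr[of "4 * j + 3" n]] by (simp add: qq_def)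

lemma qq_eq_0:
  assumes "k \<ge> ngen n"
  shows "qq n k = 0"
proof (cases "n \<ge> 2")
  case True
  \<comment> \<open>For \<open>n = 2m\<close> the first exponent after the list is
    \<open>4m - 1\<close> against the bound \<open>4m - 2\<close>; for \<open>n = 2m + 1\<close> it
    is \<open>4m + 3\<close> against \<open>4m\<close>.\<close>
  have "4 * k + 3 \<ge> 2 * n - 2" using assms by (auto simp: ngen_def split: if_splits elim!: evenE oddE)
  then show ?thesis unfolding qq_def tr_def using kostant_rowen[OF True] by simp
next
  case False
  then have "an n i j = 0" for i j by (auto simp: an_def)
  then have "pw n (Suc m) i j = 0" for m i j by simp
  moreover have "4 * k + 3 = Suc (4 * k + 2)" by simp
  ultimately show ?thesis unfolding qq_def tr_def by (simp only: sum.neutral_const)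
qed

text \<open>Signed products of traces and entries of powers of \<open>A\<close> in which each
  position of \<open>X\<close> occurs exactly once as an index. Unlike products of entries of
  \<open>A\<close> alone, this class is closed under contraction.\<close>

inductive word :: "nat \<Rightarrow> nat set \<Rightarrow> ((nat \<Rightarrow> nat) \<Rightarrow> ea) \<Rightarrow> bool" for n where
  one: "word n {} (\<lambda>_. 1)"
| neg: "word n X F \<Longrightarrow> word n X (\<lambda>f. - F f)"
| tr: "word n X F \<Longrightarrow> word n X (\<lambda>f. tr n k * F f)"
| pw: "word n X F \<Longrightarrow> u \<notin> X \<Longrightarrow> v \<notin> X \<Longrightarrow> u \<noteq> v \<Longrightarrow>
    word n (insert u (insert v X)) (\<lambda>f. pw n k (f u) (f v) * F f)"

lemma on_pos_mono: "on_pos X F \<Longrightarrow> X \<subseteq> Y \<Longrightarrow> on_pos Y F"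
  unfolding on_pos_def by (meson subsetD)

lemma on_pos_mult: "on_pos X F \<Longrightarrow> on_pos X G \<Longrightarrow> on_pos X (\<lambda>f. F f * G f :: ea)"
  unfolding on_pos_def by (intro allI impI arg_cong2[of _ _ _ _ "(*)"]) blast+

lemma word_on_pos: "word n X F \<Longrightarrow> on_pos X F"
proof (induction rule: word.induct)
  case one
  show ?case by (simp add: on_pos_def)
next
  case (neg X F)
  then show ?case unfolding on_pos_def by (intro allI impI arg_cong[of _ _ uminus]) blast
next
  case (tr X F k)
  have "on_pos X (\<lambda>f. tr n k)" by (simp add: on_pos_def)
  then show ?case using tr.IH by (rule on_pos_mult)
next
  case (pw X F u v k)
  have "on_pos (insert u (insert v X)) (\<lambda>f. pw n k (f u) (f v))" by (simp add: on_pos_def)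
  moreover have "on_pos (insert u (insert v X)) F" by (rule on_pos_mono[OF pw.IH]) auto
  ultimately show ?case by (rule on_pos_mult)
qed

lemma word_sgn: "word n X F \<Longrightarrow> word n X (\<lambda>f. (-1) ^ m * F f)"
  by (cases "even m") (auto dest: word.neg)

lemma eps_sgn: "\<exists>m. (of_int (eps k) :: ea) = (-1) ^ m"
proof (induction k)
  case 0
  show ?case by (rule exI[of _ 0]) simp
next
  case (Suc k)
  then obtain m where "(of_int (eps k) :: ea) = (-1) ^ m" by blast
  then show ?case by (intro exI[of _ "Suc (k + m)"]) (simp add: power_add)
qed

lemma parity_swap:
  assumes "parity k x" "parity l y"
  shows "x * (y * z) = y * ((-1) ^ (k * l) * (x * z))"
  unfolding mult_m1_power by (simp only: mult.assoc[symmetric] parity_commute[OF assms])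

definition front :: "nat \<Rightarrow> nat set \<Rightarrow> nat \<Rightarrow> ((nat \<Rightarrow> nat) \<Rightarrow> ea) \<Rightarrow> bool" where
  "front n X a F \<longleftrightarrow> (\<exists>k v G. v \<in> X \<and> v \<noteq> a \<and> word n (X - {a,v}) G \<and> (\<forall>f. F f = pw n k (f a) (f v) * G f))"

lemma frontI:
  assumes "v \<in> X" "v \<noteq> a" "word n (X - {a,v}) G" "\<And>f. F f = pw n k (f a) (f v) * G f"
  shows "front n X a F"
  unfolding front_def using assms by blast

text \<open>The factor holding position \<open>a\<close> can be brought to the front, with
  \<open>a\<close> as its row index: commuting and transposing cost only signs, which the remaining
  word absorbs.\<close>

lemma word_front:
  assumes "word n X F" "a \<in> X"
  shows "front n X a F"
  using assms
proof (induction rule: word.induct)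
  case one
  then show ?case by simp
next
  case (neg X F)
  then obtain k v G where 1: "v \<in> X" "v \<noteq> a" "word n (X - {a,v}) G" "\<And>f. F f = pw n k (f a) (f v) * G f"
    unfolding front_def by blast
  show ?case by (rule frontI[OF 1(1,2) word.neg[OF 1(3)], of _ k]) (simp add: 1(4))
next
  case (tr X F l)
  then obtain k v G where 1: "v \<in> X" "v \<noteq> a" "word n (X - {a,v}) G" "\<And>f. F f = pw n k (f a) (f v) * G f"
    unfolding front_def by blast
  show ?case
  proof (rule frontI[OF 1(1,2) word_sgn[OF word.tr[OF 1(3)]]])
    show "tr n l * F f = pw n k (f a) (f v) * ((-1) ^ (l * k) * (tr n l * G f))" for f
      unfolding 1(4) by (rule parity_swap[OF parity_tr parity_pw])
  qed
next
  case (pw X F u v k)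
  consider "a = u" | "a = v" | "a \<in> X" "a \<noteq> u" "a \<noteq> v" using pw.prems by blast
  then show ?case
  proof cases
    case 1
    have "insert u (insert v X) - {a,v} = X" using pw.hyps 1 by auto
    then have "word n (insert u (insert v X) - {a,v}) F" using pw.hyps(1) by simp
    then show ?thesis by (rule frontI[rotated 2, of _ _ _ _ _ _ k]) (use pw.hyps 1 in auto)
  next
    case 2
    obtain m where m: "(of_int (eps k) :: ea) = (-1) ^ m" using eps_sgn by blast
    have "insert u (insert v X) - {a,u} = X" using pw.hyps 2 by auto
    then have "word n (insert u (insert v X) - {a,u}) (\<lambda>f. (-1) ^ m * F f)"
      using word_sgn[OF pw.hyps(1)] by simp
    then show ?thesis
    proof (rule frontI[rotated 2])
      show "pw n k (f u) (f v) * F f = pw n k (f a) (f u) * ((-1) ^ m * F f)" for f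
        unfolding 2 by (subst pw_transpose) (simp add: m mult.assoc mult_m1_power)
    qed (use pw.hyps 2 in auto)
  next
    case 3
    then obtain l w G where 4: "w \<in> X" "w \<noteq> a" "word n (X - {a,w}) G" "\<And>f. F f = pw n l (f a) (f w) * G f"
      using pw.IH unfolding front_def by blast
    have "insert u (insert v (X - {a,w})) = insert u (insert v X) - {a,w}"
      using pw.hyps 3 4(1) by auto
    moreover have "word n (insert u (insert v (X - {a,w}))) (\<lambda>f. (-1) ^ (k * l) * (pw n k (f u) (f v) * G f))"
      using word_sgn[OF word.pw[OF 4(3), of u v k], of "k * l"] pw.hyps by simp
    ultimately have "word n (insert u (insert v X) - {a,w}) (\<lambda>f. (-1) ^ (k * l) * (pw n k (f u) (f v) * G f))"
      by simp
    then show ?thesis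
    proof (rule frontI[rotated 2])
      show "pw n k (f u) (f v) * F f = pw n l (f a) (f w) * ((-1) ^ (k * l) * (pw n k (f u) (f v) * G f))" for f
        unfolding 4(4) by (rule parity_swap[OF parity_pw parity_pw])
    qed (use 4 in auto)
  qed
qed

text \<open>If \<open>a\<close> and \<open>b\<close> index the same entry, contraction closes it to
  a trace. Otherwise the two entries are brought to the front with rows \<open>a\<close> and
  \<open>b\<close>; transposing the first lets them multiply to one entry of a higher power.\<close>

lemma word_ctr:
  assumes "word n X F" "a \<in> X" "b \<in> X" "a \<noteq> b"
  shows "word n (X - {a,b}) (ctr n a b F)"
proof -
  obtain k v G where 1: "v \<in> X" "v \<noteq> a" "word n (X - {a,v}) G" "\<And>f. F f = pw n k (f a) (f v) * G f"
    using word_front[OF assms(1,2)] unfolding front_def by blast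
  show ?thesis
  proof (cases "v = b")
    case True
    have "G (f(a := i, b := i)) = G f" for f i
      using word_on_pos[OF 1(3)] unfolding on_pos_def True by auto
    then have "ctr n a b F = (\<lambda>f. tr n k * G f)"
      using True assms(4) by (auto simp: ctr_def 1(4) tr_def sum_distrib_right)
    then show ?thesis using word.tr[OF 1(3)] True by simp
  next
    case False
    then have "b \<in> X - {a,v}" using assms by auto
    then obtain l w H where 2: "w \<in> X - {a,v}" "w \<noteq> b" "word n (X - {a,v} - {b,w}) H"
      "\<And>f. G f = pw n l (f b) (f w) * H f"
      using word_front[OF 1(3)] unfolding front_def by blast
    obtain m where m: "(of_int (eps k) :: ea) = (-1) ^ m" using eps_sgn by blast
    have H: "H (f(a := i, b := i)) = H f" for f i
      using word_on_pos[OF 2(3)] unfolding on_pos_def by auto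
    have "ctr n a b F f = (-1) ^ m * (pw n (k + l) (f v) (f w) * H f)" for f
    proof -
      have "ctr n a b F f = (\<Sum>i<n. pw n k i (f v) * (pw n l i (f w) * H f))"
        unfolding ctr_def 1(4) 2(4) H using False 1(1,2) 2(1,2) assms(2-4) by (intro sum.cong refl) auto
      also have "\<dots> = (\<Sum>i<n. (-1) ^ m * (pw n k (f v) i * pw n l i (f w) * H f))"
        by (intro sum.cong refl, subst pw_transpose) (simp add: m mult.assoc)
      also have "\<dots> = (-1) ^ m * (pw n (k + l) (f v) (f w) * H f)"
        by (simp only: sum_distrib_left[symmetric] sum_distrib_right[symmetric] pw_add)
      finally show ?thesis .
    qed
    then have e: "ctr n a b F = (\<lambda>f. (-1) ^ m * (pw n (k + l) (f v) (f w) * H f))" by auto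
    have "X - {a,b} = insert v (insert w (X - {a,v} - {b,w}))" using False 1(1,2) 2(1,2) assms(2-4) by auto
    moreover have "word n (insert v (insert w (X - {a,v} - {b,w}))) (ctr n a b F)"
      unfolding e using word_sgn[OF word.pw[OF 2(3), of v w "k + l"], of m] 2(1,2) by auto
    ultimately show ?thesis by simp
  qed
qed

lemma word_ctrs: "word n X F \<Longrightarrow> matching X ps \<Longrightarrow> word n {} (ctrs n ps F)"
proof (induction ps arbitrary: X F)
  case (Cons p ps)
  then show ?case by (cases p) (auto intro!: Cons.IH word_ctr)
qed auto

text \<open>Without positions only traces are left. A nonzero one is the scalar \<open>n\<close> or
  some \<open>qq n q\<close> with \<open>q < ngen n\<close>, and \<open>mult_oprod\<close> sorts it
  into the ordered product.\<close>

lemma word_empty: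
  assumes "word n X F" "X = {}"
  shows "\<exists>c J. J \<subseteq> {..<ngen n} \<and> F f = cst c * oprod (qq n) J"
  using assms
proof (induction rule: word.induct)
  case one
  show ?case by (rule exI[of _ 1], rule exI[of _ "{}"]) simp
next
  case (neg X F)
  then obtain c J where "J \<subseteq> {..<ngen n}" "F f = cst c * oprod (qq n) J" by blast
  then show ?case by (intro exI[of _ "- c"] exI[of _ J]) (simp add: cst_minus)
next
  case (tr X F k)
  then obtain c J where J: "J \<subseteq> {..<ngen n}" "F f = cst c * oprod (qq n) J" by blast
  have fin: "finite J" by (rule finite_subset[OF J(1)]) simp
  have e: "tr n k * F f = cst c * (tr n k * oprod (qq n) J)"
    by (simp only: J mult.assoc[symmetric] cst_commute)
  show ?case
  proof (cases "tr n k = 0")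
    case True
    then show ?thesis using J by (intro exI[of _ 0] exI[of _ J]) simp
  next
    case False
    then show ?thesis
    proof (cases rule: tr_nonzero_cases)
      case 1
      have "tr n k = cst (of_int (int n))" unfolding 1 tr_0 cst_of_int by simp
      then show ?thesis unfolding e using J
        by (intro exI[of _ "c * of_int (int n)"] exI[of _ J]) (simp add: cst_mult mult.assoc)
    next
      case (2 q)
      then have q: "tr n k = qq n q" by (simp add: qq_def)
      then have "q < ngen n" using qq_eq_0[of n q] False by (metis not_le)
      have m: "(-1 :: ea) ^ j = cst ((-1) ^ j)" for j
        by (cases "even j") (auto simp: cst_minus)
      have "tr n k * oprod (qq n) J
          = (if q \<in> J then 0 else (-1) ^ card {t \<in> J. t < q} * oprod (qq n) (insert q J))"
        unfolding q by (rule mult_oprod[where G = "qq n", OF qq_anticomm fin])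
      then have "tr n k * F f = cst (if q \<in> J then 0 else c * (-1) ^ card {t \<in> J. t < q}) * oprod (qq n) (insert q J)"
        unfolding e by (simp add: cst_mult mult.assoc m)
      then show ?thesis using J(1) \<open>q < ngen n\<close> by (intro exI conjI) auto
    qed
  qed
qed auto

section \<open>Invariants orthogonal to all trace products\<close>

text \<open>The derivation replacing the basis vector \<open>e\<^sub>j\<close> by \<open>e\<^sub>i\<close>.\<close>

definition rot :: "nat \<Rightarrow> nat \<Rightarrow> nat \<Rightarrow> ea \<Rightarrow> ea" where
  "rot n i j y = (\<Sum>k<n. an n i k * io j k y)"

lemma ea_double_cancel: "(x :: ea) + x = y + y \<Longrightarrow> x = y"
proof -
  assume "x + x = y + y"
  then have "x - y = - (x - y)" by (simp add: algebra_simps)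
  then have "x - y = 0" by (rule ea_eq_uminus_self)
  then show ?thesis by simp
qed

text \<open>\<open>x + gi x\<close> and \<open>x - gi x\<close> are twice the even and the odd part
  of \<open>x\<close>, and \<open>y\<close> commutes with the one and anticommutes with the
  other.\<close>

lemma mult_gi:
  assumes "parity 1 y"
  shows "y * gi x = x * y"
proof (rule ea_double_cancel)
  have "(-1 :: complex) ^ k * ((-1) ^ k * z) = z" for k z
    by (simp add: mult.assoc[symmetric] power_add[symmetric])
  then have gg: "gi (gi x) = x" by (intro ea_eqI) simp
  have p0: "parity 0 (x + gi x)" by (simp add: parity_def sgn_aut_add gg add.commute)
  have p1: "parity 1 (x - gi x)"
    using sgn_aut_add[of "\<lambda>_. Suc 0" x "- gi x"] by (simp add: parity_def sgn_aut_uminus gg)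
  have "y * (x + gi x) = (x + gi x) * y" "y * (x - gi x) = - ((x - gi x) * y)"
    using parity_commute[OF assms p0] parity_commute[OF assms p1] by simp_all
  then have "y * (x + gi x) - y * (x - gi x) = (x + gi x) * y + (x - gi x) * y" by simp
  then show "y * gi x + y * gi x = x * y + x * y" by (simp add: algebra_simps)
qed

text \<open>Left multiplication by an odd element turns an antiderivation into an ordinary
  derivation.\<close>

lemma rot_mult: "rot n i j (x * y) = rot n i j x * y + x * rot n i j y"
proof -
  have "an n i k * io j k (x * y) = an n i k * io j k x * y + x * (an n i k * io j k y)" for k
    using mult_gi[OF parity_an[of n i k], of x] by (simp add: io_mult distrib_left mult.assoc[symmetric])
  then show ?thesis by (simp add: rot_def sum.distrib sum_distrib_left sum_distrib_right)
qed

lemma rot_1 [simp]: "rot n i j 1 = 0" by (simp add: rot_def)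
lemma rot_minus: "rot n i j (x - y) = rot n i j x - rot n i j y"
  by (simp add: rot_def io_minus right_diff_distrib sum_subtractf)

lemma rot_sum: "rot n i j (sum f I) = (\<Sum>k\<in>I. rot n i j (f k))"
  unfolding rot_def io_sum sum_distrib_left by (rule sum.swap)

lemma rot_an:
  assumes "j < n" "r < n" "s < n"
  shows "rot n i j (an n r s) = (if r = j then an n i s else 0) + (if s = j then an n r i else 0)"
proof -
  have "rot n i j (an n r s) = mid n j r * (\<Sum>k<n. an n i k * mid n k s) - mid n j s * (\<Sum>k<n. an n i k * mid n k r)"
    unfolding rot_def io_an sum_distrib_left sum_subtractf[symmetric]
    by (rule sum.cong) (auto simp: mid_def)
  also have "\<dots> = mid n j r * an n i s - mid n j s * an n i r"
    using assms by (simp add: sum_mid_right)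
  also have "\<dots> = (if r = j then an n i s else 0) + (if s = j then an n r i else 0)"
    using assms an_skew[of n i r] by (auto simp: mid_def)
  finally show ?thesis .
qed

text \<open>Multiplication by \<open>a_ik\<close> and \<open>io i k\<close> are adjoint, so the two
  operations in each summand exchange their roles. This carries the invariance of \<open>y\<close>
  over to the tensor obtained by pairing with \<open>y\<close>.\<close>

lemma ip_rot:
  assumes "i < n" "j < n"
  shows "ip n y (rot n i j z) = ip n (rot n j i y) z"
  unfolding rot_def ip_sum_left ip_sum_right
proof (rule sum.cong)
  fix k assume "k \<in> {..<n}"
  then show "ip n y (an n i k * io j k z) = ip n (an n j k * io i k y) z"
    using ip_an_mult[OF assms(1), of k "io j k z" y] ip_an_mult[OF assms(2), of k "io i k y" z] assms
    by (simp add: ip_commute)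
qed simp

text \<open>The product of \<open>d\<close> generators as a tensor in its \<open>2 * d\<close>
  indices. Pairing it with an element turns that element into a scalar tensor.\<close>

primrec wd :: "nat \<Rightarrow> nat \<Rightarrow> (nat \<Rightarrow> nat) \<Rightarrow> ea" where
  "wd n 0 = (\<lambda>f. 1)"
| "wd n (Suc d) = (\<lambda>f. an n (f (2 * d)) (f (2 * d + 1)) * wd n d f)"

lemma lessThan_double_Suc: "{..<2 * Suc d} = insert (2 * d) (insert (2 * d + 1) {..<2 * d})"
  by auto

lemma word_wd: "word n {..<2 * d} (wd n d)"
proof (induction d)
  case 0
  show ?case using word.one by simp
next
  case (Suc d)
  have "word n (insert (2 * d) (insert (2 * d + 1) {..<2 * d}))
      (\<lambda>f. pw n (Suc 0) (f (2 * d)) (f (2 * d + 1)) * wd n d f)"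
    by (rule word.pw[OF Suc]) auto
  then show ?case unfolding pw_1 lessThan_double_Suc by simp
qed

lemma on_pos_wd: "on_pos {..<2 * d} (wd n d)"
  by (rule word_on_pos[OF word_wd])

lemma wd_upd: "a \<ge> 2 * d \<Longrightarrow> wd n d (f(a := v)) = wd n d f"
  using on_pos_wd unfolding on_pos_def by auto

lemma rot_wd:
  assumes "i < n" "j < n" "f ` {..<2 * d} \<subseteq> {..<n}"
  shows "rot n i j (wd n d f) = (\<Sum>a<2 * d. if f a = j then wd n d (f(a := i)) else 0)"
  using assms(3)
proof (induction d)
  case (Suc d)
  have sub: "f ` {..<2 * d} \<subseteq> {..<n}" and fd: "f (2 * d) < n" "f (2 * d + 1) < n"
    using Suc.prems unfolding lessThan_double_Suc by auto
  let ?a = "an n (f (2 * d)) (f (2 * d + 1))"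
  have "rot n i j (wd n (Suc d) f) = rot n i j ?a * wd n d f
     + (\<Sum>a<2 * d. if f a = j then ?a * wd n d (f(a := i)) else 0)"
    unfolding wd.simps rot_mult Suc.IH[OF sub] sum_distrib_left
    by (intro arg_cong2[of _ _ _ _ "(+)"] sum.cong refl) auto
  also have "(\<Sum>a<2 * d. if f a = j then ?a * wd n d (f(a := i)) else 0)
     = (\<Sum>a<2 * d. if f a = j then wd n (Suc d) (f(a := i)) else 0)"
    by (rule sum.cong) auto
  also have "rot n i j ?a * wd n d f = (if f (2 * d) = j then wd n (Suc d) (f(2 * d := i)) else 0)
     + (if f (2 * d + 1) = j then wd n (Suc d) (f(2 * d + 1 := i)) else 0)"
    unfolding rot_an[OF assms(2) fd] by (auto simp: distrib_right wd_upd)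
  finally show ?case
    unfolding lessThan_double_Suc by (subst sum.insert, simp, simp)+ (simp add: add_ac)
qed simp

text \<open>The exponent of the sign that the reflection of \<open>e_v\<close> puts on the generator
  \<open>p\<close>.\<close>

definition flip_weight :: "nat \<Rightarrow> nat \<times> nat \<Rightarrow> nat" where
  "flip_weight v p = (if fst p = v then 1 else 0) + (if snd p = v then 1 else 0)"

lemma flip_an: "sgn_aut (flip_weight v) (an n r s) = (-1) ^ flip_weight v (r, s) * an n r s"
  by (auto simp: an_def sgn_aut_uminus sgn_aut_gn flip_weight_def)

lemma flip_wd: "sgn_aut (flip_weight v) (wd n d f) = (-1) ^ card {a \<in> {..<2 * d}. f a = v} * wd n d f"
proof (induction d)
  case (Suc d)
  have "card {a \<in> {..<2 * Suc d}. f a = v} = (\<Sum>a<2 * Suc d. if f a = v then 1 else 0)"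
    unfolding card_eq_sum by (rule sum.mono_neutral_cong_left) auto
  also have "\<dots> = flip_weight v (f (2 * d), f (2 * d + 1)) + (\<Sum>a<2 * d. if f a = v then 1 else 0)"
    unfolding lessThan_double_Suc by (simp add: flip_weight_def)
  also have "(\<Sum>a<2 * d. if f a = v then 1 else 0) = card {a \<in> {..<2 * d}. f a = v}"
    unfolding card_eq_sum by (rule sum.mono_neutral_cong_right) auto
  finally have c: "card {a \<in> {..<2 * Suc d}. f a = v}
      = flip_weight v (f (2 * d), f (2 * d + 1)) + card {a \<in> {..<2 * d}. f a = v}" .
  show ?case
    unfolding c power_add wd.simps sgn_aut_mult flip_an Suc mult.assoc
      mult_m1_power[of "an n (f (2 * d)) (f (2 * d + 1))"] ..
qed simp

text \<open>Supplies the test elements: pairing \<open>y\<close> with such a product isolates a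
  single coefficient of \<open>y\<close>.\<close>

lemma wd_monomial:
  assumes "finite S" "S \<subseteq> pairs n"
  shows "\<exists>f c. f ` {..<2 * card S} \<subseteq> {..<n} \<and> c \<noteq> 0 \<and>
     (\<forall>T. cf (wd n (card S) f) T = (if T = S then c else 0))"
  using assms
proof (induction S rule: finite_induct)
  case empty
  show ?case by (rule exI[of _ "\<lambda>_. 0"], rule exI[of _ 1]) (simp add: cf_1)
next
  case (insert p S)
  then obtain f c where f: "f ` {..<2 * card S} \<subseteq> {..<n}" "c \<noteq> 0"
    "\<And>T. cf (wd n (card S) f) T = (if T = S then c else 0)" by blast
  let ?d = "card S"
  let ?f = "f(2 * ?d := fst p, 2 * ?d + 1 := snd p)"
  have p: "fst p < snd p" "snd p < n" using insert.prems by (auto simp: pairs_def)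
  have e: "wd n (card (insert p S)) ?f = gn p * wd n ?d f"
    using p insert.hyps by (simp add: an_def wd_upd)
  have "?f ` {..<2 * card (insert p S)} \<subseteq> {..<n}"
    using p f(1) insert.hyps by (auto simp: image_subset_iff less_Suc_eq)
  moreover have "cf (wd n (card (insert p S)) ?f) T
      = (if T = insert p S then (-1) ^ inv_count {p} S * c else 0)" for T
  proof -
    have "p \<in> T \<and> T - {p} = S \<longleftrightarrow> T = insert p S" using insert.hyps(2) by auto
    then show ?thesis unfolding e cf_gn_mult f(3) by auto
  qed
  ultimately have "?f ` {..<2 * card (insert p S)} \<subseteq> {..<n} \<and> (-1) ^ inv_count {p} S * c \<noteq> 0 \<and>
      (\<forall>T. cf (wd n (card (insert p S)) ?f) T = (if T = insert p S then (-1) ^ inv_count {p} S * c else 0))"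
    using f(2) by (intro conjI allI) auto
  then show ?case by blast
qed

lemma ip_ctrs: "ip n y (ctrs n ps F f) = ctrs n ps (\<lambda>f. ip n y (F f)) f"
proof (induction ps arbitrary: F)
  case (Cons p ps)
  have "(\<lambda>f. ip n y (ctr n a b F f)) = ctr n a b (\<lambda>f. ip n y (F f))" for a b
    by (simp add: ctr_def[abs_def] ip_sum_right)
  then show ?case using Cons by (cases p) simp
qed simp

theorem orth_invariant_eq_0:
  assumes supp: "supp n y"
    and rot: "\<And>i j. i < n \<Longrightarrow> j < n \<Longrightarrow> rot n i j y = rot n j i y"
    and flip: "\<And>v. v < n \<Longrightarrow> sgn_aut (flip_weight v) y = y"
    and orth: "\<And>J. J \<subseteq> {..<ngen n} \<Longrightarrow> ip n y (oprod (qq n) J) = 0"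
  shows "y = 0"
proof (rule ea_eqI)
  fix S :: "(nat \<times> nat) set" assume "finite S"
  show "cf y S = cf 0 S"
  proof (cases "S \<subseteq> pairs n")
    case False
    then show ?thesis using supp by (auto simp: supp_def)
  next
    case True
    define d where "d = card S"
    obtain f c where f: "f ` {..<2 * d} \<subseteq> {..<n}" "c \<noteq> 0"
       "\<And>T. cf (wd n d f) T = (if T = S then c else 0)"
      using wd_monomial[OF \<open>finite S\<close> True] unfolding d_def by blast
    let ?x = "\<lambda>f. ip n y (wd n d f)"
    \<comment> \<open>Rotations pass to the tensor by \<open>ip_rot\<close>, reflections because
      sign automorphisms preserve the form. A complete contraction is the pairing of
      \<open>y\<close> with a word without positions, a multiple of a product to which
      \<open>y\<close> is orthogonal.\<close>
    have "null_tensor n {..<2 * d} ?x"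
      unfolding null_tensor_def
    proof (intro conjI)
      show "on_pos {..<2 * d} ?x" using on_pos_wd[of d n] unfolding on_pos_def by metis
      show "lie_inv n {..<2 * d} ?x"
        unfolding lie_inv_def
      proof (intro allI impI)
        fix i j f assume ij: "i < n" "j < n" "i \<noteq> j" and f: "f ` {..<2 * d} \<subseteq> {..<n}"
        have s: "(\<Sum>a<2 * d. if f a = j then ?x (f(a := i)) else 0) = ip n y (rot n i j (wd n d f))"
          if "i < n" "j < n" for i j
          unfolding rot_wd[OF that f] ip_sum_right by (rule sum.cong) auto
        show "(\<Sum>a<2 * d. if f a = i then ?x (f(a := j)) else 0) = (\<Sum>a<2 * d. if f a = j then ?x (f(a := i)) else 0)"
          unfolding s[OF ij(1,2)] s[OF ij(2,1)] ip_rot[OF ij(1,2)] ip_rot[OF ij(2,1)] rot[OF ij(1,2)] ..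
      qed
      show "even_inv n {..<2 * d} ?x"
        unfolding even_inv_def
      proof (intro allI impI)
        fix v f assume v: "v < n" and nz: "?x f \<noteq> 0"
        have "?x f = ip n (sgn_aut (flip_weight v) y) (sgn_aut (flip_weight v) (wd n d f))"
          by (simp add: ip_sgn_aut)
        also have "\<dots> = ip n y ((-1) ^ card {a \<in> {..<2 * d}. f a = v} * wd n d f)"
          unfolding flip[OF v] flip_wd ..
        finally show "even (card {a \<in> {..<2 * d}. f a = v})"
          using nz by (cases "even (card {a \<in> {..<2 * d}. f a = v})") auto
      qed
      show "ctr_free n {..<2 * d} ?x"
        unfolding ctr_free_def
      proof (intro allI impI)
        fix ps f assume m: "matching {..<2 * d} ps"
        obtain c J where J: "J \<subseteq> {..<ngen n}" "ctrs n ps (wd n d) f = cst c * oprod (qq n) J"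
          using word_empty[OF word_ctrs[OF word_wd m] refl] by blast
        have "ctrs n ps ?x f = ip n y (ctrs n ps (wd n d) f)" by (simp add: ip_ctrs)
        then show "ctrs n ps ?x f = 0" using J orth by simp
      qed
    qed simp
    then have "?x f = 0" by (rule null_tensor_eq_0[OF _ f(1)])
    also have "?x f = (\<Sum>T\<in>Pow (pairs n). if T = S then cf y S * c else 0)"
      unfolding ip_def by (rule sum.cong) (auto simp: f(3))
    also have "\<dots> = cf y S * c" using True by (simp add: sum.delta)
    finally show ?thesis using f(2) by simp
  qed
qed

section \<open>The action of the orthogonal group\<close>

lemma cst_mult_cst_mult: "(cst a * x) * (cst b * y) = cst (a * b) * (x * y)"
proof -
  have "(cst a * x) * (cst b * y) = cst a * (x * cst b) * y" by (simp only: mult.assoc)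
  then show ?thesis unfolding cst_commute[of x b] cst_mult by (simp only: mult.assoc)
qed

lemma cf_oprod_gn:
  assumes "finite S"
  shows "cf (oprod gn S) T = (if T = S then 1 else 0)"
  using assms
proof (induction S arbitrary: T rule: finite_linorder_min_induct)
  case empty
  show ?case by (simp add: cf_1)
next
  case (insert b A)
  have bA: "b \<notin> A" using insert.hyps by blast
  have e: "oprod gn (insert b A) = gn b * oprod gn A"
    by (rule oprod_insert_min) (use insert.hyps in auto)
  have em: "{(t, u). t \<in> {b} \<and> u \<in> A \<and> u < t} = {}"
    using insert.hyps(2) by (auto dest: less_asym simp del: less_prod_simp)
  have i: "inv_count {b} A = 0" unfolding inv_count_def em by (rule card.empty)
  have "b \<in> T \<and> T - {b} = A \<longleftrightarrow> T = insert b A" using bA by auto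
  then show ?case unfolding e cf_gn_mult insert.IH using i by auto
qed

lemma sum_oprod_gn:
  assumes "supp n x"
  shows "(\<Sum>S\<in>Pow (pairs n). cst (cf x S) * oprod gn S) = x"
proof (rule ea_eqI)
  fix T :: "(nat \<times> nat) set"
  have "cf (\<Sum>S\<in>Pow (pairs n). cst (cf x S) * oprod gn S) T = (\<Sum>S\<in>Pow (pairs n). if S = T then cf x T else 0)"
    unfolding cf_sum by (intro sum.cong refl) (auto simp: cf_oprod_gn finite_subset)
  also have "\<dots> = cf x T" using assms by (auto simp: sum.delta supp_def)
  finally show "cf (\<Sum>S\<in>Pow (pairs n). cst (cf x S) * oprod gn S) T = cf x T" .
qed

definition gm :: "nat \<Rightarrow> (nat \<Rightarrow> nat \<Rightarrow> complex) \<Rightarrow> nat \<times> nat \<Rightarrow> ea" where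
  "gm n g p = (\<Sum>k<n. \<Sum>l<n. cst (g k (fst p) * g l (snd p)) * an n k l)"

definition ac :: "nat \<Rightarrow> (nat \<Rightarrow> nat \<Rightarrow> complex) \<Rightarrow> ea \<Rightarrow> ea" where
  "ac n g x = (\<Sum>S\<in>Pow (pairs n). cst (cf x S) * oprod (gm n g) S)"

lemma parity_cst_mult: "parity k x \<Longrightarrow> parity k (cst c * x)"
proof -
  assume x: "parity k x"
  have "gi (cst c) = cst c" by (rule ea_eqI) (simp add: cf_cst)
  then show ?thesis using x by (simp add: parity_def sgn_aut_mult mult_m1_power)
qed

lemma parity_gm: "parity 1 (gm n g p)"
  unfolding gm_def by (intro parity_sum parity_cst_mult parity_an)

lemma gm_anticomm: "gm n g p * gm n g q = - (gm n g q * gm n g p)"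
  using parity_commute[OF parity_gm[of n g p] parity_gm[of n g q]] by simp

lemma gm_swap: "gm n g (j, i) = - gm n g (i, j)"
proof -
  have "gm n g (j, i) = (\<Sum>l<n. \<Sum>k<n. cst (g k j * g l i) * an n k l)"
    unfolding gm_def fst_conv snd_conv by (rule sum.swap)
  also have "\<dots> = (\<Sum>l<n. \<Sum>k<n. - (cst (g l i * g k j) * an n l k))"
  proof (intro sum.cong refl)
    fix k l
    show "cst (g k j * g l i) * an n k l = - (cst (g l i * g k j) * an n l k)"
      using an_skew[of n l k] by (simp add: mult.commute[of "g k j"])
  qed
  finally show ?thesis by (simp add: gm_def sum_negf)
qed

lemma ac_add: "ac n g (x + y) = ac n g x + ac n g y"
  by (simp add: ac_def cst_add distrib_right sum.distrib)
lemma ac_0 [simp]: "ac n g 0 = 0" by (simp add: ac_def)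
lemma ac_cst_mult: "ac n g (cst c * x) = cst c * ac n g x"
  by (simp add: ac_def cst_mult sum_distrib_left mult.assoc)
lemma ac_sum: "ac n g (sum f I) = (\<Sum>i\<in>I. ac n g (f i))"
  by (induction I rule: infinite_finite_induct) (auto simp: ac_add)
lemma ac_uminus: "ac n g (- x) = - ac n g x"
  by (simp add: ac_def cst_minus sum_negf)

lemma ac_1 [simp]: "ac n g 1 = 1"
proof -
  have "ac n g 1 = (\<Sum>S\<in>Pow (pairs n). if S = {} then 1 else 0)"
    unfolding ac_def by (intro sum.cong refl) (simp add: cf_1)
  then show ?thesis by (simp add: sum.delta)
qed

lemma ac_gn:
  assumes "p \<in> pairs n"
  shows "ac n g (gn p) = gm n g p"
proof -
  have "ac n g (gn p) = (\<Sum>S\<in>Pow (pairs n). if S = {p} then gm n g p else 0)"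
    unfolding ac_def by (intro sum.cong refl) (simp add: cf_gn oprod_def)
  then show ?thesis using assms by (simp add: sum.delta)
qed

lemma ac_an:
  assumes "i < n" "j < n"
  shows "ac n g (an n i j) = gm n g (i, j)"
proof -
  consider "i < j" | "j < i" | "i = j" by linarith
  then show ?thesis
  proof cases
    case 1
    then show ?thesis using assms ac_gn[of "(i,j)" n g] by (simp add: an_def pairs_def)
  next
    case 2
    then show ?thesis using assms ac_gn[of "(j,i)" n g] gm_swap[of n g j i]
      by (simp add: an_def pairs_def ac_uminus)
  next
    case 3
    then show ?thesis using ea_eq_uminus_self[OF gm_swap[of n g i i]] by simp
  qed
qed

text \<open>Ordered products of the images \<open>gm\<close> multiply by the same rule as the
  monomials. Disjoint pairs \<open>(S, T)\<close> are regrouped by their union; the support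
  condition is there because \<open>ac\<close> discards monomials outside
  \<open>pairs n\<close>.\<close>

lemma ac_mult:
  assumes "supp n x" "supp n y"
  shows "ac n g (x * y) = ac n g x * ac n g y"
proof -
  let ?P = "Pow (pairs n)" and ?G = "oprod (gm n g)"
  have fin: "finite S" if "S \<in> ?P" for S using that by (intro finite_subset[OF _ finite_pairs]) simp
  let ?t = "\<lambda>S T. cst ((-1) ^ inv_count S T * cf x S * cf y T) * ?G (S \<union> T)"
  have sg: "(-1 :: ea) ^ k = cst ((-1) ^ k)" for k by (cases "even k") (auto simp: cst_minus)
  have "ac n g x * ac n g y = (\<Sum>S\<in>?P. \<Sum>T\<in>?P. (cst (cf x S) * ?G S) * (cst (cf y T) * ?G T))"
    by (simp add: ac_def sum_product)
  also have "\<dots> = (\<Sum>S\<in>?P. \<Sum>T\<in>?P. if S \<inter> T = {} then ?t S T else 0)"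
  proof (intro sum.cong refl)
    fix S T assume "S \<in> ?P" "T \<in> ?P"
    then have f: "finite S" "finite T" using fin by auto
    have "(cst (cf x S) * ?G S) * (cst (cf y T) * ?G T) = cst (cf x S * cf y T) * (?G S * ?G T)"
      by (rule cst_mult_cst_mult)
    also have "?G S * ?G T = (if S \<inter> T = {} then (-1) ^ invs S T * ?G (S \<union> T) else 0)"
      by (rule oprod_mult[where G = "gm n g", OF gm_anticomm f])
    also have "cst (cf x S * cf y T) * (if S \<inter> T = {} then (-1) ^ invs S T * ?G (S \<union> T) else 0)
        = (if S \<inter> T = {} then cst (cf x S * cf y T * (-1) ^ invs S T) * ?G (S \<union> T) else 0)"
      by (simp only: sg cst_mult mult.assoc mult_zero_right split: if_split) simp
    also have "cf x S * cf y T * (-1) ^ invs S T = (-1) ^ inv_count S T * cf x S * cf y T"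
      by (simp add: inv_count_invs)
    finally show "(cst (cf x S) * ?G S) * (cst (cf y T) * ?G T) = (if S \<inter> T = {} then ?t S T else 0)" .
  qed
  also have "\<dots> = (\<Sum>(S,T)\<in>{(S,T). S \<in> ?P \<and> T \<in> ?P \<and> S \<inter> T = {}}. ?t S T)"
    unfolding sum.cartesian_product
    by (rule sum.mono_neutral_cong_right) (auto split: if_splits)
  also have "\<dots> = (\<Sum>(U,S)\<in>(SIGMA U:?P. Pow U). ?t S (U - S))"
    by (rule sum.reindex_bij_witness[of _ "\<lambda>(U,S). (S, U - S)" "\<lambda>(S,T). (S \<union> T, S)"])
       (auto simp: Un_Diff Diff_triv inf_commute Un_absorb1)
  also have "\<dots> = (\<Sum>U\<in>?P. \<Sum>S\<in>Pow U. ?t S (U - S))"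
    by (rule sum.Sigma[symmetric]) (use fin in auto)
  also have "\<dots> = ac n g (x * y)"
    unfolding ac_def cf_mult cst_sum sum_distrib_right
    by (intro sum.cong refl) (simp add: Un_absorb1)
  finally show ?thesis by simp
qed

text \<open>\<open>orth\<close> speaks of columns. A left inverse of a square matrix is also a right
  inverse, which gives the rows.\<close>

lemma orth_rows:
  assumes "orth n g" "i < n" "j < n"
  shows "(\<Sum>k<n. g i k * g j k) = (if i = j then 1 else 0)"
proof -
  let ?A = "mat n n (\<lambda>(i,j). g i j)"
  let ?B = "mat n n (\<lambda>(i,j). g j i)"
  have "?B * ?A = 1\<^sub>m n"
    by (rule eq_matI) (use assms(1) in \<open>auto simp: orth_def scalar_prod_def atLeast0LessThan\<close>)
  then have "?A * ?B = 1\<^sub>m n" by (intro mat_mult_left_right_inverse[of ?B n ?A]) auto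
  then have "(?A * ?B) $$ (i, j) = 1\<^sub>m n $$ (i, j)" by simp
  then show ?thesis using assms by (simp add: scalar_prod_def atLeast0LessThan)
qed

lemma cst_delta_sum:
  assumes "i < (n::nat)"
  shows "(\<Sum>q<n. cst (if i = q then 1 else 0) * F q) = F i"
proof -
  have "(\<Sum>q<n. cst (if i = q then 1 else 0) * F q) = (\<Sum>q<n. if q = i then F i else 0)"
    by (intro sum.cong refl) auto
  then show ?thesis using assms by (simp add: sum.delta)
qed

text \<open>The action replaces \<open>A\<close> by \<open>g^T A g\<close>; between consecutive
  factors \<open>g g^T = 1\<close> cancels, so \<open>A^k\<close> becomes
  \<open>g^T A^k g\<close>.\<close>

lemma ac_pw:
  assumes g: "orth n g" and "i < n" "j < n"
  shows "ac n g (pw n k i j) = (\<Sum>p<n. \<Sum>q<n. cst (g p i * g q j) * pw n k p q)"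
  using assms(3)
proof (induction k arbitrary: j)
  case 0
  have "(\<Sum>p<n. \<Sum>q<n. cst (g p i * g q j) * pw n 0 p q) = (\<Sum>p<n. cst (g p i * g p j))"
    by (intro sum.cong refl) (simp only: pw.simps cst_commute[symmetric] sum_mid_left lessThan_iff)
  also have "\<dots> = cst (\<Sum>p<n. g p i * g p j)" by (simp only: cst_sum)
  also have "\<dots> = mid n i j" using g assms(2) 0 by (auto simp: orth_def mid_def)
  finally show ?case by (auto simp: mid_def)
next
  case (Suc k)
  let ?a = "\<lambda>p q r s. pw n k p q * an n r s"
  have "ac n g (pw n (Suc k) i j) = (\<Sum>l<n. ac n g (pw n k i l) * ac n g (an n l j))"
    by (simp add: ac_sum ac_mult supp_pw supp_an)
  also have "\<dots> = (\<Sum>l<n. (\<Sum>p<n. \<Sum>q<n. cst (g p i * g q l) * pw n k p q)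
      * (\<Sum>r<n. \<Sum>s<n. cst (g r l * g s j) * an n r s))"
    using Suc.IH ac_an[OF _ Suc.prems] by (intro sum.cong refl) (simp add: gm_def)
  also have "\<dots> = (\<Sum>l<n. \<Sum>p<n. \<Sum>q<n. \<Sum>r<n. \<Sum>s<n. cst (g q l * g r l) * (cst (g p i * g s j) * ?a p q r s))"
  proof (intro sum.cong refl)
    fix l
    have "(cst (g p i * g q l) * pw n k p q) * (cst (g r l * g s j) * an n r s)
        = cst (g q l * g r l) * (cst (g p i * g s j) * ?a p q r s)" for p q r s
    proof -
      have "(cst (g p i * g q l) * pw n k p q) * (cst (g r l * g s j) * an n r s)
         = cst ((g p i * g q l) * (g r l * g s j)) * ?a p q r s" by (rule cst_mult_cst_mult)
      also have "(g p i * g q l) * (g r l * g s j) = (g q l * g r l) * (g p i * g s j)" by (simp only: mult_ac)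
      finally show ?thesis by (simp only: cst_mult mult.assoc)
    qed
    then show "(\<Sum>p<n. \<Sum>q<n. cst (g p i * g q l) * pw n k p q) * (\<Sum>r<n. \<Sum>s<n. cst (g r l * g s j) * an n r s)
      = (\<Sum>p<n. \<Sum>q<n. \<Sum>r<n. \<Sum>s<n. cst (g q l * g r l) * (cst (g p i * g s j) * ?a p q r s))"
      by (simp only: sum_distrib_right) (simp only: sum_distrib_left)
  qed
  also have "\<dots> = (\<Sum>p<n. \<Sum>q<n. \<Sum>r<n. \<Sum>l<n. \<Sum>s<n. cst (g q l * g r l) * (cst (g p i * g s j) * ?a p q r s))"
    by (subst sum.swap, rule sum.cong[OF refl], subst sum.swap, rule sum.cong[OF refl], rule sum.swap)
  also have "\<dots> = (\<Sum>p<n. \<Sum>q<n. \<Sum>r<n. cst (if q = r then 1 else 0) * (\<Sum>s<n. cst (g p i * g s j) * ?a p q r s))"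
  proof (intro sum.cong refl)
    fix p q r assume "q \<in> {..<n}" "r \<in> {..<n}"
    then have "(\<Sum>l<n. g q l * g r l) = (if q = r then 1 else 0)" using orth_rows[OF g] by simp
    then show "(\<Sum>l<n. \<Sum>s<n. cst (g q l * g r l) * (cst (g p i * g s j) * ?a p q r s))
       = cst (if q = r then 1 else 0) * (\<Sum>s<n. cst (g p i * g s j) * ?a p q r s)"
      by (simp only: sum_distrib_left[symmetric] sum_distrib_right[symmetric] cst_sum[symmetric])
  qed
  also have "\<dots> = (\<Sum>p<n. \<Sum>q<n. \<Sum>s<n. cst (g p i * g s j) * ?a p q q s)"
    by (rule sum.cong[OF refl], rule sum.cong[OF refl]) (simp only: cst_delta_sum lessThan_iff)
  also have "\<dots> = (\<Sum>p<n. \<Sum>s<n. \<Sum>q<n. cst (g p i * g s j) * ?a p q q s)"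
    by (rule sum.cong[OF refl]) (rule sum.swap)
  also have "\<dots> = (\<Sum>p<n. \<Sum>s<n. cst (g p i * g s j) * pw n (Suc k) p s)"
    by (simp add: sum_distrib_left)
  finally show ?case .
qed

lemma ac_tr:
  assumes "orth n g"
  shows "ac n g (tr n k) = tr n k"
proof -
  have "ac n g (tr n k) = (\<Sum>i<n. \<Sum>p<n. \<Sum>q<n. cst (g p i * g q i) * pw n k p q)"
    unfolding tr_def ac_sum by (intro sum.cong refl) (simp add: ac_pw[OF assms])
  also have "\<dots> = (\<Sum>p<n. \<Sum>q<n. \<Sum>i<n. cst (g p i * g q i) * pw n k p q)"
    by (subst sum.swap, rule sum.cong[OF refl], rule sum.swap)
  also have "\<dots> = (\<Sum>p<n. \<Sum>q<n. cst (if p = q then 1 else 0) * pw n k p q)"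
  proof (intro sum.cong refl)
    fix p q assume "p \<in> {..<n}" "q \<in> {..<n}"
    then have "(\<Sum>i<n. g p i * g q i) = (if p = q then 1 else 0)" using orth_rows[OF assms] by simp
    then show "(\<Sum>i<n. cst (g p i * g q i) * pw n k p q) = cst (if p = q then 1 else 0) * pw n k p q"
      by (simp only: sum_distrib_right[symmetric] cst_sum[symmetric])
  qed
  also have "\<dots> = tr n k"
    unfolding tr_def by (intro sum.cong refl) (simp only: cst_delta_sum lessThan_iff)
  finally show ?thesis .
qed

lemma supp_qq: "supp n (qq n k)" unfolding qq_def by (rule supp_tr)

lemma supp_prod_list: "(\<And>x. x \<in> set xs \<Longrightarrow> supp n x) \<Longrightarrow> supp n (prod_list xs)"
  by (induction xs) (auto simp: supp_1 supp_mult)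

lemma real_ea_prod_list: "(\<And>x. x \<in> set xs \<Longrightarrow> real_ea x) \<Longrightarrow> real_ea (prod_list xs)"
  by (induction xs) (auto simp: real_ea_1 real_ea_mult)

lemma supp_oprod_qq: "supp n (oprod (qq n) J)"
  unfolding oprod_def by (rule supp_prod_list) (auto simp: supp_qq)

lemma real_ea_oprod_qq: "real_ea (oprod (qq n) J)"
  unfolding oprod_def by (rule real_ea_prod_list) (auto simp: qq_def real_ea_tr)

lemma ac_oprod_qq:
  assumes "orth n g"
  shows "ac n g (oprod (qq n) J) = oprod (qq n) J"
proof -
  have "ac n g (prod_list (map (qq n) xs)) = prod_list (map (qq n) xs)" for xs
  proof (induction xs)
    case (Cons k xs)
    have "supp n (prod_list (map (qq n) xs))" by (rule supp_prod_list) (auto simp: supp_qq)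
    moreover have "ac n g (qq n k) = qq n k" unfolding qq_def by (rule ac_tr[OF assms])
    ultimately show ?case using Cons by (simp add: ac_mult supp_qq)
  qed simp
  then show ?thesis by (simp add: oprod_def)
qed

section \<open>Infinitesimal invariance\<close>

definition deriv0 :: "(complex \<Rightarrow> ea) \<Rightarrow> ea \<Rightarrow> bool" where
  "deriv0 F F' \<longleftrightarrow> (\<forall>S. ((\<lambda>\<theta>. cf (F \<theta>) S) has_field_derivative cf F' S) (at 0))"

lemma deriv0_const: "deriv0 (\<lambda>\<theta>. x) 0"
  by (simp add: deriv0_def)

lemma deriv0_unique: "deriv0 F x \<Longrightarrow> deriv0 F y \<Longrightarrow> x = y"
  unfolding deriv0_def by (intro ea_eqI) (metis DERIV_unique)

lemma deriv0_sum: "(\<And>i. i \<in> I \<Longrightarrow> deriv0 (F i) (F' i)) \<Longrightarrow> deriv0 (\<lambda>\<theta>. \<Sum>i\<in>I. F i \<theta>) (\<Sum>i\<in>I. F' i)"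
  unfolding deriv0_def by (auto intro!: DERIV_sum)

lemma deriv0_cst_mult: "deriv0 F F' \<Longrightarrow> deriv0 (\<lambda>\<theta>. cst c * F \<theta>) (cst c * F')"
  unfolding deriv0_def by (auto intro!: DERIV_cmult)

lemma deriv0_mult_const: "(f has_field_derivative f') (at 0) \<Longrightarrow> deriv0 (\<lambda>\<theta>. cst (f \<theta>) * x) (cst f' * x)"
  unfolding deriv0_def by (auto intro!: DERIV_cmult_right)

lemma deriv0_mult:
  assumes "deriv0 F F'" "deriv0 G G'"
  shows "deriv0 (\<lambda>\<theta>. F \<theta> * G \<theta>) (F' * G 0 + F 0 * G')"
  unfolding deriv0_def
proof
  fix S
  let ?s = "\<lambda>T. (-1 :: complex) ^ inv_count T (S - T)"
  have "((\<lambda>\<theta>. \<Sum>T\<in>Pow S. ?s T * (cf (F \<theta>) T * cf (G \<theta>) (S - T))) has_field_derivative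
      (\<Sum>T\<in>Pow S. ?s T * (cf F' T * cf (G 0) (S - T) + cf G' (S - T) * cf (F 0) T))) (at 0)"
    using assms unfolding deriv0_def by (intro DERIV_sum DERIV_cmult DERIV_mult) blast+
  moreover have "(\<Sum>T\<in>Pow S. ?s T * (cf F' T * cf (G 0) (S - T) + cf G' (S - T) * cf (F 0) T))
      = cf (F' * G 0 + F 0 * G') S"
    unfolding cf_add cf_mult sum.distrib[symmetric]
    by (rule sum.cong) (simp_all add: algebra_simps)
  ultimately show "((\<lambda>\<theta>. cf (F \<theta> * G \<theta>) S) has_field_derivative cf (F' * G 0 + F 0 * G') S) (at 0)"
    by (simp add: cf_mult mult.assoc)
qed

text \<open>The curve of products and \<open>R\<close> both obey the Leibniz rule, so agreement on
  generators propagates. The value at 0 is part of the conclusion because the product rule for the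
  next factor refers to it.\<close>

lemma deriv0_oprod:
  assumes "finite S"
    and d: "\<And>p. p \<in> S \<Longrightarrow> deriv0 (\<lambda>\<theta>. G \<theta> p) (R (gn p))"
    and G0: "\<And>p. p \<in> S \<Longrightarrow> G 0 p = gn p"
    and R: "\<And>x y. R (x * y) = R x * y + x * R y" "R 1 = 0"
  shows "deriv0 (\<lambda>\<theta>. oprod (G \<theta>) S) (R (oprod gn S)) \<and> oprod (G 0) S = oprod gn S"
  using assms(1-3)
proof (induction S rule: finite_linorder_min_induct)
  case empty
  show ?case by (simp add: R deriv0_const)
next
  case (insert b A)
  have e: "oprod H (insert b A) = H b * oprod H A" for H
    by (rule oprod_insert_min) (use insert.hyps in auto)
  have IH: "deriv0 (\<lambda>\<theta>. oprod (G \<theta>) A) (R (oprod gn A))" "oprod (G 0) A = oprod gn A"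
    using insert.IH insert.prems by auto
  have b: "deriv0 (\<lambda>\<theta>. G \<theta> b) (R (gn b))" "G 0 b = gn b" using insert.prems by auto
  show ?case unfolding e R(1) using deriv0_mult[OF b(1) IH(1)] IH(2) b(2) by simp
qed

text \<open>The rotation in the plane of \<open>e_i\<close> and \<open>e_j\<close>. Its angle is
  complex, to match complex derivatives of coefficients; \<open>orth_rmat\<close> rests only on the
  sine-cosine identity, which still holds.\<close>

definition rmat :: "nat \<Rightarrow> nat \<Rightarrow> complex \<Rightarrow> nat \<Rightarrow> nat \<Rightarrow> complex" where
  "rmat i j \<theta> k m = (if m = i then (if k = i then cos \<theta> else if k = j then sin \<theta> else 0)
     else if m = j then (if k = i then - sin \<theta> else if k = j then cos \<theta> else 0)
     else if k = m then 1 else 0)"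

definition rmat' :: "nat \<Rightarrow> nat \<Rightarrow> nat \<Rightarrow> nat \<Rightarrow> complex" where
  "rmat' i j k m = (if m = i \<and> k = j then 1 else if m = j \<and> k = i then -1 else 0)"

lemma rmat_0: "i \<noteq> j \<Longrightarrow> rmat i j 0 k m = (if m = k then 1 else 0)"
  by (auto simp: rmat_def)

lemma rmat_deriv: "i \<noteq> j \<Longrightarrow> ((\<lambda>\<theta>. rmat i j \<theta> k m) has_field_derivative rmat' i j k m) (at 0)"
  unfolding rmat_def rmat'_def
  by (cases "m = i"; cases "m = j"; cases "k = i"; cases "k = j"; cases "k = m")
     (auto intro!: derivative_eq_intros)

lemma orth_rmat:
  assumes "i < n" "j < n" "i \<noteq> j"
  shows "orth n (rmat i j \<theta>)"
  unfolding orth_def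
proof (intro allI impI)
  fix a b assume ab: "a < n" "b < n"
  have two: "(\<Sum>k<n. F k) = F i + F j + (\<Sum>k\<in>{..<n} - {i,j}. F k)" for F :: "nat \<Rightarrow> complex"
  proof -
    have "{..<n} = insert i (insert j ({..<n} - {i,j}))" using assms by auto
    then have "(\<Sum>k<n. F k) = sum F (insert i (insert j ({..<n} - {i,j})))" by simp
    then show ?thesis using assms by (simp add: add.assoc)
  qed
  have sc: "sin \<theta> * sin \<theta> + cos \<theta> * cos \<theta> = 1" "cos \<theta> * cos \<theta> + sin \<theta> * sin \<theta> = 1"
    using sin_cos_squared_add[of \<theta>] by (simp_all add: power2_eq_square add.commute)
  have d: "(\<Sum>k\<in>{..<n} - {i,j}. rmat i j \<theta> k a * rmat i j \<theta> k b)
      = (if a = b \<and> a \<noteq> i \<and> a \<noteq> j then 1 else 0)"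
  proof -
    have "(\<Sum>k\<in>{..<n} - {i,j}. rmat i j \<theta> k a * rmat i j \<theta> k b)
        = (\<Sum>k\<in>{..<n} - {i,j}. if k = a then (if a = b then 1 else 0) else 0)"
      by (rule sum.cong) (auto simp: rmat_def)
    then show ?thesis using ab by (auto simp: sum.delta)
  qed
  show "(\<Sum>k<n. rmat i j \<theta> k a * rmat i j \<theta> k b) = (if a = b then 1 else 0)"
    unfolding two[of "\<lambda>k. rmat i j \<theta> k a * rmat i j \<theta> k b"] d
    using assms(3) sc by (cases "a = i"; cases "a = j"; cases "b = i"; cases "b = j") (auto simp: rmat_def)
qed

lemma an_fst_snd: "p \<in> pairs n \<Longrightarrow> an n (fst p) (snd p) = gn p"
  by (auto simp: pairs_def an_def)

lemma sum_delta_n: "a < (n::nat) \<Longrightarrow> (\<Sum>k<n. cst (if a = k then c else 0) * F k) = cst c * F a"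
proof -
  assume "a < n"
  have "(\<Sum>k<n. cst (if a = k then c else 0) * F k) = (\<Sum>k<n. if k = a then cst c * F a else 0)"
    by (rule sum.cong) auto
  then show ?thesis using \<open>a < n\<close> by (simp add: sum.delta)
qed

lemma gm_id:
  assumes "p \<in> pairs n" "\<And>k m. g k m = (if m = k then 1 else 0)"
  shows "gm n g p = gn p"
proof -
  have p: "fst p < n" "snd p < n" using assms(1) by (auto simp: pairs_def)
  have "gm n g p = (\<Sum>k<n. cst (if fst p = k then 1 else 0) * (\<Sum>l<n. cst (if snd p = l then 1 else 0) * an n k l))"
    unfolding gm_def assms(2) by (simp only: cst_mult mult.assoc sum_distrib_left)
  also have "\<dots> = gn p" using p an_fst_snd[OF assms(1)] by (simp only: sum_delta_n) simp
  finally show ?thesis .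
qed

text \<open>To first order \<open>e_i\<close> moves towards \<open>e_j\<close> and
  \<open>e_j\<close> towards \<open>-e_i\<close>, hence the difference of two replacement
  derivations.\<close>

lemma deriv0_gm:
  assumes p: "p \<in> pairs n" and ij: "i < n" "j < n" "i \<noteq> j"
  shows "deriv0 (\<lambda>\<theta>. gm n (rmat i j \<theta>) p) (rot n j i (gn p) - rot n i j (gn p))"
proof -
  obtain a b where ab[simp]: "p = (a, b)" by (cases p)
  have n: "a < n" "b < n" using p by (auto simp: pairs_def)
  let ?I = "\<lambda>k m. if m = k then 1 else 0 :: complex"
  have 1: "deriv0 (\<lambda>\<theta>. gm n (rmat i j \<theta>) p)
     (\<Sum>k<n. \<Sum>l<n. cst (rmat' i j k a * rmat i j 0 l b + rmat' i j l b * rmat i j 0 k a) * an n k l)"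
    unfolding gm_def ab fst_conv snd_conv
    by (intro deriv0_sum deriv0_mult_const DERIV_mult rmat_deriv ij)
  have row: "(\<Sum>k<n. cst (rmat' i j k m) * F k) = (if m = i then F j else 0) - (if m = j then F i else 0)" for m F
  proof -
    have "cst (rmat' i j k m) * F k
      = (if k = j then (if m = i then F j else 0) else 0) - (if k = i then (if m = j then F i else 0) else 0)" for k
      using ij by (auto simp: rmat'_def cst_minus)
    then show ?thesis using ij by (simp add: sum_subtractf sum.delta)
  qed
  have "(\<Sum>k<n. \<Sum>l<n. cst (rmat' i j k a * rmat i j 0 l b + rmat' i j l b * rmat i j 0 k a) * an n k l)
     = (\<Sum>k<n. cst (rmat' i j k a) * (\<Sum>l<n. cst (?I l b) * an n k l))
      + (\<Sum>k<n. cst (?I k a) * (\<Sum>l<n. cst (rmat' i j l b) * an n k l))"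
    unfolding sum_distrib_left sum.distrib[symmetric] rmat_0[OF ij(3)]
    by (intro sum.cong refl ea_eqI) (simp add: algebra_simps)
  also have "\<dots> = (\<Sum>k<n. cst (rmat' i j k a) * an n k b) + (\<Sum>l<n. cst (rmat' i j l b) * an n a l)"
    using n by (simp only: sum_delta_n cst_1 mult_1_left)
  also have "\<dots> = ((if a = i then an n j b else 0) - (if a = j then an n i b else 0))
      + ((if b = i then an n a j else 0) - (if b = j then an n a i else 0))"
    by (simp only: row)
  also have "\<dots> = rot n j i (an n a b) - rot n i j (an n a b)"
    using rot_an[OF ij(1) n, of j] rot_an[OF ij(2) n, of i] by simp
  also have "an n a b = gn p" using an_fst_snd[OF p] by simp
  finally show ?thesis using 1 by simp
qed

lemma rot_cst_mult: "rot n i j (cst c * x) = cst c * rot n i j x"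
proof -
  have "iop p (cst c * x) = cst c * iop p x" for p by (rule ea_eqI) (simp add: cf_iop)
  then have "io j k (cst c * x) = cst c * io j k x" for k by (simp add: io_def)
  moreover have "an n i k * (cst c * y) = cst c * (an n i k * y)" for k y
    using cst_mult_cst_mult[of 1 "an n i k" c y] by simp
  ultimately show ?thesis by (simp add: rot_def sum_distrib_left)
qed

text \<open>Rotating an invariant gives a constant curve, whose derivative at 0 is the difference of
  the two sides.\<close>

lemma invariant_rot:
  assumes x: "supp n x" and ac: "\<And>g. orth n g \<Longrightarrow> ac n g x = x" and ij: "i < n" "j < n"
  shows "rot n i j x = rot n j i x"
proof (cases "i = j")
  case False
  let ?R = "\<lambda>x. rot n j i x - rot n i j x"
  have R: "?R (x * y) = ?R x * y + x * ?R y" "?R 1 = 0" for x y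
    by (simp_all add: rot_mult algebra_simps)
  have "deriv0 (\<lambda>\<theta>. ac n (rmat i j \<theta>) x) (\<Sum>S\<in>Pow (pairs n). cst (cf x S) * ?R (oprod gn S))"
    unfolding ac_def
  proof (intro deriv0_sum deriv0_cst_mult)
    fix S assume "S \<in> Pow (pairs n)"
    then have S: "S \<subseteq> pairs n" "finite S" by (auto intro: finite_subset[OF _ finite_pairs])
    have "deriv0 (\<lambda>\<theta>. oprod (gm n (rmat i j \<theta>)) S) (?R (oprod gn S)) \<and> oprod (gm n (rmat i j 0)) S = oprod gn S"
    proof (rule deriv0_oprod[OF S(2) _ _ R])
      show "deriv0 (\<lambda>\<theta>. gm n (rmat i j \<theta>) p) (?R (gn p))" if "p \<in> S" for p
        using deriv0_gm[OF _ ij False] that S(1) by blast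
      show "gm n (rmat i j 0) p = gn p" if "p \<in> S" for p
        using gm_id[of p n "rmat i j 0"] rmat_0[OF False] that S(1) by blast
    qed
    then show "deriv0 (\<lambda>\<theta>. oprod (gm n (rmat i j \<theta>)) S) (?R (oprod gn S))" by blast
  qed
  also have "(\<Sum>S\<in>Pow (pairs n). cst (cf x S) * ?R (oprod gn S)) = ?R (\<Sum>S\<in>Pow (pairs n). cst (cf x S) * oprod gn S)"
    by (simp add: rot_sum rot_cst_mult right_diff_distrib sum_subtractf)
  also have "\<dots> = ?R x" unfolding sum_oprod_gn[OF x] ..
  finally have "deriv0 (\<lambda>\<theta>. ac n (rmat i j \<theta>) x) (?R x)" .
  then have "deriv0 (\<lambda>\<theta>. x) (?R x)" using ac[OF orth_rmat[OF ij False]] by simp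
  then have "?R x = 0" using deriv0_unique deriv0_const by blast
  then show ?thesis by simp
qed simp

lemma invariant_flip:
  assumes x: "supp n x" and ac: "\<And>g. orth n g \<Longrightarrow> ac n g x = x" and v: "v < n"
  shows "sgn_aut (flip_weight v) x = x"
proof -
  \<comment> \<open>The reflection that negates \<open>e_v\<close> and fixes the other basis
    vectors.\<close>
  define g where "g = (\<lambda>k m :: nat. if m = k then (if m = v then -1 else 1) else (0 :: complex))"
  have "orth n g"
    unfolding orth_def
  proof (intro allI impI)
    fix i j assume ij: "i < n" "j < n"
    have "(\<Sum>k<n. g k i * g k j) = (\<Sum>k<n. if k = i then (if i = j then 1 else 0) else 0)"
      by (rule sum.cong) (auto simp: g_def)
    then show "(\<Sum>k<n. g k i * g k j) = (if i = j then 1 else 0)" using ij by (simp add: sum.delta)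
  qed
  have gm: "gm n g p = sgn_aut (flip_weight v) (gn p)" if p: "p \<in> pairs n" for p
  proof -
    obtain a b where ab: "p = (a, b)" "a < n" "b < n" using p by (auto simp: pairs_def)
    let ?s = "\<lambda>m. if m = v then -1 else 1 :: complex"
    have "gm n g p = (\<Sum>k<n. cst (if a = k then ?s a else 0) * (\<Sum>l<n. cst (if b = l then ?s b else 0) * an n k l))"
      unfolding gm_def sum_distrib_left
      by (intro sum.cong refl ea_eqI) (auto simp: g_def ab)
    also have "\<dots> = cst (?s a) * (cst (?s b) * an n a b)"
      using ab by (simp only: sum_delta_n)
    also have "an n a b = gn p" using an_fst_snd[OF p] ab by simp
    also have "cst (?s a) * (cst (?s b) * gn p) = sgn_aut (flip_weight v) (gn p)"
      unfolding sgn_aut_gn using p by (auto simp: ab flip_weight_def cst_minus pairs_def)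
    finally show ?thesis .
  qed
  have opr: "oprod (gm n g) S = sgn_aut (flip_weight v) (oprod gn S)" if "finite S" "S \<subseteq> pairs n" for S
    using that
  proof (induction S rule: finite_linorder_min_induct)
    case (insert b A)
    have e: "oprod H (insert b A) = H b * oprod H A" for H
      by (rule oprod_insert_min) (use insert.hyps in auto)
    show ?case unfolding e sgn_aut_mult using insert gm by simp
  qed simp
  have "ac n g x = (\<Sum>S\<in>Pow (pairs n). cst (cf x S) * sgn_aut (flip_weight v) (oprod gn S))"
    unfolding ac_def by (intro sum.cong refl) (simp add: opr finite_subset[OF _ finite_pairs])
  also have "\<dots> = sgn_aut (flip_weight v) (\<Sum>S\<in>Pow (pairs n). cst (cf x S) * oprod gn S)"
  proof -
    have "sgn_aut w (cst c) = cst c" for w c by (rule ea_eqI) (simp add: cf_cst)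
    then show ?thesis by (simp add: sgn_aut_sum sgn_aut_mult)
  qed
  also have "\<dots> = sgn_aut (flip_weight v) x" unfolding sum_oprod_gn[OF x] ..
  finally show ?thesis using ac[OF \<open>orth n g\<close>] by simp
qed

section \<open>Spanning\<close>

lemma real_ea_cst_mult: "c \<in> \<real> \<Longrightarrow> real_ea x \<Longrightarrow> real_ea (cst c * x)"
  by (auto simp: real_ea_def)

lemma real_ea_minus: "real_ea x \<Longrightarrow> real_ea y \<Longrightarrow> real_ea (x - y)"
  by (auto simp: real_ea_def)

lemma supp_cst_mult: "supp n x \<Longrightarrow> supp n (cst c * x)"
  by (auto simp: supp_def)

lemma supp_minus: "supp n x \<Longrightarrow> supp n y \<Longrightarrow> supp n (x - y)"
  unfolding supp_def cf_minus by (metis diff_self)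

lemma real_ip: "real_ea x \<Longrightarrow> real_ea y \<Longrightarrow> ip n x y \<in> \<real>"
  unfolding ip_def real_ea_def by (intro sum_in_Reals Reals_mult) auto

text \<open>Realness of the vectors makes the bilinear form definite on their span.\<close>

lemma orth_projection:
  fixes v :: "'i \<Rightarrow> ea"
  assumes "finite I" "\<And>i. i \<in> I \<Longrightarrow> real_ea (v i)" "\<And>i. i \<in> I \<Longrightarrow> supp n (v i)"
  shows "\<exists>c. (\<forall>j\<in>I. ip n (x - (\<Sum>i\<in>I. cst (c i) * v i)) (v j) = 0) \<and> (real_ea x \<longrightarrow> (\<forall>i\<in>I. c i \<in> \<real>))"
  using assms
proof (induction I arbitrary: x rule: finite_induct)
  case (insert a I)
  have va: "real_ea (v a)" "supp n (v a)" using insert.prems by auto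
  have ex: "\<exists>c. (\<forall>j\<in>I. ip n (z - (\<Sum>i\<in>I. cst (c i) * v i)) (v j) = 0) \<and> (real_ea z \<longrightarrow> (\<forall>i\<in>I. c i \<in> \<real>))" for z
    by (rule insert.IH) (use insert.prems in auto)
  \<comment> \<open>Projecting the real vector \<open>v a\<close> uses real coefficients, so the
    residue \<open>w\<close> below is real: it is zero or not isotropic.\<close>
  obtain c0 where c0: "\<And>j. j \<in> I \<Longrightarrow> ip n (v a - (\<Sum>i\<in>I. cst (c0 i) * v i)) (v j) = 0"
    "\<And>i. i \<in> I \<Longrightarrow> c0 i \<in> \<real>"
    using ex[of "v a"] va(1) by blast
  define w where "w = v a - (\<Sum>i\<in>I. cst (c0 i) * v i)"
  have w: "real_ea w" "supp n w"
    unfolding w_def using va c0(2) insert.prems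
    by (auto intro!: real_ea_minus real_ea_sum real_ea_cst_mult supp_minus supp_sum supp_cst_mult)
  have wj: "ip n w (v j) = 0" if "j \<in> I" for j using c0(1)[OF that] by (simp add: w_def)
  have vaw: "v a = w + (\<Sum>i\<in>I. cst (c0 i) * v i)" by (simp add: w_def)
  have wa: "ip n w (v a) = ip n w w"
    by (subst vaw) (simp add: ip_add_right ip_sum_right wj)
  obtain c1 where c1: "\<And>j. j \<in> I \<Longrightarrow> ip n (x - (\<Sum>i\<in>I. cst (c1 i) * v i)) (v j) = 0"
    "real_ea x \<Longrightarrow> \<forall>i\<in>I. c1 i \<in> \<real>"
    using ex[of x] by blast
  define y where "y = x - (\<Sum>i\<in>I. cst (c1 i) * v i)"
  have yj: "ip n y (v j) = 0" if "j \<in> I" for j using c1(1)[OF that] by (simp add: y_def)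
  \<comment> \<open>If \<open>ip n w w = 0\<close>, then \<open>w = 0\<close> and division by zero
    sets \<open>t\<close> to 0, so nothing is corrected.\<close>
  define t where "t = ip n y (v a) / ip n w w"
  define c where "c = (\<lambda>i. if i = a then t else c1 i - t * c0 i)"
  have "(\<Sum>i\<in>I. cst (c i) * v i) = (\<Sum>i\<in>I. cst (c1 i) * v i - cst t * (cst (c0 i) * v i))"
    using insert.hyps by (intro sum.cong refl ea_eqI) (auto simp: c_def algebra_simps)
  then have "(\<Sum>i\<in>insert a I. cst (c i) * v i)
      = cst t * v a + ((\<Sum>i\<in>I. cst (c1 i) * v i) - cst t * (\<Sum>i\<in>I. cst (c0 i) * v i))"
    using insert.hyps by (simp add: sum_subtractf sum_distrib_left c_def)
  then have res: "x - (\<Sum>i\<in>insert a I. cst (c i) * v i) = y - cst t * w"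
    by (simp add: y_def w_def algebra_simps)
  have "ip n (y - cst t * w) (v a) = 0"
  proof (cases "ip n w w = 0")
    case True
    then have "w = 0" using ip_self_eq_0[OF w] by simp
    then have "ip n y (v a) = 0" by (subst vaw) (simp add: ip_sum_right yj)
    then show ?thesis using \<open>w = 0\<close> by simp
  next
    case False
    then show ?thesis by (simp add: ip_minus_left wa t_def)
  qed
  then have "\<forall>j\<in>insert a I. ip n (x - (\<Sum>i\<in>insert a I. cst (c i) * v i)) (v j) = 0"
    unfolding res by (simp add: ip_minus_left yj wj)
  moreover have "\<forall>i\<in>insert a I. c i \<in> \<real>" if x: "real_ea x"
  proof -
    have "real_ea y"
      unfolding y_def using x c1(2)[OF x] insert.prems by (auto intro!: real_ea_minus real_ea_sum real_ea_cst_mult)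
    then have "t \<in> \<real>" unfolding t_def by (intro Reals_divide real_ip va w)
    then show ?thesis using c1(2)[OF x] c0(2) by (auto simp: c_def)
  qed
  ultimately show ?case by blast
qed simp

text \<open>After subtracting the projection to the span, the remainder satisfies the same
  conditions, since products of traces are invariant, and \<open>orth_invariant_eq_0\<close>
  applies. The hypotheses are infinitesimal so that the volume form can be inserted
  directly.\<close>

lemma span_qq:
  assumes x: "supp n x"
    and rot: "\<And>i j. i < n \<Longrightarrow> j < n \<Longrightarrow> rot n i j x = rot n j i x"
    and flip: "\<And>v. v < n \<Longrightarrow> sgn_aut (flip_weight v) x = x"
  shows "\<exists>c. x = (\<Sum>J\<in>Pow {..<ngen n}. cst (c J) * oprod (qq n) J)"
proof -
  let ?Q = "oprod (qq n)"
  obtain c where c: "\<forall>J\<in>Pow {..<ngen n}. ip n (x - (\<Sum>J\<in>Pow {..<ngen n}. cst (c J) * ?Q J)) (?Q J) = 0"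
    using orth_projection[of "Pow {..<ngen n}" ?Q n x] real_ea_oprod_qq supp_oprod_qq by blast
  let ?u = "\<Sum>J\<in>Pow {..<ngen n}. cst (c J) * ?Q J"
  have u: "supp n ?u" by (intro supp_sum supp_cst_mult supp_oprod_qq)
  have au: "ac n g ?u = ?u" if "orth n g" for g
    by (simp add: ac_sum ac_cst_mult ac_oprod_qq[OF that])
  have "x - ?u = 0"
  proof (rule orth_invariant_eq_0[of n])
    show "supp n (x - ?u)" by (rule supp_minus[OF x u])
    show "rot n i j (x - ?u) = rot n j i (x - ?u)" if "i < n" "j < n" for i j
      unfolding rot_minus
      by (rule arg_cong2[of _ _ _ _ minus]) (rule rot[OF that], rule invariant_rot[OF u au that])
    show "sgn_aut (flip_weight v) (x - ?u) = x - ?u" if "v < n" for v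
    proof -
      have "sgn_aut (flip_weight v) (x - ?u) = sgn_aut (flip_weight v) x - sgn_aut (flip_weight v) ?u"
        using sgn_aut_add[of "flip_weight v" x "- ?u"] by (simp only: sgn_aut_uminus diff_conv_add_uminus)
      moreover have "sgn_aut (flip_weight v) ?u = ?u" by (rule invariant_flip[OF u au that])
      ultimately show ?thesis using flip[OF that] by metis
    qed
    show "ip n (x - ?u) (?Q J) = 0" if "J \<subseteq> {..<ngen n}" for J using c that by blast
  qed
  then have "x = ?u" by simp
  then show ?thesis by blast
qed

section \<open>Independence\<close>

definition homogeneous :: "nat \<Rightarrow> ea \<Rightarrow> bool" where
  "homogeneous d x \<longleftrightarrow> (\<forall>S. cf x S \<noteq> 0 \<longrightarrow> card S = d)"

lemma homogeneous_sum: "(\<And>i. i \<in> I \<Longrightarrow> homogeneous d (f i)) \<Longrightarrow> homogeneous d (sum f I)"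
  unfolding homogeneous_def cf_sum by (blast elim: sum.not_neutral_contains_not_neutral)

lemma homogeneous_mult:
  assumes "homogeneous d x" "homogeneous e y"
  shows "homogeneous (d + e) (x * y)"
  unfolding homogeneous_def
proof (intro allI impI)
  fix S assume nz: "cf (x * y) S \<noteq> 0"
  then have S: "finite S" using cf_infinite by blast
  obtain T where T: "T \<in> Pow S" "(-1) ^ inv_count T (S - T) * cf x T * cf y (S - T) \<noteq> 0"
    using nz unfolding cf_mult by (rule sum.not_neutral_contains_not_neutral)
  then have "card T = d" "card (S - T) = e" using assms by (auto simp: homogeneous_def)
  moreover have "card (S - T) = card S - card T" "card T \<le> card S"
    using T(1) S by (auto intro: card_Diff_subset card_mono finite_subset)
  ultimately show "card S = d + e" by simp
qed

lemma homogeneous_1: "homogeneous 0 1" by (simp add: homogeneous_def cf_1)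

lemma homogeneous_an: "homogeneous 1 (an n i j)"
  by (auto simp: homogeneous_def an_def cf_gn split: if_splits)

lemma homogeneous_pw: "homogeneous k (pw n k i j)"
proof (induction k arbitrary: j)
  case 0
  show ?case by (auto simp: mid_def homogeneous_def cf_1)
next
  case (Suc k)
  have "homogeneous (k + 1) (pw n k i l * an n l j)" for l by (rule homogeneous_mult[OF Suc homogeneous_an])
  then show ?case by (auto intro: homogeneous_sum)
qed

lemma homogeneous_oprod_qq:
  assumes "finite J"
  shows "homogeneous (\<Sum>k\<in>J. 4 * k + 3) (oprod (qq n) J)"
  using assms
proof (induction J rule: finite_linorder_min_induct)
  case empty
  show ?case by (simp add: homogeneous_1)
next
  case (insert b A)
  have "homogeneous (4 * b + 3) (qq n b)" unfolding qq_def tr_def by (intro homogeneous_sum homogeneous_pw)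
  moreover have "oprod (qq n) (insert b A) = qq n b * oprod (qq n) A"
    by (rule oprod_insert_min) (use insert.hyps in auto)
  moreover have "(\<Sum>k\<in>insert b A. 4 * k + 3) = (4 * b + 3) + (\<Sum>k\<in>A. 4 * k + 3)"
    using insert.hyps by (subst sum.insert) auto
  ultimately show ?case using homogeneous_mult insert.IH by metis
qed

lemma pairs_Suc: "pairs (Suc n) = pairs n \<union> (\<lambda>i. (i, n)) ` {..<n}"
  by (auto simp: pairs_def less_Suc_eq)

text \<open>The degrees in the list add up to \<open>m (2m + 1)\<close>, the top degree of the
  exterior algebra.\<close>

lemma card_pairs_odd: "card (pairs (2 * m + 1)) = (\<Sum>k<m. 4 * k + 3)"
proof -
  have s: "card (pairs (Suc n)) = card (pairs n) + n" for n
    unfolding pairs_Suc by (subst card_Un_disjoint) (auto simp: pairs_def[of n] card_image inj_on_def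
      simp del: finite_pairs intro: finite_subset[OF _ finite_pairs[of n, unfolded pairs_def]])
  show ?thesis
  proof (induction m)
    case 0
    have "pairs 1 = {}" by (auto simp: pairs_def)
    then show ?case by simp
  next
    case (Suc m)
    have "2 * Suc m + 1 = Suc (Suc (2 * m + 1))" by simp
    then have "card (pairs (2 * Suc m + 1)) = card (pairs (2 * m + 1)) + (2 * m + 1) + Suc (2 * m + 1)"
      by (simp only: s)
    then show ?case unfolding Suc by simp
  qed
qed

text \<open>Each index occurs in \<open>n - 1\<close> generators, so for odd \<open>n\<close> every
  reflection fixes the volume form.\<close>

lemma flip_weight_pairs:
  assumes "v < n"
  shows "(\<Sum>p\<in>pairs n. flip_weight v p) = n - 1"
proof -
  have "(\<Sum>p\<in>pairs n. flip_weight v p) = card {p \<in> pairs n. fst p = v} + card {p \<in> pairs n. snd p = v}"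
    unfolding flip_weight_def sum.distrib card_eq_sum sum.inter_filter[OF finite_pairs] ..
  also have "{p \<in> pairs n. fst p = v} = Pair v ` {v<..<n}" by (auto simp: pairs_def)
  also have "{p \<in> pairs n. snd p = v} = (\<lambda>i. (i, v)) ` {..<v}" using assms by (auto simp: pairs_def)
  finally show ?thesis using assms by (simp add: card_image inj_on_def)
qed

text \<open>A factor \<open>a\<^sub>j\<^sub>k\<close> replaced by \<open>a\<^sub>i\<^sub>k\<close> duplicates a factor of the volume form.\<close>

lemma rot_vol:
  assumes "i < n" "j < n" "i \<noteq> j"
  shows "rot n i j (oprod gn (pairs n)) = 0"
proof -
  let ?v = "oprod gn (pairs n)"
  have z: "gn q * iop p ?v = 0" if "p \<noteq> q" "q \<in> pairs n" for p q
  proof (rule ea_eqI)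
    fix S
    have "q \<notin> insert p (S - {q})" using that(1) by simp
    then have "insert p (S - {q}) \<noteq> pairs n" using that(2) by metis
    then show "cf (gn q * iop p ?v) S = cf 0 S" by (simp add: cf_gn_mult cf_iop cf_oprod_gn)
  qed
  have "an n i k * io j k ?v = 0" if "k < n" for k
    using z assms that by (auto simp: an_def io_def pairs_def)
  then show ?thesis by (simp add: rot_def)
qed

text \<open>The volume form is invariant for odd \<open>n\<close>, hence in the span of the products, and the full product is
  the only one in its degree.\<close>

lemma top_nonzero_odd: "oprod (qq (2 * m + 1)) {..<m} \<noteq> 0"
proof
  define n where "n = 2 * m + 1"
  let ?v = "oprod gn (pairs n)"
  assume "oprod (qq (2 * m + 1)) {..<m} = 0"
  then have z: "oprod (qq n) {..<m} = 0" by (simp only: n_def)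
  have ng: "ngen n = m" by (simp add: ngen_def n_def)
  have cfv: "cf ?v S = (if S = pairs n then 1 else 0)" for S by (rule cf_oprod_gn) simp
  have "\<exists>c. ?v = (\<Sum>J\<in>Pow {..<ngen n}. cst (c J) * oprod (qq n) J)"
  proof (rule span_qq)
    show "supp n ?v" by (auto simp: supp_def cfv)
    show "rot n i j ?v = rot n j i ?v" if "i < n" "j < n" for i j
      using rot_vol[OF that] rot_vol[OF that(2,1)] by (cases "i = j") auto
    show "sgn_aut (flip_weight v) ?v = ?v" if "v < n" for v
    proof -
      have "even (sum (flip_weight v) (pairs n))" using flip_weight_pairs[OF that] by (simp add: n_def)
      then show ?thesis by (intro ea_eqI) (simp add: cfv)
    qed
  qed
  then obtain c where c: "?v = (\<Sum>J\<in>Pow {..<m}. cst (c J) * oprod (qq n) J)" unfolding ng by blast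
  have "cf ?v (pairs n) = 1" by (simp add: cfv)
  then have "(\<Sum>J\<in>Pow {..<m}. c J * cf (oprod (qq n) J) (pairs n)) \<noteq> 0"
    by (subst (asm) c) simp
  then obtain J where J: "J \<in> Pow {..<m}" "c J * cf (oprod (qq n) J) (pairs n) \<noteq> 0"
    by (rule sum.not_neutral_contains_not_neutral)
  have fJ: "finite J" using J(1) by (auto intro: finite_subset)
  have "card (pairs n) = (\<Sum>k\<in>J. 4 * k + 3)"
    using homogeneous_oprod_qq[OF fJ, of n] J(2) by (simp add: homogeneous_def)
  then have e: "(\<Sum>k\<in>J. 4 * k + 3) = (\<Sum>k<m. 4 * k + 3)" by (simp only: card_pairs_odd n_def)
  have "J = {..<m}"
  proof (rule ccontr)
    assume "J \<noteq> {..<m}"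
    then obtain b where b: "b < m" "b \<notin> J" using J(1) by auto
    have "(\<Sum>k\<in>J. 4 * k + 3) < (\<Sum>k<m. 4 * k + 3)"
      by (rule sum_strict_mono2[of _ _ b]) (use J(1) b in auto)
    then show False using e by simp
  qed
  then show False using J(2) z by simp
qed

text \<open>The quotient map that kills all generators outside \<open>pairs n\<close>. From
  dimension \<open>n + 1\<close> it makes the last row and column of \<open>A\<close> zero.\<close>

definition restr :: "nat \<Rightarrow> ea \<Rightarrow> ea" where
  "restr n x = Abs_ea (\<lambda>S. if S \<subseteq> pairs n then cf x S else 0)"

lemma cf_restr: "cf (restr n x) S = (if S \<subseteq> pairs n then cf x S else 0)"
  unfolding restr_def by (subst Abs_ea_inverse) auto

lemma restr_mult: "restr n (x * y) = restr n x * restr n y"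
proof (rule ea_eqI)
  fix S :: "(nat \<times> nat) set"
  show "cf (restr n (x * y)) S = cf (restr n x * restr n y) S"
  proof (cases "S \<subseteq> pairs n")
    case True
    then have "T \<subseteq> pairs n" "S - T \<subseteq> pairs n" if "T \<in> Pow S" for T using that by auto
    then show ?thesis using True unfolding cf_restr cf_mult
      by (simp only: if_True) (intro sum.cong refl, simp)
  next
    case False
    have "cf (restr n x * restr n y) S = 0"
      unfolding cf_mult cf_restr
    proof (rule sum.neutral, rule ballI)
      fix T assume "T \<in> Pow S"
      then have "\<not> T \<subseteq> pairs n \<or> \<not> S - T \<subseteq> pairs n" using False by blast
      then show "(-1) ^ inv_count T (S - T) * (if T \<subseteq> pairs n then cf x T else 0) *
          (if S - T \<subseteq> pairs n then cf y (S - T) else 0) = 0" by auto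
    qed
    then show ?thesis using False by (simp add: cf_restr)
  qed
qed

lemma restr_sum: "restr n (sum f I) = (\<Sum>i\<in>I. restr n (f i))"
  by (rule ea_eqI) (simp add: cf_restr)

lemma restr_1: "restr n 1 = 1"
  by (rule ea_eqI) (simp add: cf_restr cf_1)

lemma restr_0: "restr n 0 = 0"
  by (rule ea_eqI) (simp add: cf_restr)

lemma restr_an: "restr n (an (Suc n) i j) = an n i j"
  by (rule ea_eqI) (auto simp: cf_restr an_def cf_gn pairs_def)

text \<open>Stated for positive exponents: the identity matrix of size \<open>n + 1\<close> does not
  restrict to that of size \<open>n\<close>.\<close>

lemma restr_pw: "restr n (pw (Suc n) (Suc k) i j) = pw n (Suc k) i j"
proof (induction k arbitrary: j)
  case 0
  show ?case unfolding pw_1 by (rule restr_an)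
next
  case (Suc k)
  have "restr n (pw (Suc n) (Suc (Suc k)) i j) = (\<Sum>l<Suc n. pw n (Suc k) i l * an n l j)"
    unfolding pw.simps(2)[of "Suc n" "Suc k"] restr_sum restr_mult restr_an Suc ..
  also have "\<dots> = pw n (Suc (Suc k)) i j"
  proof -
    have "an n n j = 0" by (auto simp: an_def)
    then show ?thesis unfolding pw.simps(2)[of n "Suc k"] sum.lessThan_Suc by (simp only: mult_zero_right add_0_right)
  qed
  finally show ?case .
qed

lemma restr_qq: "restr n (qq (Suc n) k) = qq n k"
proof -
  have e: "4 * k + 3 = Suc (4 * k + 2)" by simp
  have p: "pw n l n n = 0" for l by (rule pw_outside) simp
  show ?thesis
    unfolding qq_def tr_def restr_sum e restr_pw
    unfolding sum.lessThan_Suc p by (rule add_0_right)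
qed

lemma restr_oprod_qq: "restr n (oprod (qq (Suc n)) J) = oprod (qq n) J"
proof -
  have "restr n (prod_list (map (qq (Suc n)) xs)) = prod_list (map (qq n) xs)" for xs
    by (induction xs) (simp_all add: restr_1 restr_mult restr_qq)
  then show ?thesis by (simp add: oprod_def)
qed

lemma top_nonzero: "oprod (qq n) {..<ngen n} \<noteq> 0"
proof (cases "even n")
  case False
  then obtain m where "n = 2 * m + 1" by (auto elim: oddE)
  then show ?thesis using top_nonzero_odd[of m] by (simp add: ngen_def)
next
  case True
  show ?thesis
  \<comment> \<open>For \<open>n = 2 * m + 2\<close> the list has the same length \<open>m\<close>
    as for \<open>2 * m + 1\<close>, so a vanishing full product would restrict to a vanishing one
    there. For \<open>n = 0\<close> truncated subtraction makes the list empty.\<close>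
  proof (cases "n = 0")
    case False
    then obtain m where n: "n = Suc (2 * m + 1)" using True
      by (metis Suc_double_not_eq_double add.commute even_Suc evenE not0_implies_Suc oddE plus_1_eq_Suc)
    have "restr (2 * m + 1) (oprod (qq n) {..<m}) \<noteq> 0"
      unfolding n restr_oprod_qq by (rule top_nonzero_odd)
    then have "oprod (qq n) {..<m} \<noteq> 0" using restr_0 by metis
    then show ?thesis by (simp add: n ngen_def)
  qed (simp add: ngen_def)
qed

text \<open>Multiplying a relation by the product over the complement of \<open>J\<close> kills every term not contained in \<open>J\<close>.\<close>

lemma independent_qq:
  assumes z: "(\<Sum>J\<in>Pow {..<ngen n}. cst (c J) * oprod (qq n) J) = 0" and J: "J \<subseteq> {..<ngen n}"
  shows "c J = 0"
proof -
  let ?F = "{..<ngen n}" and ?Q = "oprod (qq n)"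
  have fin: "finite K" if "K \<subseteq> ?F" for K using that by (rule finite_subset) simp
  have mul: "?Q K * ?Q L = (if K \<inter> L = {} then (-1) ^ invs K L * ?Q (K \<union> L) else 0)"
    if "K \<subseteq> ?F" "L \<subseteq> ?F" for K L
    by (rule oprod_mult[where G = "qq n", OF qq_anticomm fin[OF that(1)] fin[OF that(2)]])
  show ?thesis
    using J
  proof (induction "card J" arbitrary: J rule: less_induct)
    case less
    have "0 = (\<Sum>K\<in>Pow ?F. cst (c K) * ?Q K) * ?Q (?F - J)" unfolding z by simp
    also have "\<dots> = (\<Sum>K\<in>Pow ?F. cst (c K) * (?Q K * ?Q (?F - J)))"
      by (simp only: sum_distrib_right mult.assoc)
    also have "\<dots> = (\<Sum>K\<in>Pow ?F. if K = J then cst (c J) * ((-1) ^ invs J (?F - J) * ?Q ?F) else 0)"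
    proof (rule sum.cong[OF refl])
      fix K assume "K \<in> Pow ?F"
      then have K: "K \<subseteq> ?F" by simp
      show "cst (c K) * (?Q K * ?Q (?F - J)) = (if K = J then cst (c J) * ((-1) ^ invs J (?F - J) * ?Q ?F) else 0)"
      proof (cases "K \<subseteq> J")
        case True
        show ?thesis
        proof (cases "K = J")
          case True
          have "J \<union> (?F - J) = ?F" using less.prems by auto
          then show ?thesis using True mul[OF less.prems, of "?F - J"] by simp
        next
          case False
          \<comment> \<open>Proper subsets of \<open>J\<close> survive the multiplication by the
            complementary product; their coefficients are zero by the induction on the size of
            \<open>J\<close>.\<close>
          then have "card K < card J" using True fin[OF less.prems] by (intro psubset_card_mono) auto
          then have "c K = 0" using less.hyps K by blast
          then show ?thesis using False by simp
        qed
      next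
        case False
        then have "K \<inter> (?F - J) \<noteq> {}" "K \<noteq> J" using K by auto
        then show ?thesis using mul[OF K, of "?F - J"] by simp
      qed
    qed
    also have "\<dots> = cst (c J) * ((-1) ^ invs J (?F - J) * ?Q ?F)" using less.prems by (simp add: sum.delta)
    finally have e: "cst (c J) * ((-1) ^ invs J (?F - J) * ?Q ?F) = 0" by simp
    show ?case
    proof (rule ccontr)
      assume "c J \<noteq> 0"
      then have "(-1) ^ invs J (?F - J) * ?Q ?F = 0" using cst_mult_eq_0[OF e] by simp
      then show False using top_nonzero[of n] by (cases "even (invs J (?F - J))") auto
    qed
  qed
qed

section \<open>Transfer to coefficient functions\<close>

lemma cf_Abs_elem:
  assumes "Defs.elem n x"
  shows "cf (Abs_ea x) = x"
proof -
  have "x S = 0" if "infinite S" for S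
  proof -
    have "\<not> S \<subseteq> pairs n" using that finite_subset[of S "pairs n"] finite_pairs by blast
    then show ?thesis using assms unfolding Defs.elem_def by blast
  qed
  then show ?thesis by (intro Abs_ea_inverse) simp
qed

lemma elem_cf: "Defs.elem n (cf x) = supp n x"
  by (simp add: Defs.elem_def supp_def)

lemma emul_cf: "emul (cf x) (cf y) = cf (x * y)"
  by (simp add: times_ea.rep_eq)

lemma eneg_cf: "eneg (cf x) = cf (- x)"
  by (simp add: uminus_ea.rep_eq)

lemma escale_cf: "escale c (cf x) = cf (cst c * x)"
  by (intro ext) (simp add: escale_def)

lemma esum_cf: "esum I (\<lambda>i. cf (f i)) = cf (sum f I)"
  by (intro ext) (simp add: esum_def)

lemma ezero_cf: "ezero = cf 0"
  by (intro ext) (simp add: ezero_def)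

lemma eprod_cf: "eprod (map (\<lambda>i. cf (F i)) xs) = cf (prod_list (map F xs))"
  by (induction xs) (simp_all add: eprod_def one_ea.rep_eq emul_cf)

lemma agen_cf: "i < n \<Longrightarrow> j < n \<Longrightarrow> agen i j = cf (an n i j)"
  by (intro ext) (auto simp: agen_def an_def cf_gn)

lemma mpow_cf: "i < n \<Longrightarrow> j < n \<Longrightarrow> mpow n agen k i j = cf (pw n k i j)"
proof (induction k arbitrary: j)
  case 0
  then show ?case by (auto simp: mone_def mid_def one_ea.rep_eq ezero_cf[symmetric])
next
  case (Suc k)
  have "esum {..<n} (\<lambda>l. emul (mpow n agen k i l) (agen l j)) = esum {..<n} (\<lambda>l. cf (pw n k i l * an n l j))"
    unfolding esum_def using Suc by (intro ext sum.cong refl) (simp add: agen_cf emul_cf)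
  then show ?case by (simp add: mmul_def esum_cf)
qed

lemma gq_cf: "gq n = (\<lambda>k. cf (qq n k))"
proof
  fix k
  have "gq n k = esum {..<n} (\<lambda>i. cf (pw n (4 * k + 3) i i))"
    unfolding gq_def qtr_def mtrace_def esum_def by (intro ext sum.cong refl) (simp add: mpow_cf del: mpow.simps pw.simps)
  then show "gq n k = cf (qq n k)" unfolding esum_cf qq_def tr_def .
qed

lemma qprod_cf: "qprod n J = cf (oprod (qq n) J)"
  unfolding qprod_def gq_cf eprod_cf oprod_def ..

lemma gimg_cf: "gimg n g = (\<lambda>p. cf (gm n g p))"
proof
  fix p
  have "gimg n g p = esum ({..<n} \<times> {..<n}) (\<lambda>q. cf (cst (g (fst q) (fst p) * g (snd q) (snd p)) * an n (fst q) (snd q)))"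
    unfolding gimg_def esum_def
    by (intro ext sum.cong refl) (auto simp: agen_cf[of _ n] escale_cf)
  then show "gimg n g p = cf (gm n g p)"
    unfolding esum_cf gm_def sum.cartesian_product by (simp add: case_prod_unfold)
qed

lemma act_cf: "act n g (cf x) = cf (ac n g x)"
  unfolding act_def ac_def gimg_cf eprod_cf escale_cf esum_cf oprod_def ..

lemma invariant_cf: "invariant n (cf x) \<longleftrightarrow> supp n x \<and> (\<forall>g. orth n g \<longrightarrow> ac n g x = x)"
  unfolding invariant_def elem_cf act_cf cf_inject ..

lemma esum_qprod_cf:
  "esum I (\<lambda>J. escale (c J) (qprod n J)) = cf (\<Sum>J\<in>I. cst (c J) * oprod (qq n) J)"
  unfolding qprod_cf escale_cf esum_cf ..

theorem theorem4p5:
  fixes n :: nat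
  shows "(\<forall>k < ngen n. invariant n (gq n k))
    \<and> (\<forall>i < ngen n. \<forall>j < ngen n. emul (gq n i) (gq n j) = eneg (emul (gq n j) (gq n i)))
    \<and> (\<forall>J \<subseteq> {..<ngen n}. invariant n (qprod n J))
    \<and> (\<forall>c :: nat set \<Rightarrow> complex.
         esum (Pow {..<ngen n}) (\<lambda>J. escale (c J) (qprod n J)) = ezero
         \<longrightarrow> (\<forall>J \<subseteq> {..<ngen n}. c J = 0))
    \<and> (\<forall>x. invariant n x \<longrightarrow>
         (\<exists>c :: nat set \<Rightarrow> complex. x = esum (Pow {..<ngen n}) (\<lambda>J. escale (c J) (qprod n J))))"
proof (intro conjI allI impI)
  show "invariant n (gq n k)" for k
    unfolding gq_cf invariant_cf using supp_qq ac_tr by (auto simp: qq_def)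
  show "emul (gq n i) (gq n j) = eneg (emul (gq n j) (gq n i))" for i j
    unfolding gq_cf emul_cf eneg_cf using qq_anticomm[of n i j] by simp
  show "invariant n (qprod n J)" for J
    unfolding qprod_cf invariant_cf using supp_oprod_qq ac_oprod_qq by blast
  show "c J = 0" if "esum (Pow {..<ngen n}) (\<lambda>J. escale (c J) (qprod n J)) = ezero" "J \<subseteq> {..<ngen n}" for c J
    using that independent_qq[of c n J] unfolding esum_qprod_cf ezero_cf cf_inject by blast
  fix x assume x: "invariant n x"
  then have e: "cf (Abs_ea x) = x" by (intro cf_Abs_elem[of n]) (simp add: invariant_def)
  then have i: "supp n (Abs_ea x)" "\<And>g. orth n g \<Longrightarrow> ac n g (Abs_ea x) = Abs_ea x"
    using x invariant_cf[of n "Abs_ea x"] by auto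
  obtain c where "Abs_ea x = (\<Sum>J\<in>Pow {..<ngen n}. cst (c J) * oprod (qq n) J)"
    using span_qq[OF i(1) invariant_rot[OF i] invariant_flip[OF i]] by blast
  then have "x = esum (Pow {..<ngen n}) (\<lambda>J. escale (c J) (qprod n J))"
    unfolding esum_qprod_cf using e by metis
  then show "\<exists>c. x = esum (Pow {..<ngen n}) (\<lambda>J. escale (c J) (qprod n J))" by blast
qed

end
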